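(* Let $a,T\in\mathcal{A}$ be freely independent with $T$ R-diagonal, let $z\in\mathbb{C}$, and let $(a_n)_{n\ge1}$ be a sequence in $\mathcal{A}$ with $\sup_n\|a_n\|<\infty$ which converges to $a$ in $*$-moments as $n\to\infty$. Put $\mu_1=\widetilde\mu_{|a-z|}$, $\mu_2=\widetilde\mu_{|T|}$, and $\mu_1^{(n)}=\widetilde\mu_{|a_n-z|}$. Assume that (a) $\operatorname{supp}(\mu_{a+T})=\operatorname{spec}(a+T)$, where $\mu_{a+T}$ is the Brown measure of $a+T$; (b) $z\in\Theta_{\rm out}$, i.e. $m_2(\mu_2)<1/m_{-2}(\mu_1)$; (c) there exists $\eta>0$ such that $[-\eta,\eta]\cap\operatorname{supp}(\mu_1^{(n)})=\emptyset$ for all large $n$. Then there exists $\varepsilon>0$ such that $[-\varepsilon,\varepsilon]\cap\operatorname{supp}(\mu_1^{(n)}\boxplus\mu_2)=\emptyset$ for all large $n$.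
   Context: $(\mathcal{A},\tau)$ is a finite von Neumann algebra with a faithful normal tracial state. For a positive $x\in\mathcal{A}$, $\mu_x$ is its spectral distribution under $\tau$, and $\widetilde\nu(B)=\frac12[\nu(B)+\nu(-B)]$ is the symmetrization of a measure $\nu$ on $\mathbb{R}$. For a probability measure $\nu$ on $\mathbb{R}$, $m_{p}(\nu)=\int|t|^{p}\,d\nu(t)\in[0,\infty]$ for $p=2,-2$ ($1/\infty=0$). $\boxplus$ is free additive convolution. The Brown measure $\mu_x$ of $x\in\mathcal{A}$ is the unique probability measure on $\mathbb{C}$ with $\log\Delta(x-w)=\int\log|\lambda-w|\,d\mu_x(\lambda)$ for $w\in\mathbb{C}$, where $\Delta(y)=\exp\left(\int_0^\infty\log t\,d\mu_{|y|}(t)\right)$. $\operatorname{spec}$ is the spectrum in $\mathcal{A}$. $T$ is R-diagonal if it has the same $*$-moments as $uh$ with $u$ a Haar unitary, $h\geq 0$, and $u,h$ freely independent. *)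

theory Defs
  imports "HOL-Probability.Probability" "HOL-Computational_Algebra.Polynomial"
begin

section \<open>Bounded operators on a complex Hilbert space\<close>

text \<open>
  The inner product is conjugate-linear in the first argument. Its real part is the
  inner product of \<^class>\<open>real_inner\<close>, so the norm is the Hilbert space norm.
\<close>

class complex_hilbert = real_inner + complete_space +
  fixes scaleC :: "complex \<Rightarrow> 'a \<Rightarrow> 'a"  (infixr "*\<^sub>C" 75)
    and cinner :: "'a \<Rightarrow> 'a \<Rightarrow> complex"
  assumes scaleC_add_right: "c *\<^sub>C (x + y) = c *\<^sub>C x + c *\<^sub>C y"
    and scaleC_add_left: "(c + d) *\<^sub>C x = c *\<^sub>C x + d *\<^sub>C x"
    and scaleC_scaleC: "c *\<^sub>C (d *\<^sub>C x) = (c * d) *\<^sub>C x"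
    and scaleR_scaleC: "r *\<^sub>R x = complex_of_real r *\<^sub>C x"
    and cinner_commute: "cinner x y = cnj (cinner y x)"
    and cinner_add_right: "cinner x (y + z) = cinner x y + cinner x z"
    and cinner_scaleC_right: "cinner x (c *\<^sub>C y) = c * cinner x y"
    and inner_eq_Re_cinner: "inner x y = Re (cinner x y)"

lemma bounded_linear_scaleC: "bounded_linear (\<lambda>x::'h::complex_hilbert. c *\<^sub>C x)"
proof (rule bounded_linear_intro[where K = "cmod c"])
  fix x y :: 'h and r :: real
  show "c *\<^sub>C (x + y) = c *\<^sub>C x + c *\<^sub>C y" by (rule scaleC_add_right)
  show "c *\<^sub>C (r *\<^sub>R x) = r *\<^sub>R (c *\<^sub>C x)"
    by (simp add: scaleR_scaleC scaleC_scaleC mult.commute)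
  have "cinner (c *\<^sub>C x) (c *\<^sub>C x) = c * cnj c * cinner x x"
    by (metis (no_types, opaque_lifting) cinner_commute cinner_scaleC_right
        complex_cnj_mult mult.assoc)
  also have "\<dots> = complex_of_real ((cmod c)\<^sup>2) * cinner x x"
    by (simp only: complex_norm_square)
  finally have "inner (c *\<^sub>C x) (c *\<^sub>C x) = (cmod c)\<^sup>2 * inner x x"
    by (simp add: inner_eq_Re_cinner)
  then have "(norm (c *\<^sub>C x))\<^sup>2 = (norm x * cmod c)\<^sup>2"
    by (simp add: power2_norm_eq_inner power_mult_distrib)
  then show "norm (c *\<^sub>C x) \<le> norm x * cmod c"
    by (metis norm_ge_zero mult_nonneg_nonneg order_refl power2_eq_imp_eq)
qed

text \<open>
  Operators are the real-linear bounded maps \<open>'h \<Rightarrow>\<^sub>L 'h\<close> of the library that are in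
  addition complex-linear; the norm of \<open>'h \<Rightarrow>\<^sub>L 'h\<close> is the operator norm.
\<close>

type_synonym 'h oper = "'h \<Rightarrow>\<^sub>L 'h"

definition clinear_op :: "'h::complex_hilbert oper \<Rightarrow> bool" where
  "clinear_op x \<longleftrightarrow> (\<forall>c \<xi>. x (c *\<^sub>C \<xi>) = c *\<^sub>C x \<xi>)"

lift_definition scalar_op :: "complex \<Rightarrow> 'h::complex_hilbert oper" is "\<lambda>c \<xi>. c *\<^sub>C \<xi>"
  by (rule bounded_linear_scaleC)

definition is_adjoint :: "'h::complex_hilbert oper \<Rightarrow> 'h oper \<Rightarrow> bool" where
  "is_adjoint x y \<longleftrightarrow> (\<forall>\<xi> \<zeta>. cinner (y \<xi>) \<zeta> = cinner \<xi> (x \<zeta>))"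

definition adj :: "'h::complex_hilbert oper \<Rightarrow> 'h oper" where
  "adj x = (THE y. is_adjoint x y)"

definition positive_op :: "'h::complex_hilbert oper \<Rightarrow> bool" where
  "positive_op x \<longleftrightarrow> clinear_op x \<and> (\<forall>\<xi>. cinner \<xi> (x \<xi>) \<in> \<real>\<^sub>\<ge>\<^sub>0)"

definition le_op :: "'h::complex_hilbert oper \<Rightarrow> 'h oper \<Rightarrow> bool" where
  "le_op x y \<longleftrightarrow> positive_op (y - x)"

definition op_prod :: "'h::complex_hilbert oper list \<Rightarrow> 'h oper" where
  "op_prod xs = foldr (o\<^sub>L) xs id_blinfun"

definition op_power :: "'h::complex_hilbert oper \<Rightarrow> nat \<Rightarrow> 'h oper" where
  "op_power x n = op_prod (replicate n x)"

text \<open>The modulus \<open>|x|\<close> is the positive square root of \<open>x\<^sup>* x\<close>.\<close>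

definition op_abs :: "'h::complex_hilbert oper \<Rightarrow> 'h oper" where
  "op_abs x = (THE h. positive_op h \<and> h o\<^sub>L h = adj x o\<^sub>L x)"


section \<open>Von Neumann algebras with a faithful normal tracial state\<close>

definition commutant :: "'h::complex_hilbert oper set \<Rightarrow> 'h oper set" where
  "commutant S = {y. clinear_op y \<and> (\<forall>x\<in>S. x o\<^sub>L y = y o\<^sub>L x)}"

definition von_neumann_algebra :: "'h::complex_hilbert oper set \<Rightarrow> bool" where
  "von_neumann_algebra M \<longleftrightarrow>
     (\<forall>x\<in>M. clinear_op x) \<and>
     (\<forall>x\<in>M. \<exists>y\<in>M. is_adjoint x y) \<and>
     commutant (commutant M) = M"

text \<open>
  Only the values of \<open>\<tau>\<close> on \<open>M\<close> matter. Finiteness of \<open>M\<close> is implied by the existence of a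
  faithful tracial state. Normality is preservation of suprema of
  upward directed sets of positive elements.
\<close>

locale tracial_vN_algebra =
  fixes M :: "'h::complex_hilbert oper set" and \<tau> :: "'h oper \<Rightarrow> complex"
  assumes von_neumann: "von_neumann_algebra M"
    and trace_add: "\<And>x y. x \<in> M \<Longrightarrow> y \<in> M \<Longrightarrow> \<tau> (x + y) = \<tau> x + \<tau> y"
    and trace_scalar: "\<And>c x. x \<in> M \<Longrightarrow> \<tau> (scalar_op c o\<^sub>L x) = c * \<tau> x"
    and trace_one: "\<tau> id_blinfun = 1"
    and trace_positive: "\<And>x. x \<in> M \<Longrightarrow> positive_op x \<Longrightarrow> \<tau> x \<in> \<real>\<^sub>\<ge>\<^sub>0"
    and trace_faithful: "\<And>x. x \<in> M \<Longrightarrow> positive_op x \<Longrightarrow> \<tau> x = 0 \<Longrightarrow> x = 0"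
    and trace_commute: "\<And>x y. x \<in> M \<Longrightarrow> y \<in> M \<Longrightarrow> \<tau> (x o\<^sub>L y) = \<tau> (y o\<^sub>L x)"
    and trace_normal: "\<And>D s. D \<subseteq> M \<Longrightarrow> D \<noteq> {} \<Longrightarrow> \<forall>x\<in>D. positive_op x \<Longrightarrow>
          \<forall>x\<in>D. \<forall>y\<in>D. \<exists>v\<in>D. le_op x v \<and> le_op y v \<Longrightarrow>
          s \<in> M \<Longrightarrow> \<forall>x\<in>D. le_op x s \<Longrightarrow>
          \<forall>t\<in>M. (\<forall>x\<in>D. le_op x t) \<longrightarrow> le_op s t \<Longrightarrow>
          Re (\<tau> s) = (SUP x\<in>D. Re (\<tau> x))"

definition op_spectrum :: "'h::complex_hilbert oper set \<Rightarrow> 'h oper \<Rightarrow> complex set" where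
  "op_spectrum M x = {w. \<not> (\<exists>y\<in>M. y o\<^sub>L (x - scalar_op w) = id_blinfun \<and>
                                 (x - scalar_op w) o\<^sub>L y = id_blinfun)}"


section \<open>Star-moments, freeness, R-diagonal elements\<close>

text \<open>A star-word is a list of booleans, where \<^const>\<open>True\<close> stands for the adjoint.\<close>

definition star_word :: "'h::complex_hilbert oper \<Rightarrow> bool list \<Rightarrow> 'h oper" where
  "star_word x w = op_prod (map (\<lambda>b. if b then adj x else x) w)"

inductive_set star_algebra :: "'h::complex_hilbert oper \<Rightarrow> 'h oper set"
  for x :: "'h oper" where
  gen: "x \<in> star_algebra x"
| one: "id_blinfun \<in> star_algebra x"
| add: "y \<in> star_algebra x \<Longrightarrow> v \<in> star_algebra x \<Longrightarrow> y + v \<in> star_algebra x"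
| scalar: "y \<in> star_algebra x \<Longrightarrow> scalar_op c o\<^sub>L y \<in> star_algebra x"
| mult: "y \<in> star_algebra x \<Longrightarrow> v \<in> star_algebra x \<Longrightarrow> y o\<^sub>L v \<in> star_algebra x"
| adj: "y \<in> star_algebra x \<Longrightarrow> adj y \<in> star_algebra x"

text \<open>
  Free independence of two elements is freeness of the unital star-algebras they generate:
  alternating products of centred elements are centred. The boolean tags record which of the
  two algebras each factor is taken from.
\<close>

definition freely_independent ::
    "('h::complex_hilbert oper \<Rightarrow> complex) \<Rightarrow> 'h oper \<Rightarrow> 'h oper \<Rightarrow> bool" where
  "freely_independent \<tau> x y \<longleftrightarrow>
     (\<forall>xs. xs \<noteq> [] \<and> distinct_adj (map fst xs) \<and>
        (\<forall>(i, v)\<in>set xs. v \<in> star_algebra (if i then x else y) \<and> \<tau> v = 0)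
        \<longrightarrow> \<tau> (op_prod (map snd xs)) = 0)"

definition haar_unitary :: "('h::complex_hilbert oper \<Rightarrow> complex) \<Rightarrow> 'h oper \<Rightarrow> bool" where
  "haar_unitary \<tau> u \<longleftrightarrow> adj u o\<^sub>L u = id_blinfun \<and> u o\<^sub>L adj u = id_blinfun \<and>
     (\<forall>n\<ge>1. \<tau> (op_power u n) = 0)"

text \<open>
  The elements \<open>u\<close> and \<open>h\<close> may live in a different tracial von Neumann algebra, acting on a
  different Hilbert space, whose type is passed as a parameter because HOL has no
  quantification over types. In the hypothesis of a theorem that is polymorphic in \<open>'k\<close>,
  \<open>R_diagonal TYPE('k) \<tau> T\<close> says that \<open>u\<close> and \<open>h\<close> exist on some Hilbert space.
\<close>

definition R_diagonal ::
    "'k::complex_hilbert itself \<Rightarrow> ('h::complex_hilbert oper \<Rightarrow> complex) \<Rightarrow> 'h oper \<Rightarrow> bool" where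
  "R_diagonal _ \<tau> T \<longleftrightarrow>
     (\<exists>(N :: 'k oper set) \<sigma> u h.
        tracial_vN_algebra N \<sigma> \<and> u \<in> N \<and> h \<in> N \<and>
        haar_unitary \<sigma> u \<and> positive_op h \<and> freely_independent \<sigma> u h \<and>
        (\<forall>w. \<tau> (star_word T w) = \<sigma> (star_word (u o\<^sub>L h) w)))"

definition converges_in_star_moments ::
    "('h::complex_hilbert oper \<Rightarrow> complex) \<Rightarrow> (nat \<Rightarrow> 'h oper) \<Rightarrow> 'h oper \<Rightarrow> bool" where
  "converges_in_star_moments \<tau> a_seq a \<longleftrightarrow>
     (\<forall>w. (\<lambda>n. \<tau> (star_word (a_seq n) w)) \<longlonglongrightarrow> \<tau> (star_word a w))"


section \<open>Spectral distributions and the Brown measure\<close>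

definition msupp :: "'a::topological_space measure \<Rightarrow> 'a set" where
  "msupp \<mu> = {t. \<forall>U. open U \<and> t \<in> U \<longrightarrow> emeasure \<mu> U > 0}"

definition compact_prob :: "real measure \<Rightarrow> bool" where
  "compact_prob \<mu> \<longleftrightarrow> prob_space \<mu> \<and> sets \<mu> = sets borel \<and> (\<exists>R. AE t in \<mu>. \<bar>t\<bar> \<le> R)"

definition spectral_distribution ::
    "('h::complex_hilbert oper \<Rightarrow> complex) \<Rightarrow> 'h oper \<Rightarrow> real measure" where
  "spectral_distribution \<tau> x =
     (THE \<mu>. compact_prob \<mu> \<and> (\<forall>n. complex_of_real (\<integral>t. t ^ n \<partial>\<mu>) = \<tau> (op_power x n)))"

definition symmetrization :: "real measure \<Rightarrow> real measure" where
  "symmetrization \<nu> =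
     measure_of UNIV (sets borel) (\<lambda>B. (emeasure \<nu> B + emeasure \<nu> (uminus ` B)) / 2)"

text \<open>In \<^typ>\<open>ennreal\<close> one has \<open>0 powi (-2) = \<infinity>\<close>, so an atom at 0 makes \<open>m\<^sub>-\<^sub>2\<close> infinite.\<close>

definition abs_moment :: "int \<Rightarrow> real measure \<Rightarrow> ennreal" where
  "abs_moment p \<nu> = (\<integral>\<^sup>+ t. ennreal \<bar>t\<bar> powi p \<partial>\<nu>)"

text \<open>
  Logarithmic integrals take the value \<open>-\<infinity>\<close>, so the convention \<open>ln 0 = 0\<close> of the library must
  be avoided. If both parts of the integral below are infinite, its value is \<open>\<infinity>\<close>; such a
  measure never satisfies the equation defining the Brown measure, whose left-hand side is
  less than \<open>\<infinity>\<close>.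
\<close>

definition elog :: "real \<Rightarrow> ereal" where
  "elog t = (if t \<le> 0 then -\<infinity> else ereal (ln t))"

definition ext_integral :: "'a measure \<Rightarrow> ('a \<Rightarrow> ereal) \<Rightarrow> ereal" where
  "ext_integral \<mu> f =
     enn2ereal (\<integral>\<^sup>+ t. e2ennreal (f t) \<partial>\<mu>) - enn2ereal (\<integral>\<^sup>+ t. e2ennreal (- f t) \<partial>\<mu>)"

definition FK_det :: "('h::complex_hilbert oper \<Rightarrow> complex) \<Rightarrow> 'h oper \<Rightarrow> real" where
  "FK_det \<tau> y =
     (let L = ext_integral (spectral_distribution \<tau> (op_abs y)) elog
      in if L = -\<infinity> then 0 else exp (real_of_ereal L))"

definition brown_measure ::
    "('h::complex_hilbert oper \<Rightarrow> complex) \<Rightarrow> 'h oper \<Rightarrow> complex measure" where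
  "brown_measure \<tau> x =
     (THE \<mu>. prob_space \<mu> \<and> sets \<mu> = sets borel \<and>
        (\<forall>w. elog (FK_det \<tau> (x - scalar_op w)) = ext_integral \<mu> (\<lambda>l. elog (cmod (l - w)))))"


section \<open>Free additive convolution of compactly supported measures\<close>

text \<open>
  A linear functional on the free algebra \<open>\<complex>\<langle>X, Y\<rangle>\<close> is given by its values \<open>\<phi> w\<close> on the words
  \<open>w\<close> in the letters \<open>X\<close> (\<^const>\<open>True\<close>) and \<open>Y\<close> (\<^const>\<open>False\<close>).
  \<open>word_poly_ev \<phi> w [(i1, p1), ..., (ik, pk)]\<close> is the value of its linear extension on the
  product \<open>w p1(Z\<^bsub>i1\<^esub>) \<dots> pk(Z\<^bsub>ik\<^esub>)\<close> with \<open>Z\<^bsub>True\<^esub> = X\<close> and \<open>Z\<^bsub>False\<^esub> = Y\<close>.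
\<close>

primrec word_poly_ev ::
    "(bool list \<Rightarrow> complex) \<Rightarrow> bool list \<Rightarrow> (bool \<times> complex poly) list \<Rightarrow> complex" where
  "word_poly_ev \<phi> w [] = \<phi> w"
| "word_poly_ev \<phi> w (q # qs) =
     (\<Sum>j\<le>degree (snd q). coeff (snd q) j * word_poly_ev \<phi> (w @ replicate j (fst q)) qs)"

text \<open>
  \<open>\<phi>\<close> is the joint law of free variables \<open>X\<close>, \<open>Y\<close> with distributions \<open>\<mu>\<close>, \<open>\<nu>\<close>.
\<close>

definition free_joint_law ::
    "real measure \<Rightarrow> real measure \<Rightarrow> (bool list \<Rightarrow> complex) \<Rightarrow> bool" where
  "free_joint_law \<mu> \<nu> \<phi> \<longleftrightarrow>
     (\<forall>n. \<phi> (replicate n True) = complex_of_real (\<integral>t. t ^ n \<partial>\<mu>)) \<and>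
     (\<forall>n. \<phi> (replicate n False) = complex_of_real (\<integral>t. t ^ n \<partial>\<nu>)) \<and>
     (\<forall>qs. qs \<noteq> [] \<and> distinct_adj (map fst qs) \<and>
        (\<forall>q\<in>set qs. word_poly_ev \<phi> [] [q] = 0)
        \<longrightarrow> word_poly_ev \<phi> [] qs = 0)"

text \<open>
  The distribution of \<open>X + Y\<close>; its \<open>n\<close>-th moment \<open>\<phi> ((X + Y)\<^sup>n)\<close> is the sum of \<open>\<phi>\<close> over
  all words of length \<open>n\<close>.
\<close>

definition free_add_conv :: "real measure \<Rightarrow> real measure \<Rightarrow> real measure"  (infixl "\<boxplus>" 65) where
  "\<mu> \<boxplus> \<nu> =
     (THE \<rho>. compact_prob \<rho> \<and>
        (\<exists>\<phi>. free_joint_law \<mu> \<nu> \<phi> \<and>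
           (\<forall>n. complex_of_real (\<integral>t. t ^ n \<partial>\<rho>) = (\<Sum>w | length w = n. \<phi> w))))"

end

theory Submission
  imports Defs "HOL-Library.Poly_Mapping"
begin

text \<open>
  Let \<open>X\<close>, \<open>Y\<close> be free with symmetric distributions \<open>\<mu>\<close>, \<open>\<nu>\<close>. If \<open>\<mu>\<close> has a gap at \<open>0\<close> then \<open>X\<close> is
  invertible and \<open>X + Y = (1 + Y X\<^sup>-\<^sup>1) X\<close>. By symmetry \<open>Y\<close> and \<open>X\<^sup>-\<^sup>1\<close> are centred, so \<open>(Y X\<^sup>-\<^sup>1)\<^sup>k\<close> is a
  reduced word, and a Haagerup-type inequality on the free Fock space bounds its norm by a multiple
  of \<open>k q\<^sup>k\<close> with \<open>q\<^sup>2 = m\<^sub>2(\<nu>) m\<^sub>-\<^sub>2(\<mu>)\<close>. Thus \<open>q < 1\<close> forces a gap of \<open>\<mu> \<boxplus> \<nu>\<close> at \<open>0\<close> whose size depends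
  only on \<open>q\<close>, the gap of \<open>\<mu>\<close> and a bound for the supports. For \<open>\<mu> = \<mu>1_seq n\<close> the uniform gap makes
  \<open>m\<^sub>-\<^sub>2(\<mu>)\<close> the integral of one fixed continuous function, so its limit is at most \<open>m\<^sub>-\<^sub>2(\<mu>1)\<close> and
  \<open>q\<close> stays below \<open>1\<close>. The Fock space is built for finitely supported approximations of the two
  measures; the joint law and the gap pass to the limit through moments.
\<close>

section \<open>Compactly supported measures and their moments\<close>

text \<open>The gain is that a centred letter acts by its L^2 norm except where it replaces another
  letter; hence some power of \<open>Y X^-1\<close> has norm at most 1/2, which already bounds
  \<open>1 + Y X^-1\<close> from below.

  The operation \<open>\<boxplus>\<close> is given by a definite description, so nothing is known
  about its support until the described measure has been constructed. It is obtained from a positive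
  functional on polynomials by solving the Hausdorff moment problem. Accordingly the gap is carried
  as the inequality \<open>\<delta>\<^sup>2 * \<integral>p\<^sup>2 \<le> \<integral>t\<^sup>2
  p\<^sup>2\<close> for all polynomials p, which is closed under convergence of moments and gives
  the gap back by Weierstrass approximation.

  Only numbers leave the Fock space and all estimates concern single vectors, so no completion is
  taken. Finitely supported measures make the one-variable spaces finite-dimensional, with an
  explicit orthonormal basis. The rounding that produces them is odd and so keeps the means of Y and
  \<open>X^-1\<close> at zero.\<close>

definition bounded_prob :: "real \<Rightarrow> real measure \<Rightarrow> bool" where
  "bounded_prob K \<mu> \<longleftrightarrow> prob_space \<mu> \<and> sets \<mu> = sets borel \<and> (AE t in \<mu>. \<bar>t\<bar> \<le> K)"

lemma compact_prob_iff_bounded_prob: "compact_prob \<mu> \<longleftrightarrow> (\<exists>K. bounded_prob K \<mu>)"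
  by (auto simp: compact_prob_def bounded_prob_def)

lemma bounded_prob_mono: "bounded_prob K \<mu> \<Longrightarrow> K \<le> L \<Longrightarrow> bounded_prob L \<mu>"
  unfolding bounded_prob_def by (auto elim!: eventually_mono)

lemma bounded_prob_nonneg:
  assumes "bounded_prob K \<mu>" shows "0 \<le> K"
proof (rule ccontr)
  assume "\<not> 0 \<le> K"
  interpret prob_space \<mu> using assms by (simp add: bounded_prob_def)
  have "AE t in \<mu>. \<bar>t\<bar> \<le> K"
    using assms by (simp add: bounded_prob_def)
  then have "AE t in \<mu>. False"
    by (rule eventually_mono) (use \<open>\<not> 0 \<le> K\<close> in auto)
  then show False by simp
qed

lemma bounded_prob_measurable:
  "bounded_prob K \<mu> \<Longrightarrow> f \<in> borel_measurable borel \<Longrightarrow> f \<in> borel_measurable \<mu>"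
  by (simp add: bounded_prob_def cong: measurable_cong_sets)

lemma bounded_prob_integrable:
  fixes f :: "real \<Rightarrow> real"
  assumes "bounded_prob K \<mu>" "f \<in> borel_measurable borel" "\<And>t. \<bar>t\<bar> \<le> K \<Longrightarrow> \<bar>f t\<bar> \<le> B"
  shows "integrable \<mu> f"
proof -
  interpret prob_space \<mu> using assms by (simp add: bounded_prob_def)
  show ?thesis
    by (rule integrable_const_bound[where B = B])
       (use assms in \<open>auto simp: bounded_prob_def intro: bounded_prob_measurable elim!: eventually_mono\<close>)
qed

lemma bounded_prob_integrable_cont:
  fixes f :: "real \<Rightarrow> real"
  assumes "bounded_prob K \<mu>" "f \<in> borel_measurable borel" "continuous_on {-K..K} f"
  shows "integrable \<mu> f"
proof -
  have "bounded (f ` {-K..K})"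
    using assms(3) compact_continuous_image compact_imp_bounded by blast
  then obtain B where "\<And>t. t \<in> {-K..K} \<Longrightarrow> \<bar>f t\<bar> \<le> B"
    unfolding bounded_iff by (metis imageI real_norm_def)
  then show ?thesis
    by (intro bounded_prob_integrable[OF assms(1,2), of B]) (simp add: abs_le_iff)
qed

lemma bounded_prob_integrable_poly:
  "bounded_prob K \<mu> \<Longrightarrow> integrable \<mu> (poly p)"
  by (rule bounded_prob_integrable_cont)
     (auto intro!: continuous_intros borel_measurable_continuous_onI)

lemma bounded_prob_integral_bound:
  fixes f g :: "real \<Rightarrow> real"
  assumes \<mu>: "bounded_prob K \<mu>" and "integrable \<mu> f" "integrable \<mu> g"
    and "\<And>t. \<bar>t\<bar> \<le> K \<Longrightarrow> \<bar>f t - g t\<bar> \<le> e"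
  shows "\<bar>(\<integral>t. f t \<partial>\<mu>) - (\<integral>t. g t \<partial>\<mu>)\<bar> \<le> e"
proof -
  interpret prob_space \<mu> using \<mu> by (simp add: bounded_prob_def)
  have "\<bar>(\<integral>t. f t \<partial>\<mu>) - (\<integral>t. g t \<partial>\<mu>)\<bar> = \<bar>\<integral>t. f t - g t \<partial>\<mu>\<bar>"
    using assms by simp
  also have "\<dots> \<le> (\<integral>t. \<bar>f t - g t\<bar> \<partial>\<mu>)"
    by (rule integral_abs_bound)
  also have "\<dots> \<le> (\<integral>t. e \<partial>\<mu>)"
    by (rule integral_mono_AE) (use assms in \<open>auto simp: bounded_prob_def elim!: eventually_mono\<close>)
  finally show ?thesis by (simp add: prob_space)
qed

lemma poly_integral:
  assumes "bounded_prob K \<mu>"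
  shows "(\<integral>t. poly p t \<partial>\<mu>) = (\<Sum>j\<le>degree p. coeff p j * (\<integral>t. t ^ j \<partial>\<mu>))"
proof -
  have "integrable \<mu> (\<lambda>t. t ^ j)" for j
    by (rule bounded_prob_integrable_cont[OF assms]) (auto intro!: continuous_intros)
  then show ?thesis
    by (simp add: poly_altdef)
qed

lemma weierstrass_poly:
  fixes f :: "real \<Rightarrow> real"
  assumes "continuous_on {-K..K} f" "0 < e"
  obtains p where "\<And>t. \<bar>t\<bar> \<le> K \<Longrightarrow> \<bar>f t - poly p t\<bar> < e"
proof -
  obtain g where g: "real_polynomial_function g" "\<And>t. t \<in> {-K..K} \<Longrightarrow> \<bar>f t - g t\<bar> < e"
    using Stone_Weierstrass_real_polynomial_function[of "{-K..K}" f e] assms by auto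
  then obtain a n where g': "g = (\<lambda>x. \<Sum>i\<le>n. a i * x ^ i)"
    using real_polynomial_function_iff_sum by blast
  have "poly (\<Sum>i\<le>n. monom (a i) i) t = g t" for t
    by (simp add: g' poly_sum poly_monom)
  then show ?thesis
    using g(2) by (intro that[of "\<Sum>i\<le>n. monom (a i) i"]) (auto simp: abs_le_iff)
qed

text \<open>Weierstrass approximation on the one interval \<open>{-K..K}\<close> that carries all
  the measures costs at most r/3 for each of them; this uniformity is why the radius
  \<open>K\<close> is kept explicit.\<close>

lemma moments_tendsto_integral_tendsto:
  fixes f :: "real \<Rightarrow> real"
  assumes \<mu>s: "\<And>n. bounded_prob K (\<mu>s n)" and \<mu>: "bounded_prob K \<mu>"
    and mom: "\<And>k. (\<lambda>n. \<integral>t. t ^ k \<partial>\<mu>s n) \<longlonglongrightarrow> (\<integral>t. t ^ k \<partial>\<mu>)"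
    and f: "continuous_on {-K..K} f" "f \<in> borel_measurable borel"
  shows "(\<lambda>n. \<integral>t. f t \<partial>\<mu>s n) \<longlonglongrightarrow> (\<integral>t. f t \<partial>\<mu>)"
proof (rule LIMSEQ_I)
  fix r :: real assume "0 < r"
  then obtain p where p: "\<And>t. \<bar>t\<bar> \<le> K \<Longrightarrow> \<bar>f t - poly p t\<bar> < r/3"
    using weierstrass_poly[OF f(1), of "r/3"] by auto
  have "(\<lambda>n. \<integral>t. poly p t \<partial>\<mu>s n) \<longlonglongrightarrow> (\<integral>t. poly p t \<partial>\<mu>)"
    unfolding poly_integral[OF \<mu>] poly_integral[OF \<mu>s] by (intro tendsto_intros mom)
  then obtain N where N: "\<And>n. n \<ge> N \<Longrightarrow> \<bar>(\<integral>t. poly p t \<partial>\<mu>s n) - (\<integral>t. poly p t \<partial>\<mu>)\<bar> < r/3"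
    using \<open>0 < r\<close> unfolding LIMSEQ_def dist_real_def by (meson divide_pos_pos zero_less_numeral)
  have *: "\<bar>(\<integral>t. f t \<partial>\<nu>) - (\<integral>t. poly p t \<partial>\<nu>)\<bar> \<le> r/3" if "bounded_prob K \<nu>" for \<nu>
    by (rule bounded_prob_integral_bound[OF that])
       (use that f p in \<open>auto intro: bounded_prob_integrable_cont bounded_prob_integrable_poly less_imp_le\<close>)
  have "\<bar>(\<integral>t. f t \<partial>\<mu>s n) - (\<integral>t. f t \<partial>\<mu>)\<bar> < r" if "n \<ge> N" for n
    using *[OF \<mu>s, of n] *[OF \<mu>] N[OF that] \<open>0 < r\<close> by linarith
  then show "\<exists>no. \<forall>n\<ge>no. norm ((\<integral>t. f t \<partial>\<mu>s n) - (\<integral>t. f t \<partial>\<mu>)) < r"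
    by auto
qed

text \<open>The preceding lemma, applied to the constant sequence \<open>\<mu>\<close>, shows that
  all continuous functions have equal integrals. For cos and sin this gives equal characteristic
  functions, and Levy uniqueness concludes.\<close>

lemma moments_determine:
  assumes "compact_prob \<mu>" "compact_prob \<nu>" "\<And>k. (\<integral>t. t ^ k \<partial>\<mu>) = (\<integral>t. t ^ k \<partial>\<nu>)"
  shows "\<mu> = \<nu>"
proof -
  obtain K L where "bounded_prob K \<mu>" "bounded_prob L \<nu>"
    using assms by (auto simp: compact_prob_iff_bounded_prob)
  then have \<mu>: "bounded_prob (max K L) \<mu>" and \<nu>: "bounded_prob (max K L) \<nu>"
    by (auto intro: bounded_prob_mono)
  have eq: "(\<integral>t. f t \<partial>\<mu>) = (\<integral>t. f t \<partial>\<nu>)" if "continuous_on UNIV f" for f :: "real \<Rightarrow> real"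
  proof -
    have "(\<lambda>n::nat. \<integral>t. f t \<partial>\<mu>) \<longlonglongrightarrow> (\<integral>t. f t \<partial>\<nu>)"
      by (rule moments_tendsto_integral_tendsto[OF \<mu> \<nu>])
         (use assms that in \<open>auto intro: borel_measurable_continuous_onI continuous_on_subset\<close>)
    then show ?thesis by (simp add: LIMSEQ_const_iff)
  qed
  have rd: "real_distribution \<mu>" "real_distribution \<nu>"
    using \<mu> \<nu> by (auto simp: bounded_prob_def real_distribution_def real_distribution_axioms_def
        dest: sets_eq_imp_space_eq)
  have int: "integrable \<rho> (\<lambda>x. cis (t * x))" if "bounded_prob M \<rho>" for M \<rho> t
  proof -
    interpret prob_space \<rho> using that by (simp add: bounded_prob_def)
    show ?thesis
      by (rule integrable_const_bound[where B = 1])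
         (auto intro!: bounded_prob_measurable[OF that] borel_measurable_continuous_onI continuous_intros
            simp: bounded_prob_def that[unfolded bounded_prob_def] cong: measurable_cong_sets)
  qed
  have "char \<mu> t = char \<nu> t" for t
  proof (rule complex_eqI)
    have "Re (char \<rho> t) = (\<integral>x. cos (t * x) \<partial>\<rho>)" "Im (char \<rho> t) = (\<integral>x. sin (t * x) \<partial>\<rho>)"
      if "bounded_prob M \<rho>" for M \<rho>
    proof -
      have "char \<rho> t = (\<integral>x. cis (t * x) \<partial>\<rho>)"
        by (simp add: char_def cis_conv_exp)
      then show "Re (char \<rho> t) = (\<integral>x. cos (t * x) \<partial>\<rho>)" "Im (char \<rho> t) = (\<integral>x. sin (t * x) \<partial>\<rho>)"
        using integral_Re[OF int[OF that, of t]] integral_Im[OF int[OF that, of t]] by simp_all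
    qed
    then show "Re (char \<mu> t) = Re (char \<nu> t)" "Im (char \<mu> t) = Im (char \<nu> t)"
      using \<mu> \<nu> by (auto intro!: eq continuous_intros)
  qed
  then show ?thesis
    using rd by (intro Levy_uniqueness) auto
qed

section \<open>Supports\<close>

lemma null_imp_disjoint_msupp:
  assumes "open U" "emeasure \<mu> U = 0" shows "U \<inter> msupp \<mu> = {}"
  using assms by (auto simp: msupp_def)

text \<open>Every point of \<open>C\<close> has an open neighbourhood of measure zero, and by
  compactness finitely many of them cover \<open>C\<close>.\<close>

lemma disjoint_msupp_imp_null:
  fixes C :: "real set"
  assumes "compact C" "C \<inter> msupp \<mu> = {}" "sets \<mu> = sets borel"
  shows "emeasure \<mu> C = 0"
proof -
  have "\<forall>t\<in>C. \<exists>U. open U \<and> t \<in> U \<and> emeasure \<mu> U = 0"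
    using assms(2) unfolding msupp_def disjoint_iff mem_Collect_eq not_all not_imp
      zero_less_iff_neq_zero not_not by metis
  then obtain U where U: "\<And>t. t \<in> C \<Longrightarrow> open (U t) \<and> t \<in> U t \<and> emeasure \<mu> (U t) = 0"
    by metis
  obtain D where D: "D \<subseteq> C" "finite D" "C \<subseteq> (\<Union>t\<in>D. U t)"
    by (rule compactE_image[OF assms(1), of C U]) (use U in auto)
  have "(\<Union>t\<in>D. U t) \<in> null_sets \<mu>"
    by (rule null_sets_UN') (use D U assms(3) in \<open>auto simp: null_sets_def countable_finite\<close>)
  moreover have "C \<in> sets \<mu>" using assms by (auto intro: borel_compact)
  ultimately show ?thesis
    using D(3) by (meson null_sets_subset null_setsD1)
qed

text \<open>The inequality says that (d^2 - t^2) p^2 has integral at most 0. By approximation this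
  holds with the tent function \<open>f\<close> in place of p, where the integrand is nonnegative
  everywhere and strictly positive on (-d, d).\<close>

lemma quadratic_gap:
  assumes \<rho>: "bounded_prob K \<rho>" and "0 < d"
    and gap: "\<And>p. d\<^sup>2 * (\<integral>t. (poly p t)\<^sup>2 \<partial>\<rho>) \<le> (\<integral>t. t\<^sup>2 * (poly p t)\<^sup>2 \<partial>\<rho>)"
  shows "{-d<..<d} \<inter> msupp \<rho> = {}"
proof -
  interpret prob_space \<rho> using \<rho> by (simp add: bounded_prob_def)
  have K: "0 \<le> K" using \<rho> by (rule bounded_prob_nonneg)
  have [measurable_cong]: "sets \<rho> = sets borel" using \<rho> by (simp add: bounded_prob_def)
  define f where "f t = max 0 (d - \<bar>t\<bar>)" for t :: real
  have f: "continuous_on A f" for A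
    unfolding f_def by (intro continuous_intros)
  have [measurable]: "f \<in> borel_measurable borel"
    by (rule borel_measurable_continuous_onI[OF f])
  define g where "g t = (d\<^sup>2 - t\<^sup>2) * (f t)\<^sup>2" for t
  have int_g: "integrable \<rho> g"
    unfolding g_def by (rule bounded_prob_integrable_cont[OF \<rho>]) (auto intro!: continuous_intros f)
  have g_nonneg: "0 \<le> g t" for t
  proof (cases "\<bar>t\<bar> \<le> d")
    case True
    then have "t\<^sup>2 \<le> d\<^sup>2" using \<open>0 < d\<close> by (metis abs_le_square_iff abs_of_pos)
    then show ?thesis by (simp add: g_def)
  qed (simp add: g_def f_def)
  define C where "C = d\<^sup>2 + K\<^sup>2"
  have C: "\<bar>d\<^sup>2 - t\<^sup>2\<bar> \<le> C" if "\<bar>t\<bar> \<le> K" for t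
  proof -
    have "t\<^sup>2 \<le> K\<^sup>2" using that K by (metis abs_le_square_iff abs_of_nonneg)
    then show ?thesis unfolding C_def using zero_le_power2[of d] zero_le_power2[of t] by linarith
  qed
  have le: "(\<integral>t. g t \<partial>\<rho>) \<le> e" if "0 < e" for e
  proof -
    \<comment> \<open>The bound 1 keeps \<open>\<bar>f t + poly p t\<bar>\<close> below 2d + 1; the
      other term makes C e' (2d + 1) at most e.\<close>
    define e' where "e' = min 1 (e / (C * (2 * d + 1)))"
    have "C > 0" using \<open>0 < d\<close> by (simp add: C_def add_pos_nonneg)
    have C': "0 < C * (2 * d + 1)" using \<open>C > 0\<close> \<open>0 < d\<close> by simp
    have "e' \<le> e / (C * (2 * d + 1))" by (simp add: e'_def)
    with C' have "e' * (C * (2 * d + 1)) \<le> e" by (simp only: pos_le_divide_eq)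
    moreover have "0 < e'" "e' \<le> 1" using that C' unfolding e'_def by simp_all
    ultimately have e': "0 < e'" "e' \<le> 1" "C * (e' * (2 * d + 1)) \<le> e"
      by (simp_all add: mult.left_commute)
    obtain p where p: "\<And>t. \<bar>t\<bar> \<le> K \<Longrightarrow> \<bar>f t - poly p t\<bar> < e'"
      using weierstrass_poly[OF f e'(1)] by blast
    have "\<bar>g t - (d\<^sup>2 - t\<^sup>2) * (poly p t)\<^sup>2\<bar> \<le> e" if t: "\<bar>t\<bar> \<le> K" for t
    proof -
      have "\<bar>f t\<bar> \<le> d" using \<open>0 < d\<close> by (auto simp: f_def)
      then have s: "\<bar>f t + poly p t\<bar> \<le> 2 * d + 1" using p[OF t] e' by linarith
      have "g t - (d\<^sup>2 - t\<^sup>2) * (poly p t)\<^sup>2 = (d\<^sup>2 - t\<^sup>2) * ((f t - poly p t) * (f t + poly p t))"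
        by (simp add: g_def algebra_simps power2_eq_square)
      also have "\<bar>\<dots>\<bar> = \<bar>d\<^sup>2 - t\<^sup>2\<bar> * (\<bar>f t - poly p t\<bar> * \<bar>f t + poly p t\<bar>)"
        by (simp add: abs_mult)
      also have "\<dots> \<le> C * (e' * (2 * d + 1))"
        by (intro mult_mono C[OF t] less_imp_le[OF p[OF t]] s) (use \<open>C > 0\<close> e' in auto)
      finally show ?thesis using e' by linarith
    qed
    moreover have int: "integrable \<rho> (\<lambda>t. (d\<^sup>2 - t\<^sup>2) * (poly p t)\<^sup>2)"
      "integrable \<rho> (\<lambda>t. (poly p t)\<^sup>2)" "integrable \<rho> (\<lambda>t. t\<^sup>2 * (poly p t)\<^sup>2)"
      by (rule bounded_prob_integrable_cont[OF \<rho>]; force intro!: continuous_intros borel_measurable_continuous_onI)+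
    ultimately have "\<bar>(\<integral>t. g t \<partial>\<rho>) - (\<integral>t. (d\<^sup>2 - t\<^sup>2) * (poly p t)\<^sup>2 \<partial>\<rho>)\<bar> \<le> e"
      by (intro bounded_prob_integral_bound[OF \<rho>] int_g)
    moreover have "(\<integral>t. (d\<^sup>2 - t\<^sup>2) * (poly p t)\<^sup>2 \<partial>\<rho>) \<le> 0"
      using gap[of p] int by (simp add: left_diff_distrib)
    ultimately show ?thesis by linarith
  qed
  have "(\<integral>t. g t \<partial>\<rho>) \<le> 0"
    using le by (meson field_le_epsilon add_0 dense_ge)
  then have "(\<integral>t. g t \<partial>\<rho>) = 0"
    using g_nonneg by (intro antisym integral_nonneg_AE) auto
  then have "AE t in \<rho>. g t = 0"
    using integral_nonneg_eq_0_iff_AE[OF int_g] g_nonneg by auto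
  moreover have "g t \<noteq> 0" if "t \<in> {-d<..<d}" for t
  proof -
    have "t\<^sup>2 < d\<^sup>2" using that \<open>0 < d\<close> by (intro power2_strict_mono) auto
    then show ?thesis using that by (auto simp: g_def f_def)
  qed
  ultimately have "AE t in \<rho>. t \<notin> {-d<..<d}" by (auto elim!: eventually_mono)
  then have "emeasure \<rho> {-d<..<d} = 0"
    by (subst (asm) AE_iff_measurable[of "{-d<..<d}"])
       (auto simp: sets_eq_imp_space_eq[of \<rho> borel] \<open>sets \<rho> = sets borel\<close>)
  then show ?thesis by (intro null_imp_disjoint_msupp) auto
qed

section \<open>The Hausdorff moment problem\<close>

text \<open>The quotient is the product of the j factors (k - i)/(n - i), all of modulus at most 1.
  Each differs from k/n by at most 2j/n because n - i is at least n/2, and replacing factors one at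
  a time adds the errors.\<close>

lemma binomial_ratio_bound:
  fixes n k j :: nat
  assumes "k \<le> n" "2 * j \<le> n" "0 < n"
  shows "\<bar>real (k choose j) / real (n choose j) - (real k / real n) ^ j\<bar> \<le> 2 * real j ^ 2 / real n"
proof -
  have eq: "real (k choose j) / real (n choose j) = (\<Prod>i\<in>{0..<j}. (real k - real i) / (real n - real i))"
    by (simp add: binomial_gbinomial gbinomial_prod_rev prod_dividef)
  have pos: "real n - real i > 0" if "i < j" for i
    using that assms by simp
  have "norm ((\<Prod>i\<in>{0..<j}. (real k - real i) / (real n - real i)) - (\<Prod>i\<in>{0..<j}. real k / real n))
      \<le> (\<Sum>i\<in>{0..<j}. norm ((real k - real i) / (real n - real i) - real k / real n))"
  proof (rule norm_prod_diff)
    fix i assume "i \<in> {0..<j}"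
    then have "\<bar>real k - real i\<bar> \<le> real n - real i" using assms by auto
    then show "norm ((real k - real i) / (real n - real i)) \<le> 1"
      using pos[of i] \<open>i \<in> {0..<j}\<close> by (simp add: divide_le_eq_1_pos)
    show "norm (real k / real n) \<le> 1"
      using assms by simp
  qed
  also have "\<dots> \<le> (\<Sum>i\<in>{0..<j}. 2 * real j / real n)"
  proof (rule sum_mono)
    fix i assume i: "i \<in> {0..<j}"
    have p: "real n - real i > 0" using pos i by simp
    have "(real k - real i) / (real n - real i) - real k / real n
        = - (real i * (real n - real k) / (real n * (real n - real i)))"
      using p assms(3) by (simp add: field_simps)
    then have "norm ((real k - real i) / (real n - real i) - real k / real n)
        = real i * (real n - real k) / (real n * (real n - real i))"
      using p assms by (simp add: abs_mult)
    also have "\<dots> \<le> real j * real n / (real n * (real n / 2))"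
      by (intro frac_le mult_mono mult_left_mono mult_pos_pos) (use i assms p in auto)
    also have "\<dots> = 2 * real j / real n"
      using assms by (simp add: field_simps)
    finally show "norm ((real k - real i) / (real n - real i) - real k / real n) \<le> 2 * real j / real n" .
  qed
  finally show ?thesis
    by (simp add: eq power2_eq_square mult.left_commute)
qed

lemma poly_functional_sum:
  fixes l :: "real poly \<Rightarrow> real"
  assumes add: "\<And>p q. l (p + q) = l p + l q" and smult: "\<And>c p. l (smult c p) = c * l p"
  shows "l (\<Sum>i\<in>A. smult (c i) (f i)) = (\<Sum>i\<in>A. c i * l (f i))"
proof -
  have "l 0 = 0" using smult[of 0 0] by simp
  then show ?thesis
    by (induction A rule: infinite_finite_induct) (simp_all add: add smult)
qed

lemma smult_sum_right: "smult c (\<Sum>i\<in>A. f i) = (\<Sum>i\<in>A. smult c (f i))"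
  by (induction A rule: infinite_finite_induct) (simp_all add: smult_add_right)

lemma pcompose_power: "p ^ n \<circ>\<^sub>p q = (p \<circ>\<^sub>p q) ^ n"
  for p q :: "'a::comm_semiring_1 poly"
  by (induction n) (simp_all add: pcompose_1 pcompose_mult)

text \<open>The Bernstein weights \<open>w n k\<close> are nonnegative and sum to 1. Placed at the
  points k/n they form probability measures whose moments tend to those of \<open>l\<close>;
  tightness supplies a limit measure along a subsequence.\<close>

lemma hausdorff_moment_unit_interval:
  fixes l :: "real poly \<Rightarrow> real"
  assumes add: "\<And>p q. l (p + q) = l p + l q" and smult: "\<And>c p. l (smult c p) = c * l p"
    and one: "l 1 = 1"
    and pos: "\<And>k m. 0 \<le> l ([:0, 1:] ^ k * [:1, -1:] ^ m)"
  obtains \<mu> where "prob_space \<mu>" "sets \<mu> = sets borel" "AE t in \<mu>. t \<in> {0..1}"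
    "\<And>j. (\<integral>t. t ^ j \<partial>\<mu>) = l ([:0, 1:] ^ j)"
proof -
  define x y where "x = [:0, 1::real:]" and "y = [:1, -1::real:]"
  have xy: "x + y = 1" by (simp add: x_def y_def)
  define w where "w n k = real (n choose k) * l (x ^ k * y ^ (n - k))" for n k
  have w_nonneg: "0 \<le> w n k" for n k
    using pos by (simp add: w_def x_def y_def)
  note lsum = poly_functional_sum[of l, OF add smult]
  \<comment> \<open>The binomial moments of the weights are exact, not merely asymptotic: the factor
    left over after splitting off x^j is (x + y)^(n - j) = 1.\<close>
  have w_binom: "(\<Sum>k\<le>n. w n k * real (k choose j)) = real (n choose j) * l (x ^ j)" if "j \<le> n" for n j
  proof -
    have "(\<Sum>k\<le>n. w n k * real (k choose j)) = (\<Sum>k\<in>{j..n}. w n k * real (k choose j))"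
      by (rule sum.mono_neutral_right) (auto simp: not_le)
    also have "\<dots> = (\<Sum>i\<le>n - j. w n (i + j) * real ((i + j) choose j))"
      by (rule sum.reindex_bij_witness[of _ "\<lambda>i. i + j" "\<lambda>k. k - j"]) (use that in auto)
    also have "\<dots> = (\<Sum>i\<le>n - j. (real (n choose j) * real ((n - j) choose i)) * l (x ^ j * (x ^ i * y ^ (n - j - i))))"
    proof (rule sum.cong[OF refl])
      fix i assume "i \<in> {..n - j}"
      then have "(n choose (i + j)) * ((i + j) choose j) = (n choose j) * ((n - j) choose i)"
        using choose_mult[of j "i + j" n] that by simp
      then have "real (n choose (i + j)) * real ((i + j) choose j) = real (n choose j) * real ((n - j) choose i)"
        by (metis of_nat_mult)
      moreover have "x ^ (i + j) * y ^ (n - (i + j)) = x ^ j * (x ^ i * y ^ (n - j - i))"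
        by (simp add: power_add add.commute mult_ac)
      moreover have "w n (i + j) * real ((i + j) choose j)
          = (real (n choose (i + j)) * real ((i + j) choose j)) * l (x ^ (i + j) * y ^ (n - (i + j)))"
        by (simp only: w_def mult_ac)
      ultimately show "w n (i + j) * real ((i + j) choose j)
          = (real (n choose j) * real ((n - j) choose i)) * l (x ^ j * (x ^ i * y ^ (n - j - i)))"
        by simp
    qed
    also have "\<dots> = l (\<Sum>i\<le>n - j. smult (real (n choose j) * real ((n - j) choose i)) (x ^ j * (x ^ i * y ^ (n - j - i))))"
      by (rule lsum[symmetric])
    also have "(\<Sum>i\<le>n - j. smult (real (n choose j) * real ((n - j) choose i)) (x ^ j * (x ^ i * y ^ (n - j - i))))
        = smult (real (n choose j)) (x ^ j * (x + y) ^ (n - j))"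
    proof -
      have "real c * real d = e \<Longrightarrow> smult (real c) (p * (of_nat d * q * r)) = smult e (p * (q * r))"
        for c d e and p q r :: "real poly"
        by (simp add: of_nat_mult_conv_smult mult.assoc)
      then show ?thesis
        unfolding binomial_ring sum_distrib_left smult_sum_right by (intro sum.cong refl) simp
    qed
    finally show ?thesis by (simp add: xy smult)
  qed
  have w_sum: "(\<Sum>k\<le>n. w n k) = 1" for n
    using w_binom[of 0 n] by (simp add: one)
  define P where "P n = point_measure {..n} (\<lambda>k. ennreal (w n k))" for n
  define N where "N n = distr (P n) borel (\<lambda>k. real k / real n)" for n
  have meas: "(\<lambda>k. real k / real n) \<in> measurable (P n) borel" for n
    unfolding P_def by simp
  have spN: "space (N n) = UNIV" "sets (N n) = sets borel" for n by (simp_all add: N_def)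
  have probP: "prob_space (P n)" for n
  proof (rule prob_spaceI)
    show "emeasure (P n) (space (P n)) = 1"
      unfolding P_def by (simp add: space_point_measure emeasure_point_measure_finite w_nonneg w_sum)
  qed
  have probN: "prob_space (N n)" for n
    unfolding N_def by (rule prob_space.prob_space_distr[OF probP meas])
  have intN: "(\<integral>t. f t \<partial>N n) = (\<Sum>k\<le>n. w n k * f (real k / real n))"
    if "f \<in> borel_measurable borel" for n and f :: "real \<Rightarrow> real"
    unfolding N_def
    by (subst integral_distr[OF meas that])
       (simp add: P_def lebesgue_integral_point_measure_finite w_nonneg)
  have rdN: "real_distribution (N n)" for n
    unfolding real_distribution_def real_distribution_axioms_def using probN spN by auto
  have "tight N"
    unfolding tight_def
  proof (intro conjI allI impI rdN)
    fix e :: real assume "0 < e"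
    \<comment> \<open>Tightness is phrased with intervals open on the left, hence -1 rather than 0.
      For n = 0 the only atom is 0, since division by zero gives 0.\<close>
    have "measure (N n) {-1<..1} = 1" for n
    proof -
      have "measure (N n) {-1<..1} = measure (P n) ((\<lambda>k. real k / real n) -` {-1<..1} \<inter> space (P n))"
        unfolding N_def by (rule measure_distr[OF meas]) simp
      also have "(\<lambda>k. real k / real n) -` {-1<..1} \<inter> space (P n) = space (P n)"
        by (auto simp: P_def space_point_measure divide_le_eq_1 less_le_trans[of "-1" 0])
      finally show ?thesis using prob_space.prob_space[OF probP] by simp
    qed
    then show "\<exists>a b. a < b \<and> (\<forall>n. 1 - e < measure (N n) {a<..b})"
      using \<open>0 < e\<close> by (intro exI[of _ "-1"] exI[of _ 1]) simp
  qed
  then obtain r \<mu> where r: "strict_mono (r :: nat \<Rightarrow> nat)" and \<mu>: "real_distribution \<mu>"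
    and conv: "weak_conv_m (N \<circ> id \<circ> r) \<mu>"
    using tight_imp_convergent_subsubsequence[of N id] strict_mono_id by blast
  interpret real_distribution \<mu> by (rule \<mu>)
  have weak: "(\<lambda>n. \<integral>t. f t \<partial>N (r n)) \<longlonglongrightarrow> (\<integral>t. f t \<partial>\<mu>)"
    if "continuous_on UNIV f" "\<And>t. \<bar>f t\<bar> \<le> 1" for f :: "real \<Rightarrow> real"
    using weak_conv_imp_integral_bdd_continuous_conv[of "N \<circ> id \<circ> r" \<mu> f 1] rdN \<mu> conv that
    by (simp add: o_def continuous_on_eq_continuous_at)
  \<comment> \<open>Weak convergence tests only bounded continuous functions. Clamping to [0, 1]
    makes the powers bounded without changing them on the atoms k/n.\<close>
  define c where "c t = max 0 (min 1 t)" for t :: real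
  have c: "continuous_on UNIV c" unfolding c_def by (intro continuous_intros)
  have c_id: "c (real k / real n) = real k / real n" if "k \<le> n" for k n
  proof -
    have "real k / real n \<le> 1" using that by (simp add: divide_le_eq_1) auto
    then show ?thesis by (simp add: c_def)
  qed
  have c01: "0 \<le> c t" "c t \<le> 1" for t by (auto simp: c_def)
  have AE01: "AE t in \<mu>. t \<in> {0..1}"
  proof -
    \<comment> \<open>The distance to [0, 1], capped at 1: its integral vanishes for every
      \<open>N n\<close> and hence for the limit.\<close>
    define f where "f t = min 1 \<bar>t - c t\<bar>" for t
    have f: "continuous_on UNIV f" "\<And>t. \<bar>f t\<bar> \<le> 1" unfolding f_def by (auto intro!: continuous_intros c)
    have fm: "f \<in> borel_measurable borel" using f by (auto intro: borel_measurable_continuous_onI)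
    have "(\<integral>t. f t \<partial>N n) = 0" for n
      by (simp add: intN[OF fm]) (simp add: f_def c_id)
    with weak[OF f] have "(\<integral>t. f t \<partial>\<mu>) = 0" by (simp add: LIMSEQ_const_iff)
    moreover have "integrable \<mu> f"
      by (rule integrable_const_bound[where B = 1]) (use f fm in auto)
    ultimately have "AE t in \<mu>. f t = 0"
      using integral_nonneg_eq_0_iff_AE[of \<mu> f] by (simp add: f_def[abs_def])
    then show ?thesis
      by (rule eventually_mono) (auto simp: f_def c_def min_def max_def split: if_splits)
  qed
  have "(\<integral>t. t ^ j \<partial>\<mu>) = l (x ^ j)" for j
  proof -
    have f: "continuous_on UNIV (\<lambda>t. c t ^ j)" by (intro continuous_intros c)
    have fm: "(\<lambda>t. c t ^ j) \<in> borel_measurable borel" using f by (rule borel_measurable_continuous_onI)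
    have "(\<lambda>n. \<integral>t. c t ^ j \<partial>N (r n)) \<longlonglongrightarrow> (\<integral>t. c t ^ j \<partial>\<mu>)"
      by (rule weak[OF f]) (use c01 in \<open>simp add: power_le_one\<close>)
    moreover have "(\<lambda>n. \<integral>t. c t ^ j \<partial>N n) \<longlonglongrightarrow> l (x ^ j)"
    proof (rule LIM_zero_cancel, rule Lim_null_comparison)
      show "\<forall>\<^sub>F n in sequentially. norm ((\<integral>t. c t ^ j \<partial>N n) - l (x ^ j)) \<le> 2 * real j ^ 2 / real n"
        using eventually_ge_at_top[of "2 * j + 1"]
      proof eventually_elim
        case (elim n)
        have ne: "real (n choose j) \<noteq> 0" using elim by simp
        have "l (x ^ j) = (\<Sum>k\<le>n. w n k * (real (k choose j) / real (n choose j)))"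
          using w_binom[of j n] elim ne by (simp flip: sum_divide_distrib)
        then have "(\<integral>t. c t ^ j \<partial>N n) - l (x ^ j)
            = (\<Sum>k\<le>n. w n k * ((real k / real n) ^ j - real (k choose j) / real (n choose j)))"
          by (simp add: intN[OF fm] c_id right_diff_distrib sum_subtractf)
        also have "\<bar>\<dots>\<bar> \<le> (\<Sum>k\<le>n. w n k * (2 * real j ^ 2 / real n))"
        proof (rule order_trans[OF sum_abs], rule sum_mono)
          fix k assume "k \<in> {..n}"
          then show "\<bar>w n k * ((real k / real n) ^ j - real (k choose j) / real (n choose j))\<bar>
              \<le> w n k * (2 * real j ^ 2 / real n)"
            using binomial_ratio_bound[of k n j] elim w_nonneg[of n k]
            unfolding abs_mult abs_of_nonneg[OF w_nonneg]
            by (intro mult_left_mono) (simp_all add: abs_minus_commute)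
        qed
        also have "\<dots> = 2 * real j ^ 2 / real n"
          by (simp only: sum_distrib_right[symmetric] w_sum)
        finally show ?case by simp
      qed
      show "(\<lambda>n. 2 * real j ^ 2 / real n) \<longlonglongrightarrow> 0"
        by (rule lim_const_over_n)
    qed
    then have "(\<lambda>n. \<integral>t. c t ^ j \<partial>N (r n)) \<longlonglongrightarrow> l (x ^ j)"
      using LIMSEQ_subseq_LIMSEQ[OF _ r] by (fastforce simp: o_def)
    ultimately have "(\<integral>t. c t ^ j \<partial>\<mu>) = l (x ^ j)"
      by (rule LIMSEQ_unique)
    moreover have "(\<integral>t. c t ^ j \<partial>\<mu>) = (\<integral>t. t ^ j \<partial>\<mu>)"
    proof (rule integral_cong_AE)
      show "AE t in \<mu>. c t ^ j = t ^ j"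
        using AE01 by (rule eventually_mono) (simp add: c_def)
    qed (use fm in simp_all)
    ultimately show ?thesis by simp
  qed
  then show ?thesis
    using that[of \<mu>] AE01 prob_space_axioms by (simp add: x_def)
qed

text \<open>The affine polynomial \<open>A\<close> carries [-K, K] to [0, 1] and \<open>B\<close> is
  1 - A. In A^k B^m the even parts of the exponents form a square, which leaves a factor 1, A, B or
  AB. Since A + B = 1, the last one is A B^2 + B A^2 and thus again covered by the
  hypotheses.\<close>

lemma poly_functional_measure:
  fixes l :: "real poly \<Rightarrow> real"
  assumes add: "\<And>p q. l (p + q) = l p + l q" and smult: "\<And>c p. l (smult c p) = c * l p"
    and one: "l 1 = 1" and "0 < K"
    and sq: "\<And>q. 0 \<le> l (q * q)"
    and upper: "\<And>q. 0 \<le> l ([:K, -1:] * (q * q))" and lower: "\<And>q. 0 \<le> l ([:K, 1:] * (q * q))"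
  obtains \<mu> where "bounded_prob K \<mu>" "\<And>j. (\<integral>t. t ^ j \<partial>\<mu>) = l ([:0, 1:] ^ j)"
proof -
  define A B where "A = [:1/2, 1/(2*K):]" and "B = [:1/2, -1/(2*K):]"
  have A: "A = smult (1/(2*K)) [:K, 1:]" and B: "B = smult (1/(2*K)) [:K, -1:]" and AB: "A + B = 1"
    using \<open>0 < K\<close> by (simp_all add: A_def B_def)
  define l' where "l' p = l (p \<circ>\<^sub>p A)" for p
  have posAB: "0 \<le> l (A * (q * q))" "0 \<le> l (B * (q * q))" for q
    using upper[of q] lower[of q] \<open>0 < K\<close> by (simp_all only: A B smult mult_smult_left) simp_all
  have "0 \<le> l (A ^ k * B ^ m)" for k m
  proof -
    have *: "A ^ k * B ^ m = (A ^ (k mod 2) * B ^ (m mod 2)) * ((A ^ (k div 2) * B ^ (m div 2)) * (A ^ (k div 2) * B ^ (m div 2)))"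
    proof -
      have "z ^ k = z ^ (k mod 2) * (z ^ (k div 2) * z ^ (k div 2))" for z :: "real poly" and k
        by (metis mod_mult_div_eq mult_2 power_add)
      from this[of A k] this[of B m] show ?thesis by (simp add: mult_ac)
    qed
    define q where "q = A ^ (k div 2) * B ^ (m div 2)"
    have "A * B = A * (B * B) + B * (A * A)"
    proof -
      have "A * B = A * B * (A + B)" by (simp only: AB mult_1_right)
      then show ?thesis by (simp add: algebra_simps)
    qed
    then have "A * B * (q * q) = (A * (B * B) + B * (A * A)) * (q * q)"
      by (rule arg_cong)
    also have "\<dots> = A * ((B * q) * (B * q)) + B * ((A * q) * (A * q))"
      by (simp add: algebra_simps)
    finally have AB': "A * B * (q * q) = A * ((B * q) * (B * q)) + B * ((A * q) * (A * q))" .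
    consider "k mod 2 = 0" "m mod 2 = 0" | "k mod 2 = 1" "m mod 2 = 0"
      | "k mod 2 = 0" "m mod 2 = 1" | "k mod 2 = 1" "m mod 2 = 1"
      by (metis not_mod_2_eq_0_eq_1)
    then have "0 \<le> l (A ^ (k mod 2) * B ^ (m mod 2) * (q * q))"
    proof cases
      case 4
      then show ?thesis by (simp only: power_one_right AB' add) (intro add_nonneg_nonneg posAB)
    qed (simp_all add: sq posAB)
    then show ?thesis by (simp only: * q_def)
  qed
  moreover have "([:0, 1:] ^ k * [:1, -1:] ^ m) \<circ>\<^sub>p A = A ^ k * B ^ m" for k m
  proof -
    have "[:1, -1:] \<circ>\<^sub>p A = B" "[:0, 1:] \<circ>\<^sub>p A = A"
      by (simp_all add: pcompose_pCons A_def B_def)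
    then show ?thesis by (simp only: pcompose_mult pcompose_power)
  qed
  ultimately have "0 \<le> l' ([:0, 1:] ^ k * [:1, -1:] ^ m)" for k m
    by (simp add: l'_def)
  moreover have "l' (p + q) = l' p + l' q" "l' (smult c p) = c * l' p" "l' 1 = 1" for p q c
    by (simp_all add: l'_def pcompose_add pcompose_smult add smult one pcompose_1)
  ultimately obtain \<nu> where \<nu>: "prob_space \<nu>" "sets \<nu> = sets borel" "AE t in \<nu>. t \<in> {0..1}"
    and mom: "\<And>j. (\<integral>t. t ^ j \<partial>\<nu>) = l' ([:0, 1:] ^ j)"
    using hausdorff_moment_unit_interval[of l'] by blast
  have \<nu>1: "bounded_prob 1 \<nu>"     using \<nu>(1,2) eventually_mono[OF \<nu>(3), of "\<lambda>t. \<bar>t\<bar> \<le> 1"] by (simp add: bounded_prob_def)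
  have l': "(\<integral>t. poly p t \<partial>\<nu>) = l' p" for p
  proof -
    have "l' p = l' (\<Sum>i\<le>degree p. smult (coeff p i) ([:0, 1:] ^ i))"
      by (simp only: monom_altdef[symmetric] poly_as_sum_of_monoms)
    also have "\<dots> = (\<Sum>i\<le>degree p. coeff p i * l' ([:0, 1:] ^ i))"
      by (rule poly_functional_sum) fact+
    finally show ?thesis by (simp add: poly_integral[OF \<nu>1] mom)
  qed
  define h where "h t = K * (2 * t - 1)" for t :: real
  have [measurable]: "h \<in> borel_measurable borel" unfolding h_def by measurable
  have hm: "h \<in> measurable \<nu> borel" by (rule bounded_prob_measurable[OF \<nu>1]) simp
  define \<mu> where "\<mu> = distr \<nu> borel h"
  have "bounded_prob K \<mu>"
    unfolding bounded_prob_def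
  proof (intro conjI)
    show "prob_space \<mu>" unfolding \<mu>_def by (rule prob_space.prob_space_distr[OF \<nu>(1) hm])
    show "AE t in \<mu>. \<bar>t\<bar> \<le> K"
      unfolding \<mu>_def
    proof (subst AE_distr_iff[OF hm])
      show "AE t in \<nu>. \<bar>h t\<bar> \<le> K"
        using \<nu>(3)
      proof (rule eventually_mono)
        fix t :: real assume "t \<in> {0..1}"
        then have "\<bar>2 * t - 1\<bar> \<le> 1" by auto
        then show "\<bar>h t\<bar> \<le> K" using \<open>0 < K\<close> by (simp add: h_def abs_mult mult_left_le)
      qed
    qed simp
  qed (simp add: \<mu>_def)
  moreover have "(\<integral>t. t ^ j \<partial>\<mu>) = l ([:0, 1:] ^ j)" for j
  proof -
    have "(\<integral>t. t ^ j \<partial>\<mu>) = (\<integral>t. h t ^ j \<partial>\<nu>)"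
      unfolding \<mu>_def by (rule integral_distr[OF hm]) simp
    also have "\<dots> = (\<integral>t. poly ([:-K, 2 * K:] ^ j) t \<partial>\<nu>)"
      by (simp add: h_def algebra_simps)
    also have "\<dots> = l (([:-K, 2 * K:] ^ j) \<circ>\<^sub>p A)"
      by (simp only: l' l'_def)
    also have "([:-K, 2 * K:] ^ j) \<circ>\<^sub>p A = [:0, 1:] ^ j"
      using \<open>0 < K\<close> by (simp add: pcompose_power pcompose_pCons A_def)
    finally show ?thesis .
  qed
  ultimately show ?thesis by (rule that)
qed

section \<open>Polynomials of linear maps\<close>

definition peval :: "('v::real_vector \<Rightarrow> 'v) \<Rightarrow> real poly \<Rightarrow> 'v \<Rightarrow> 'v" where
  "peval F p v = (\<Sum>i\<le>degree p. coeff p i *\<^sub>R (F ^^ i) v)"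

lemma peval_0 [simp]: "peval F 0 v = 0"
  by (simp add: peval_def)

lemma peval_pCons:
  assumes "linear F" shows "peval F (pCons a p) v = a *\<^sub>R v + F (peval F p v)"
proof (cases "p = 0")
  case True
  then show ?thesis using assms by (simp add: peval_def linear_0)
next
  case False
  have "peval F (pCons a p) v = (\<Sum>i\<le>Suc (degree p). coeff (pCons a p) i *\<^sub>R (F ^^ i) v)"
    using False by (simp add: peval_def)
  also have "\<dots> = a *\<^sub>R v + (\<Sum>i\<le>degree p. coeff p i *\<^sub>R F ((F ^^ i) v))"
    by (subst sum.atMost_Suc_shift) simp
  finally show ?thesis
    using assms by (simp add: peval_def linear_sum linear_scale)
qed

context
  fixes F :: "'v::real_vector \<Rightarrow> 'v"
  assumes F: "linear F"
begin

lemma peval_1: "peval F 1 v = v"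
  using F by (simp add: one_pCons peval_pCons linear_0)

lemma peval_add: "peval F (p + q) v = peval F p v + peval F q v"
proof (induction p q rule: poly_induct2)
  case (pCons a p b q)
  then show ?case by (simp add: peval_pCons[OF F] linear_add[OF F] algebra_simps)
qed simp

lemma peval_smult: "peval F (smult c p) v = c *\<^sub>R peval F p v"
  by (induction p) (simp_all add: peval_pCons[OF F] linear_scale[OF F] algebra_simps)

lemma peval_mult: "peval F (p * q) v = peval F p (peval F q v)"
  by (induction p) (simp_all add: peval_pCons[OF F] peval_add peval_smult)

lemma peval_commute: "peval F p (F v) = F (peval F p v)"
  by (induction p) (simp_all add: peval_pCons[OF F] linear_add[OF F] linear_scale[OF F] linear_0[OF F])

lemma peval_linear_factor: "peval F [:a, b:] v = a *\<^sub>R v + b *\<^sub>R F v"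
  by (simp add: peval_pCons[OF F] linear_0[OF F] linear_scale[OF F])

lemma peval_monom: "peval F ([:0, 1:] ^ n) v = (F ^^ n) v"
proof (induction n)
  case (Suc n)
  have "peval F ([:0, 1:] ^ Suc n) v = peval F [:0, 1:] (peval F ([:0, 1:] ^ n) v)"
    by (simp only: power_Suc peval_mult)
  then show ?case by (simp only: Suc peval_linear_factor) simp
qed (simp add: peval_1)

end

section \<open>Positive operators\<close>

subclass (in complex_hilbert) banach ..

lemma cinner_add_left: "cinner (x + y) z = cinner x z + cinner y z"
  for x :: "'h::complex_hilbert"
  by (metis cinner_commute cinner_add_right complex_cnj_add)

lemma cinner_scaleC_left: "cinner (c *\<^sub>C x) y = cnj c * cinner x y"
  for x :: "'h::complex_hilbert"
  by (metis cinner_commute cinner_scaleC_right complex_cnj_mult)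

lemma cinner_scaleR_right: "cinner x (r *\<^sub>R y) = of_real r * cinner x y"
  for x :: "'h::complex_hilbert"
  by (simp add: scaleR_scaleC cinner_scaleC_right)

lemma cinner_scaleR_left: "cinner (r *\<^sub>R x) y = of_real r * cinner x y"
  for x :: "'h::complex_hilbert"
  by (simp add: scaleR_scaleC cinner_scaleC_left)

lemma cinner_self: "cinner x x = of_real ((norm x)\<^sup>2)" for x :: "'h::complex_hilbert"
proof -
  have "Im (cinner x x) = 0"
    by (metis cinner_commute complex_cnj_cancel_iff Reals_cnj_iff complex_is_Real_iff)
  then show ?thesis
    by (simp add: complex_eq_iff power2_norm_eq_inner inner_eq_Re_cinner)
qed

lemma cinner_diff_left: "cinner (x - y) z = cinner x z - cinner y z"
  for x :: "'h::complex_hilbert"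
  by (metis add_diff_cancel_right' cinner_add_left diff_add_cancel)

lemma cinner_diff_right: "cinner x (y - z) = cinner x y - cinner x z"
  for x :: "'h::complex_hilbert"
  by (metis add_diff_cancel_right' cinner_add_right diff_add_cancel)

lemma cinner_eqI: "(\<And>\<zeta>. cinner \<xi> \<zeta> = cinner \<eta> \<zeta>) \<Longrightarrow> \<xi> = \<eta>" for \<xi> :: "'h::complex_hilbert"
proof -
  assume "\<And>\<zeta>. cinner \<xi> \<zeta> = cinner \<eta> \<zeta>"
  then have "cinner (\<xi> - \<eta>) (\<xi> - \<eta>) = 0" by (simp add: cinner_diff_left)
  then show ?thesis by (simp add: cinner_self)
qed

lemma scalar_op_apply [simp]: "blinfun_apply (scalar_op c) \<xi> = c *\<^sub>C \<xi>"
  by (simp add: scalar_op.rep_eq)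

lemma clinear_op_id: "clinear_op (id_blinfun :: 'h oper)"
  and clinear_op_scalar: "clinear_op (scalar_op c :: 'h oper)"
  and clinear_op_compose: "clinear_op x \<Longrightarrow> clinear_op y \<Longrightarrow> clinear_op (x o\<^sub>L y)"
  and clinear_op_add: "clinear_op x \<Longrightarrow> clinear_op y \<Longrightarrow> clinear_op (x + y)"
  and clinear_op_scaleR: "clinear_op x \<Longrightarrow> clinear_op (r *\<^sub>R x)"
  and clinear_op_diff: "clinear_op x \<Longrightarrow> clinear_op y \<Longrightarrow> clinear_op (x - y)"
  for x y :: "'h::complex_hilbert oper"
proof -
  interpret s: bounded_linear "\<lambda>x::'h. c *\<^sub>C x" for c by (rule bounded_linear_scaleC)
  show "clinear_op (id_blinfun :: 'h oper)" by (simp add: clinear_op_def)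
  show "clinear_op (scalar_op c :: 'h oper)" by (simp add: clinear_op_def scaleC_scaleC mult.commute)
  show "clinear_op x \<Longrightarrow> clinear_op y \<Longrightarrow> clinear_op (x o\<^sub>L y)" by (simp add: clinear_op_def)
  show "clinear_op x \<Longrightarrow> clinear_op y \<Longrightarrow> clinear_op (x + y)"
    by (simp add: clinear_op_def blinfun.add_left s.add)
  show "clinear_op x \<Longrightarrow> clinear_op y \<Longrightarrow> clinear_op (x - y)"
    by (simp add: clinear_op_def blinfun.diff_left s.diff)
  show "clinear_op x \<Longrightarrow> clinear_op (r *\<^sub>R x)"
    by (simp add: clinear_op_def blinfun.scaleR_left s.scaleR)
qed

lemma adj_eqI: "is_adjoint x y \<Longrightarrow> adj x = y"
  unfolding adj_def
proof (rule the_equality)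
  fix v assume "is_adjoint x y" "is_adjoint x v"
  then have "blinfun_apply v \<xi> = y \<xi>" for \<xi>
    by (intro cinner_eqI) (simp add: is_adjoint_def)
  then show "v = y" by (rule blinfun_eqI)
qed

abbreviation self_adjoint :: "'h::complex_hilbert oper \<Rightarrow> bool" where
  "self_adjoint x \<equiv> is_adjoint x x"

lemma self_adjoint_inner: "self_adjoint x \<Longrightarrow> inner (x \<xi>) \<zeta> = inner \<xi> (x \<zeta>)"
  by (simp add: is_adjoint_def inner_eq_Re_cinner)

text \<open>Self-adjointness comes from polarization: realness of the quadratic form at \<xi> +
  \<zeta> and at \<xi> + i \<zeta> fixes the imaginary and the real part of the sesquilinear
  form.\<close>

lemma positive_op_iff:
  "positive_op x \<longleftrightarrow> clinear_op x \<and> self_adjoint x \<and> (\<forall>\<xi>. 0 \<le> inner \<xi> (x \<xi>))"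
proof
  assume pos: "positive_op x"
  have real: "Im (cinner \<xi> (x \<xi>)) = 0" and nonneg: "0 \<le> Re (cinner \<xi> (x \<xi>))" for \<xi>
    using pos by (auto simp: positive_op_def complex_nonneg_Reals_iff)
  have lin: "x (c *\<^sub>C \<xi>) = c *\<^sub>C x \<xi>" for c \<xi>
    using pos by (simp add: positive_op_def clinear_op_def)
  have "cinner (x \<xi>) \<zeta> = cinner \<xi> (x \<zeta>)" for \<xi> \<zeta>
  proof -
    have "Im (cinner \<xi> (x \<zeta>)) + Im (cinner \<zeta> (x \<xi>)) = 0"
      using real[of "\<xi> + \<zeta>"] real[of \<xi>] real[of \<zeta>]
      by (simp add: blinfun.add_right cinner_add_left cinner_add_right)
    moreover have "Re (cinner \<xi> (x \<zeta>)) - Re (cinner \<zeta> (x \<xi>)) = 0"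
      using real[of "\<xi> + \<i> *\<^sub>C \<zeta>"] real[of \<xi>] real[of \<zeta>]
      by (simp add: blinfun.add_right cinner_add_left cinner_add_right lin cinner_scaleC_left
          cinner_scaleC_right)
    ultimately have "cinner \<xi> (x \<zeta>) = cnj (cinner \<zeta> (x \<xi>))"
      by (simp add: complex_eq_iff)
    then show ?thesis using cinner_commute[of "x \<xi>" \<zeta>] by simp
  qed
  then show "clinear_op x \<and> self_adjoint x \<and> (\<forall>\<xi>. 0 \<le> inner \<xi> (x \<xi>))"
    using pos nonneg by (simp add: positive_op_def is_adjoint_def inner_eq_Re_cinner)
next
  assume *: "clinear_op x \<and> self_adjoint x \<and> (\<forall>\<xi>. 0 \<le> inner \<xi> (x \<xi>))"
  then have "cinner \<xi> (x \<xi>) = cnj (cinner \<xi> (x \<xi>))" for \<xi>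
    by (metis cinner_commute is_adjoint_def)
  then have "Im (cinner \<xi> (x \<xi>)) = 0" for \<xi>
    by (metis Reals_cnj_iff complex_is_Real_iff)
  then show "positive_op x"
    using * by (simp add: positive_op_def complex_nonneg_Reals_iff inner_eq_Re_cinner)
qed

lemma positive_op_sandwich:
  assumes "positive_op p" "clinear_op q" "self_adjoint q"
  shows "positive_op (q o\<^sub>L p o\<^sub>L q)"
proof -
  have "inner \<xi> (q (p (q \<xi>))) = inner (q \<xi>) (p (q \<xi>))" for \<xi>
    using assms(3) by (simp add: self_adjoint_inner)
  then show ?thesis
    using assms by (auto simp: positive_op_iff clinear_op_compose is_adjoint_def)
qed

lemma positive_op_square:
  assumes "clinear_op q" "self_adjoint q" shows "positive_op (q o\<^sub>L q)"
proof -
  have "inner \<xi> (q (q \<xi>)) = inner (q \<xi>) (q \<xi>)" for \<xi>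
    using assms(2) by (simp add: self_adjoint_inner)
  then show ?thesis
    using assms by (auto simp: positive_op_iff clinear_op_compose is_adjoint_def)
qed

lemma self_adjoint_id: "self_adjoint id_blinfun"
  and self_adjoint_add: "self_adjoint x \<Longrightarrow> self_adjoint y \<Longrightarrow> self_adjoint (x + y)"
  and self_adjoint_diff: "self_adjoint x \<Longrightarrow> self_adjoint y \<Longrightarrow> self_adjoint (x - y)"
  and self_adjoint_scaleR: "self_adjoint x \<Longrightarrow> self_adjoint (r *\<^sub>R x)"
  by (simp_all add: is_adjoint_def blinfun.add_left blinfun.diff_left blinfun.scaleR_left
      cinner_add_left cinner_add_right cinner_diff_left cinner_diff_right cinner_scaleR_left
      cinner_scaleR_right)

lemma inner_op_le: "inner \<xi> (blinfun_apply x \<xi>) \<le> norm x * (norm \<xi>)\<^sup>2" for x :: "'h::real_inner \<Rightarrow>\<^sub>L 'h"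
proof -
  have "inner \<xi> (x \<xi>) \<le> norm \<xi> * norm (x \<xi>)" by (rule norm_cauchy_schwarz)
  also have "\<dots> \<le> norm \<xi> * (norm x * norm \<xi>)"
    by (intro mult_left_mono norm_blinfun) simp
  finally show ?thesis by (simp add: power2_eq_square mult_ac)
qed

text \<open>If \<open>0 \<le> B \<le> 1\<close> then \<open>B - B\<^sup>2 = (1 - B) B (1 - B) + B (1 - B) B\<close> is positive.\<close>

lemma positive_contraction_norm_le_1:
  fixes B :: "'h::complex_hilbert oper"
  assumes "positive_op B" "positive_op (id_blinfun - B)"
  shows "norm B \<le> 1"
proof (rule norm_blinfun_bound)
  fix \<xi>
  have sa: "inner (B \<xi>) \<zeta> = inner \<xi> (B \<zeta>)" for \<xi> \<zeta>
    using assms(1) by (simp add: positive_op_iff self_adjoint_inner)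
  define \<eta> where "\<eta> = \<xi> - B \<xi>"
  have "0 \<le> inner \<eta> (B \<eta>) + inner (B \<xi>) (B \<xi> - B (B \<xi>))"
    using assms by (intro add_nonneg_nonneg) (auto simp: positive_op_iff blinfun.diff_left)
  also have "\<dots> = inner \<xi> (B \<xi>) - inner (B \<xi>) (B \<xi>)"
    by (simp add: \<eta>_def blinfun.diff_right inner_diff_left inner_diff_right sa)
  finally have "(norm (B \<xi>))\<^sup>2 \<le> inner \<xi> (B \<xi>)"
    by (simp add: power2_norm_eq_inner)
  also have "\<dots> \<le> (norm \<xi>)\<^sup>2"
  proof -
    have "0 \<le> inner \<xi> (\<xi> - B \<xi>)" using assms(2) by (auto simp: positive_op_iff blinfun.diff_left)
    then show ?thesis by (simp add: inner_diff_right power2_norm_eq_inner)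
  qed
  finally show "norm (B \<xi>) \<le> 1 * norm \<xi>"
    by simp
qed simp

section \<open>Square roots of positive operators\<close>

text \<open>The iteration \<open>b \<mapsto> (B + b\<^sup>2) / 2\<close> converges to \<open>1 - sqrt (1 - B)\<close>; the scalar iteration for
  \<open>B = 1\<close> majorizes its increments.\<close>

primrec sqrt_iter :: "'h::complex_hilbert oper \<Rightarrow> nat \<Rightarrow> 'h oper" where
  "sqrt_iter B 0 = 0"
| "sqrt_iter B (Suc n) = (1/2) *\<^sub>R (B + (sqrt_iter B n o\<^sub>L sqrt_iter B n))"

primrec sqrt_iter_real :: "nat \<Rightarrow> real" where
  "sqrt_iter_real 0 = 0"
| "sqrt_iter_real (Suc n) = (1 + sqrt_iter_real n * sqrt_iter_real n) / 2"

lemma sqrt_iter_real_bounds: "0 \<le> sqrt_iter_real n" "sqrt_iter_real n \<le> 1"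
  by (induction n) (auto simp: mult_le_one)

lemma sqrt_iter_real_mono: "sqrt_iter_real n \<le> sqrt_iter_real (Suc n)"
proof -
  have "0 \<le> (1 - sqrt_iter_real n)\<^sup>2" by simp
  then show ?thesis by (simp add: power2_eq_square algebra_simps)
qed

lemma norm_sqrt_iter_le: "norm B \<le> 1 \<Longrightarrow> norm (sqrt_iter B n) \<le> sqrt_iter_real n"
proof (induction n)
  case (Suc n)
  have "norm (sqrt_iter B n o\<^sub>L sqrt_iter B n) \<le> sqrt_iter_real n * sqrt_iter_real n"
    using Suc by (intro order_trans[OF norm_blinfun_compose] mult_mono) (auto simp: sqrt_iter_real_bounds)
  then have "norm (B + (sqrt_iter B n o\<^sub>L sqrt_iter B n)) \<le> 1 + sqrt_iter_real n * sqrt_iter_real n"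
    using Suc.prems norm_triangle_ineq[of B "sqrt_iter B n o\<^sub>L sqrt_iter B n"] by linarith
  then show ?case by simp
qed simp

text \<open>Writing the difference of squares as s(s - t) + (s - t)t requires no commutativity. The
  scalar sequence satisfies the same recursion with equality, so its increments dominate by
  induction.\<close>

lemma norm_sqrt_iter_diff:
  assumes "norm B \<le> 1"
  shows "norm (sqrt_iter B (Suc n) - sqrt_iter B n) \<le> sqrt_iter_real (Suc n) - sqrt_iter_real n"
proof (induction n)
  case 0
  then show ?case using assms by simp
next
  case (Suc n)
  let ?b = "sqrt_iter B" and ?t = sqrt_iter_real
  have "?b (Suc (Suc n)) - ?b (Suc n) = (1/2) *\<^sub>R ((?b (Suc n) o\<^sub>L ?b (Suc n)) - (?b n o\<^sub>L ?b n))"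
    by (simp only: sqrt_iter.simps scaleR_diff_right[symmetric] add_diff_cancel_left)
  also have "(?b (Suc n) o\<^sub>L ?b (Suc n)) - (?b n o\<^sub>L ?b n)
      = (?b (Suc n) o\<^sub>L (?b (Suc n) - ?b n)) + ((?b (Suc n) - ?b n) o\<^sub>L ?b n)"
    by (rule blinfun_eqI) (simp only: blinfun.bilinear_simps blinfun_apply_blinfun_compose, simp)
  finally have "norm (?b (Suc (Suc n)) - ?b (Suc n))
      \<le> (norm (?b (Suc n) o\<^sub>L (?b (Suc n) - ?b n)) + norm ((?b (Suc n) - ?b n) o\<^sub>L ?b n)) / 2"
    using norm_triangle_ineq[of "?b (Suc n) o\<^sub>L (?b (Suc n) - ?b n)" "(?b (Suc n) - ?b n) o\<^sub>L ?b n"]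
    by (simp del: sqrt_iter.simps)
  also have "\<dots> \<le> (?t (Suc n) * (?t (Suc n) - ?t n) + (?t (Suc n) - ?t n) * ?t n) / 2"
    by (intro divide_right_mono add_mono order_trans[OF norm_blinfun_compose] mult_mono Suc
        norm_sqrt_iter_le assms sqrt_iter_real_bounds) (use sqrt_iter_real_mono in auto)
  also have "\<dots> = ?t (Suc (Suc n)) - ?t (Suc n)"
  proof -
    have "(s * (s - t) + (s - t) * t) / 2 = (1 + s * s) / 2 - (1 + t * t) / 2" for s t :: real
      by (simp add: field_simps)
    then show ?thesis by (metis sqrt_iter_real.simps(2))
  qed
  finally show ?case .
qed

lemma sqrt_iter_convergent:
  assumes "norm B \<le> 1"
  shows "convergent (sqrt_iter B)"
proof -
  have le: "norm (sqrt_iter B m - sqrt_iter B n) \<le> sqrt_iter_real m - sqrt_iter_real n" if "n \<le> m" for m n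
    using that
  proof (induction m rule: dec_induct)
    case (step m)
    have "sqrt_iter B (Suc m) - sqrt_iter B n
        = (sqrt_iter B (Suc m) - sqrt_iter B m) + (sqrt_iter B m - sqrt_iter B n)" by simp
    then have "norm (sqrt_iter B (Suc m) - sqrt_iter B n)
        \<le> norm (sqrt_iter B (Suc m) - sqrt_iter B m) + norm (sqrt_iter B m - sqrt_iter B n)"
      by (metis norm_triangle_ineq)
    then show ?case using norm_sqrt_iter_diff[OF assms, of m] step by linarith
  qed simp
  have "incseq sqrt_iter_real" by (rule incseq_SucI) (rule sqrt_iter_real_mono)
  then have "Cauchy sqrt_iter_real"
    using incseq_convergent[of sqrt_iter_real 1] sqrt_iter_real_bounds
    by (metis LIMSEQ_imp_Cauchy)
  have "Cauchy (sqrt_iter B)"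
  proof (rule metric_CauchyI)
    fix e :: real assume "0 < e"
    then obtain N where N: "\<And>m n. m \<ge> N \<Longrightarrow> n \<ge> N \<Longrightarrow> dist (sqrt_iter_real m) (sqrt_iter_real n) < e"
      using \<open>Cauchy sqrt_iter_real\<close> by (meson metric_CauchyD)
    have "dist (sqrt_iter B m) (sqrt_iter B n) < e" if "m \<ge> N" "n \<ge> N" for m n
      using le[of m n] le[of n m] N[OF that] by (cases m n rule: le_cases) (auto simp: dist_norm norm_minus_commute)
    then show "\<exists>N. \<forall>m\<ge>N. \<forall>n\<ge>N. dist (sqrt_iter B m) (sqrt_iter B n) < e" by blast
  qed
  then show ?thesis by (simp add: Cauchy_convergent_iff)
qed

lemma sqrt_iter_clinear_op: "clinear_op B \<Longrightarrow> clinear_op (sqrt_iter B n)"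
proof (induction n)
  case 0
  then show ?case by (metis clinear_op_diff diff_self sqrt_iter.simps(1))
qed (simp add: clinear_op_add clinear_op_compose clinear_op_scaleR)

lemma sqrt_iter_self_adjoint: "self_adjoint B \<Longrightarrow> self_adjoint (sqrt_iter B n)"
proof (induction n)
  case 0
  then show ?case by (metis self_adjoint_diff diff_self sqrt_iter.simps(1))
next
  case (Suc n)
  then have "self_adjoint (sqrt_iter B n o\<^sub>L sqrt_iter B n)" by (simp add: is_adjoint_def)
  with Suc show ?case by (simp add: self_adjoint_add self_adjoint_scaleR)
qed

lemma op_compose_add_left: "(x + y) o\<^sub>L z = (x o\<^sub>L z) + (y o\<^sub>L z)"
  and op_compose_add_right: "z o\<^sub>L (x + y) = (z o\<^sub>L x) + (z o\<^sub>L y)"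
  and op_compose_diff_left: "(x - y) o\<^sub>L z = (x o\<^sub>L z) - (y o\<^sub>L z)"
  and op_compose_diff_right: "z o\<^sub>L (x - y) = (z o\<^sub>L x) - (z o\<^sub>L y)"
  and op_compose_scaleR_left: "(r *\<^sub>R x) o\<^sub>L z = r *\<^sub>R (x o\<^sub>L z)"
  and op_compose_scaleR_right: "z o\<^sub>L (r *\<^sub>R x) = r *\<^sub>R (z o\<^sub>L x)"
  and op_compose_assoc: "(x o\<^sub>L y) o\<^sub>L z = x o\<^sub>L (y o\<^sub>L z)"
  and op_compose_id_left: "id_blinfun o\<^sub>L x = x"
  and op_compose_id_right: "x o\<^sub>L id_blinfun = x"
  for x y z :: "'h::real_normed_vector \<Rightarrow>\<^sub>L 'h"
  by (auto intro!: blinfun_eqI simp: blinfun.bilinear_simps)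

lemmas op_compose_distribs = op_compose_add_left op_compose_add_right op_compose_diff_left op_compose_diff_right
  op_compose_scaleR_left op_compose_scaleR_right op_compose_id_left op_compose_id_right

lemma sqrt_iter_commute:
  assumes "B o\<^sub>L y = y o\<^sub>L B" shows "sqrt_iter B n o\<^sub>L y = y o\<^sub>L sqrt_iter B n"
proof (induction n)
  case 0
  then show ?case by (auto intro!: blinfun_eqI simp: blinfun.bilinear_simps)
next
  case (Suc n)
  let ?b = "sqrt_iter B n"
  have "(?b o\<^sub>L ?b) o\<^sub>L y = ?b o\<^sub>L (?b o\<^sub>L y)" by (rule op_compose_assoc)
  also have "\<dots> = ?b o\<^sub>L (y o\<^sub>L ?b)" by (simp only: Suc)
  also have "\<dots> = (?b o\<^sub>L y) o\<^sub>L ?b" by (rule op_compose_assoc[symmetric])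
  also have "\<dots> = (y o\<^sub>L ?b) o\<^sub>L ?b" by (simp only: Suc)
  also have "\<dots> = y o\<^sub>L (?b o\<^sub>L ?b)" by (rule op_compose_assoc)
  finally show ?case using assms by (simp add: op_compose_distribs)
qed

text \<open>For the positive contraction B = 1 - A/K the limit L satisfies 2L = B + L^2, that is (1
  - L)^2 = A/K; hence h = sqrt K (1 - L). The iterates commute with everything that commutes with A.
  This is recorded because both uniqueness and membership in the algebra rest on it.\<close>

lemma positive_op_sqrt_exists:
  fixes A :: "'h::complex_hilbert oper"
  assumes A: "positive_op A"
  shows "\<exists>h. positive_op h \<and> h o\<^sub>L h = A \<and> (\<forall>y. A o\<^sub>L y = y o\<^sub>L A \<longrightarrow> h o\<^sub>L y = y o\<^sub>L h)"
proof -
  define K where "K = norm A + 1"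
  have K: "0 < K" "norm A \<le> K" by (auto simp: K_def add_nonneg_pos)
  define B where "B = id_blinfun - (1/K) *\<^sub>R A"
  have A': "clinear_op A" "self_adjoint A" "\<And>\<xi>. 0 \<le> inner \<xi> (A \<xi>)"
    using A by (auto simp: positive_op_iff)
  have Bcl: "clinear_op B" and Bsa: "self_adjoint B"
    by (simp_all add: B_def clinear_op_diff clinear_op_id clinear_op_scaleR A'
        self_adjoint_diff self_adjoint_id self_adjoint_scaleR)
  have "norm B \<le> 1"
  proof (rule positive_contraction_norm_le_1)
    have "0 \<le> inner \<xi> (B \<xi>)" for \<xi>
    proof -
      have "inner \<xi> (A \<xi>) \<le> K * (norm \<xi>)\<^sup>2"
        by (rule order_trans[OF inner_op_le]) (simp add: K mult_right_mono)
      then show ?thesis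
        using K by (simp add: B_def blinfun.diff_left blinfun.scaleR_left inner_diff_right
            power2_norm_eq_inner field_simps)
    qed
    then show "positive_op B" using Bcl Bsa by (simp add: positive_op_iff)
    show "positive_op (id_blinfun - B)"
      using A' K by (simp add: B_def positive_op_iff clinear_op_scaleR self_adjoint_scaleR
          blinfun.scaleR_left)
  qed
  then obtain L where L: "sqrt_iter B \<longlonglongrightarrow> L"
    using sqrt_iter_convergent by (auto simp: convergent_def)
  have app: "(\<lambda>n. sqrt_iter B n \<xi>) \<longlonglongrightarrow> L \<xi>" for \<xi>
    by (intro blinfun.tendsto L tendsto_const)
  have comp: "(\<lambda>n. sqrt_iter B n o\<^sub>L y) \<longlonglongrightarrow> (L o\<^sub>L y)" "(\<lambda>n. y o\<^sub>L sqrt_iter B n) \<longlonglongrightarrow> (y o\<^sub>L L)" for y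
    by (intro bounded_bilinear.tendsto[OF bounded_bilinear_blinfun_compose] L tendsto_const)+
  have "norm L \<le> 1"
    by (rule LIMSEQ_le_const2[OF tendsto_norm[OF L]])
       (use norm_sqrt_iter_le[OF \<open>norm B \<le> 1\<close>] sqrt_iter_real_bounds order_trans in blast)
  have "clinear_op L"
    unfolding clinear_op_def
  proof (intro allI)
    fix c \<xi>
    have "(\<lambda>n. sqrt_iter B n (c *\<^sub>C \<xi>)) \<longlonglongrightarrow> c *\<^sub>C L \<xi>"
      using sqrt_iter_clinear_op[OF Bcl]
      by (simp add: clinear_op_def) (intro bounded_linear.tendsto[OF bounded_linear_scaleC] app)
    then show "L (c *\<^sub>C \<xi>) = c *\<^sub>C L \<xi>" by (rule LIMSEQ_unique[OF app])
  qed
  have cinner_lim: "(\<lambda>n. cinner (f n) \<zeta>) \<longlonglongrightarrow> cinner l \<zeta>" if "f \<longlonglongrightarrow> l" for f and l \<zeta> :: 'h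
  proof -
    \<comment> \<open>Continuity is available for the real inner product only, so the complex one is
      expressed through it.\<close>
    have "cinner \<xi> \<zeta> = Complex (inner \<xi> \<zeta>) (inner \<xi> (- \<i> *\<^sub>C \<zeta>))" for \<xi> \<zeta> :: 'h
      by (simp add: complex_eq_iff inner_eq_Re_cinner cinner_scaleC_right)
    then show ?thesis by (auto intro!: tendsto_intros that)
  qed
  have "self_adjoint L"
    unfolding is_adjoint_def
  proof (intro allI)
    fix \<xi> \<zeta>
    have "(\<lambda>n. cnj (cinner (sqrt_iter B n \<zeta>) \<xi>)) \<longlonglongrightarrow> cnj (cinner (L \<zeta>) \<xi>)"
      by (intro tendsto_intros cinner_lim app)
    moreover have "cnj (cinner (sqrt_iter B n \<zeta>) \<xi>) = cinner (sqrt_iter B n \<xi>) \<zeta>" for n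
      using sqrt_iter_self_adjoint[OF Bsa, of n] by (metis cinner_commute is_adjoint_def)
    ultimately have "(\<lambda>n. cinner (sqrt_iter B n \<xi>) \<zeta>) \<longlonglongrightarrow> cnj (cinner (L \<zeta>) \<xi>)" by simp
    then have "cinner (L \<xi>) \<zeta> = cnj (cinner (L \<zeta>) \<xi>)"
      using LIMSEQ_unique cinner_lim[OF app] by blast
    then show "cinner (L \<xi>) \<zeta> = cinner \<xi> (L \<zeta>)" by (metis cinner_commute)
  qed
  have "L = (1/2) *\<^sub>R (B + (L o\<^sub>L L))"
  proof (rule LIMSEQ_unique)
    show "(\<lambda>n. sqrt_iter B (Suc n)) \<longlonglongrightarrow> L" by (rule LIMSEQ_Suc[OF L])
    show "(\<lambda>n. sqrt_iter B (Suc n)) \<longlonglongrightarrow> (1/2) *\<^sub>R (B + (L o\<^sub>L L))"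
      unfolding sqrt_iter.simps
      by (intro tendsto_intros bounded_bilinear.tendsto[OF bounded_bilinear_blinfun_compose] L)
  qed
  then have "2 *\<^sub>R L = 2 *\<^sub>R ((1/2) *\<^sub>R (B + (L o\<^sub>L L)))" by (rule arg_cong)
  then have LL: "L + L = B + (L o\<^sub>L L)" by (simp add: scaleR_2)
  define h where "h = sqrt K *\<^sub>R (id_blinfun - L)"
  have "h o\<^sub>L h = K *\<^sub>R ((id_blinfun - L) o\<^sub>L (id_blinfun - L))"
    using K by (simp add: h_def op_compose_scaleR_left op_compose_scaleR_right)
  also have "(id_blinfun - L) o\<^sub>L (id_blinfun - L) = id_blinfun - (L + L) + (L o\<^sub>L L)"
    by (simp add: op_compose_distribs)
  also have "\<dots> = (1/K) *\<^sub>R A" by (simp add: LL B_def)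
  finally have hh: "h o\<^sub>L h = A" using K by simp
  have "0 \<le> inner \<xi> (h \<xi>)" for \<xi>
  proof -
    have "inner \<xi> (L \<xi>) \<le> norm L * (norm \<xi>)\<^sup>2" by (rule inner_op_le)
    also have "\<dots> \<le> 1 * (norm \<xi>)\<^sup>2" using \<open>norm L \<le> 1\<close> by (intro mult_right_mono) auto
    finally show ?thesis
      using K by (simp add: h_def blinfun.bilinear_simps inner_diff_right power2_norm_eq_inner)
  qed
  then have "positive_op h"
    unfolding positive_op_iff h_def
    by (simp add: clinear_op_scaleR clinear_op_diff clinear_op_id \<open>clinear_op L\<close> \<open>self_adjoint L\<close>
        self_adjoint_scaleR self_adjoint_diff self_adjoint_id)
  moreover have "h o\<^sub>L y = y o\<^sub>L h" if "A o\<^sub>L y = y o\<^sub>L A" for y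
  proof -
    have "B o\<^sub>L y = y o\<^sub>L B" using that by (simp add: B_def op_compose_distribs)
    then have "L o\<^sub>L y = y o\<^sub>L L"
      using LIMSEQ_unique[OF comp(1)[of y]] comp(2)[of y] sqrt_iter_commute[of B y] by simp
    then show ?thesis by (simp add: h_def op_compose_distribs)
  qed
  ultimately show ?thesis using hh by blast
qed

lemma positive_op_form_zero:
  assumes "positive_op h" "inner \<xi> (h \<xi>) = 0" shows "h \<xi> = 0"
proof -
  obtain r where r: "positive_op r" "r o\<^sub>L r = h"
    using positive_op_sqrt_exists[OF assms(1)] by blast
  have "inner (r \<xi>) (r \<xi>) = inner \<xi> (r (r \<xi>))"
    using r(1) by (simp add: positive_op_iff self_adjoint_inner)
  also have "\<dots> = 0" using assms(2) r(2) by (metis blinfun_apply_blinfun_compose)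
  finally have "r \<xi> = 0" by simp
  then show ?thesis using r(2) by (metis blinfun_apply_blinfun_compose blinfun.zero_right)
qed

text \<open>With d = (h - k) \<xi>, commutation gives (h + k) d = 0. Both forms are nonnegative at
  d, so h d = k d = 0, and therefore d is orthogonal to itself.\<close>

lemma positive_op_sqrt_unique:
  fixes h k :: "'h::complex_hilbert oper"
  assumes h: "positive_op h" and k: "positive_op k" and eq: "h o\<^sub>L h = k o\<^sub>L k"
    and comm: "k o\<^sub>L h = h o\<^sub>L k"
  shows "h = k"
proof (rule blinfun_eqI)
  fix \<xi>
  have sa: "inner (h \<xi>) \<zeta> = inner \<xi> (h \<zeta>)" "inner (k \<xi>) \<zeta> = inner \<xi> (k \<zeta>)" for \<xi> \<zeta>
    using h k by (simp_all add: positive_op_iff self_adjoint_inner)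
  have eq': "h (h \<zeta>) = k (k \<zeta>)" "k (h \<zeta>) = h (k \<zeta>)" for \<zeta>
    using eq comm by (metis blinfun_apply_blinfun_compose)+
  define d where "d = h \<xi> - k \<xi>"
  have "h d + k d = 0" by (simp add: d_def blinfun.diff_right eq')
  then have "inner d (h d) + inner d (k d) = 0"
    by (metis inner_add_right inner_zero_right)
  moreover have "0 \<le> inner d (h d)" "0 \<le> inner d (k d)" using h k by (auto simp: positive_op_iff)
  ultimately have "inner d (h d) = 0" "inner d (k d) = 0" by linarith+
  then have "h d = 0" "k d = 0" using positive_op_form_zero h k by blast+
  then have "inner d d = 0"
    using sa(1)[of \<xi> d] sa(2)[of \<xi> d] by (simp add: d_def inner_diff_left)
  then show "h \<xi> = k \<xi>" by (simp add: d_def)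
qed

text \<open>Any competing positive root commutes with its own square and hence with the root
  constructed above; so the definite description denotes the latter.\<close>

lemma op_abs_exists:
  fixes x :: "'h::complex_hilbert oper"
  assumes "clinear_op x" "clinear_op (adj x)" "is_adjoint x (adj x)"
  shows "positive_op (op_abs x)" "op_abs x o\<^sub>L op_abs x = adj x o\<^sub>L x"
    "\<And>y. (adj x o\<^sub>L x) o\<^sub>L y = y o\<^sub>L (adj x o\<^sub>L x) \<Longrightarrow> op_abs x o\<^sub>L y = y o\<^sub>L op_abs x"
proof -
  define A where "A = adj x o\<^sub>L x"
  have adj: "cinner (adj x \<xi>) \<zeta> = cinner \<xi> (x \<zeta>)" for \<xi> \<zeta>
    using assms(3) by (simp add: is_adjoint_def)
  have adj': "cinner \<xi> (adj x \<zeta>) = cinner (x \<xi>) \<zeta>" for \<xi> \<zeta>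
    by (metis adj cinner_commute)
  have "positive_op A"
    unfolding positive_op_def A_def
    by (simp add: assms clinear_op_compose adj' cinner_self complex_nonneg_Reals_iff)
  then obtain h where h: "positive_op h" "h o\<^sub>L h = A"
    and comm: "\<And>y. A o\<^sub>L y = y o\<^sub>L A \<Longrightarrow> h o\<^sub>L y = y o\<^sub>L h"
    using positive_op_sqrt_exists by blast
  have "op_abs x = h"
    unfolding op_abs_def
  proof (rule the_equality)
    fix k assume k: "positive_op k \<and> k o\<^sub>L k = adj x o\<^sub>L x"
    then have "A o\<^sub>L k = k o\<^sub>L A" by (metis A_def op_compose_assoc)
    then have hk: "h o\<^sub>L k = k o\<^sub>L h" by (rule comm)
    have kk: "k o\<^sub>L k = h o\<^sub>L h" using k h(2) by (simp add: A_def)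
    show "k = h" by (rule positive_op_sqrt_unique[OF conjunct1[OF k] h(1) kk hk])
  qed (use h in \<open>simp add: A_def\<close>)
  then show "positive_op (op_abs x)" "op_abs x o\<^sub>L op_abs x = adj x o\<^sub>L x"
    "\<And>y. (adj x o\<^sub>L x) o\<^sub>L y = y o\<^sub>L (adj x o\<^sub>L x) \<Longrightarrow> op_abs x o\<^sub>L y = y o\<^sub>L op_abs x"
    using h comm unfolding A_def by blast+
qed

section \<open>Spectral distributions in a tracial von Neumann algebra\<close>

lemma scaleR_eq_scalar_op: "r *\<^sub>R x = scalar_op (of_real r) o\<^sub>L x" for x :: "'h::complex_hilbert oper"
  by (rule blinfun_eqI) (simp add: blinfun.scaleR_left scaleR_scaleC)

lemma op_power_eq_funpow: "op_power x n = (((o\<^sub>L) x) ^^ n) id_blinfun"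
  by (induction n) (simp_all add: op_power_def op_prod_def)

lemma linear_op_compose: "linear ((o\<^sub>L) x :: 'h oper \<Rightarrow> 'h oper)" for x :: "'h::complex_hilbert oper"
  by (rule linearI) (simp_all add: op_compose_distribs)

lemma op_prod_append: "op_prod (xs @ ys) = op_prod xs o\<^sub>L op_prod ys"
  by (induction xs) (simp_all add: op_prod_def op_compose_id_left op_compose_assoc)

lemma star_word_append: "star_word x (v @ w) = star_word x v o\<^sub>L star_word x w"
  by (simp add: star_word_def op_prod_append)

lemma op_power_square: "op_power x (2 * k) = op_power (x o\<^sub>L x) k"
  by (induction k) (simp_all add: op_power_def op_prod_def op_compose_assoc)

lemma op_power_adj_compose:
  "op_power (adj x o\<^sub>L x) k = star_word x (concat (replicate k [True, False]))"
  by (induction k) (simp_all add: op_power_def op_prod_def star_word_def op_compose_assoc)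

context tracial_vN_algebra
begin

lemma M_clinear: "x \<in> M \<Longrightarrow> clinear_op x"
  using von_neumann by (simp add: von_neumann_algebra_def)

lemma M_adj:
  assumes "x \<in> M" shows "is_adjoint x (adj x)" "adj x \<in> M"
proof -
  obtain y where "y \<in> M" "is_adjoint x y"
    using von_neumann assms by (auto simp: von_neumann_algebra_def)
  then show "is_adjoint x (adj x)" "adj x \<in> M" using adj_eqI by metis+
qed

text \<open>The bicommutant equation in pointwise form; the closure properties of \<open>M\<close>
  under the algebra operations are read off from it.\<close>

lemma M_iff: "y \<in> M \<longleftrightarrow> clinear_op y \<and> (\<forall>x\<in>commutant M. x o\<^sub>L y = y o\<^sub>L x)"
  using von_neumann unfolding von_neumann_algebra_def commutant_def by blast

lemma M_id: "id_blinfun \<in> M"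
  by (simp add: M_iff clinear_op_id op_compose_distribs)

lemma M_add: "x \<in> M \<Longrightarrow> y \<in> M \<Longrightarrow> x + y \<in> M"
  by (simp add: M_iff clinear_op_add op_compose_distribs)

lemma M_diff: "x \<in> M \<Longrightarrow> y \<in> M \<Longrightarrow> x - y \<in> M"
  by (simp add: M_iff clinear_op_diff op_compose_distribs)

lemma M_scaleR: "x \<in> M \<Longrightarrow> r *\<^sub>R x \<in> M"
  by (simp add: M_iff clinear_op_scaleR op_compose_distribs)

lemma M_compose: "x \<in> M \<Longrightarrow> y \<in> M \<Longrightarrow> x o\<^sub>L y \<in> M"
proof -
  assume x: "x \<in> M" and y: "y \<in> M"
  have "v o\<^sub>L (x o\<^sub>L y) = (x o\<^sub>L y) o\<^sub>L v" if "v \<in> commutant M" for v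
  proof -
    have "v o\<^sub>L (x o\<^sub>L y) = (x o\<^sub>L v) o\<^sub>L y"
      using x that by (simp only: M_iff op_compose_assoc[symmetric])
    also have "\<dots> = x o\<^sub>L (y o\<^sub>L v)"
      using y that by (simp only: M_iff op_compose_assoc)
    finally show ?thesis unfolding op_compose_assoc .
  qed
  then show ?thesis
    using clinear_op_compose[OF M_clinear[OF x] M_clinear[OF y]] M_iff by blast
qed

lemma M_scalar: "scalar_op c \<in> M"
proof -
  have "x o\<^sub>L scalar_op c = scalar_op c o\<^sub>L x" if "x \<in> commutant M" for x
  proof (rule blinfun_eqI)
    fix \<xi>
    have "clinear_op x" using that by (simp add: commutant_def)
    then show "(x o\<^sub>L scalar_op c) \<xi> = (scalar_op c o\<^sub>L x) \<xi>" by (simp add: clinear_op_def)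
  qed
  then show ?thesis using clinear_op_scalar M_iff by blast
qed

lemma trace_scaleR: "x \<in> M \<Longrightarrow> \<tau> (r *\<^sub>R x) = of_real r * \<tau> x"
  by (simp add: scaleR_eq_scalar_op trace_scalar)

lemma trace_diff: "x \<in> M \<Longrightarrow> y \<in> M \<Longrightarrow> \<tau> (x - y) = \<tau> x - \<tau> y"
  using trace_add[of x "(-1) *\<^sub>R y"] trace_scaleR[of y "-1"] M_scaleR[of y "-1"] by simp

text \<open>Elements of the commutant of \<open>M\<close> commute with
  \<open>adj x o\<^sub>L x\<close> and therefore with its root, which puts the root into the
  bicommutant. The norm bound follows from
  \<open>norm (op_abs x \<xi>) = norm (x \<xi>)\<close>.\<close>

lemma op_abs_properties:
  assumes "x \<in> M"
  shows "op_abs x \<in> M" "positive_op (op_abs x)" "op_abs x o\<^sub>L op_abs x = adj x o\<^sub>L x"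
    "norm (op_abs x) \<le> norm x"
proof -
  note adj = M_adj[OF assms]
  note abs = op_abs_exists[OF M_clinear[OF assms] M_clinear[OF adj(2)] adj(1)]
  show pos: "positive_op (op_abs x)" and sq: "op_abs x o\<^sub>L op_abs x = adj x o\<^sub>L x"
    using abs by blast+
  have "y o\<^sub>L op_abs x = op_abs x o\<^sub>L y" if "y \<in> commutant M" for y
  proof -
    have "adj x o\<^sub>L x \<in> M" using adj assms by (simp add: M_compose)
    then show ?thesis using abs(3)[of y] that by (simp add: commutant_def)
  qed
  then show "op_abs x \<in> M" using pos by (simp add: M_iff positive_op_iff)
  show "norm (op_abs x) \<le> norm x"
  proof (rule norm_blinfun_bound)
    fix \<xi>
    have "inner (op_abs x \<xi>) (op_abs x \<xi>) = inner \<xi> (op_abs x (op_abs x \<xi>))"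
      using pos by (simp add: positive_op_iff self_adjoint_inner)
    also have "\<dots> = inner \<xi> (adj x (x \<xi>))"
      using sq by (metis blinfun_apply_blinfun_compose)
    also have "\<dots> = inner (adj x (x \<xi>)) \<xi>" by (rule inner_commute)
    also have "\<dots> = inner (x \<xi>) (x \<xi>)"
      using adj(1) by (simp add: is_adjoint_def inner_eq_Re_cinner)
    finally have "norm (op_abs x \<xi>) = norm (x \<xi>)" by (simp add: norm_eq_sqrt_inner)
    then show "norm (op_abs x \<xi>) \<le> norm x * norm \<xi>" by (simp add: norm_blinfun)
  qed simp
qed

text \<open>\<open>peval\<close> is taken for left multiplication by \<open>h\<close> on the space
  of operators and evaluated at the identity, so that \<open>Q p\<close> is the operator
  p(h).\<close>

lemma peval_op:
  fixes h :: "'h oper"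
  defines "Q \<equiv> \<lambda>p. peval ((o\<^sub>L) h) p id_blinfun"
  assumes h: "h \<in> M" "positive_op h"
  shows "Q p \<in> M" "h o\<^sub>L Q p = Q p o\<^sub>L h" "self_adjoint (Q p)" "Q (p * q) = Q p o\<^sub>L Q q"
proof -
  note lin = linear_op_compose[of h]
  have Q_pCons: "Q (pCons a p) = a *\<^sub>R id_blinfun + (h o\<^sub>L Q p)" for a p
    unfolding Q_def by (rule peval_pCons[OF lin])
  have Q0: "Q 0 = 0" by (simp add: Q_def)
  show "Q p \<in> M"
  proof (induction p)
    case 0
    then show ?case using M_diff[OF M_id M_id] by (simp add: Q0)
  qed (simp add: Q_pCons M_add M_scaleR M_id M_compose h)
  have comp: "peval ((o\<^sub>L) h) p y = Q p o\<^sub>L y" for p and y :: "'h oper"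
  proof (induction p)
    case 0
    have "(0 o\<^sub>L y) = 0" by (rule blinfun_eqI) simp
    then show ?case by (simp add: Q0)
  next
    case (pCons a p)
    then show ?case by (simp add: Q_pCons peval_pCons[OF lin] op_compose_distribs op_compose_assoc)
  qed
  show comm: "h o\<^sub>L Q p = Q p o\<^sub>L h" for p
    using peval_commute[OF lin, of p id_blinfun] comp[of p h] by (simp add: Q_def op_compose_id_right)
  show "self_adjoint (Q p)"
  proof (induction p)
    case 0
    then show ?case using self_adjoint_diff[OF self_adjoint_id self_adjoint_id] by (simp add: Q0)
  next
    case (pCons a p)
    have "cinner (h (Q p \<xi>)) \<zeta> = cinner \<xi> (h (Q p \<zeta>))" for \<xi> \<zeta>
    proof -
      have "cinner (h (Q p \<xi>)) \<zeta> = cinner \<xi> (Q p (h \<zeta>))"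
        using h(2) pCons.IH by (simp add: positive_op_iff is_adjoint_def)
      also have "Q p (h \<zeta>) = h (Q p \<zeta>)"
        using arg_cong[OF comm[of p], of "\<lambda>x. blinfun_apply x \<zeta>"] by simp
      finally show ?thesis .
    qed
    then have "self_adjoint (h o\<^sub>L Q p)" by (simp add: is_adjoint_def)
    then show ?case by (simp add: Q_pCons self_adjoint_add self_adjoint_scaleR self_adjoint_id)
  qed
  show "Q (p * q) = Q p o\<^sub>L Q q"
  proof -
    have "Q (p * q) = peval ((o\<^sub>L) h) p (Q q)" by (simp add: Q_def peval_mult[OF lin])
    then show ?thesis by (simp only: comp)
  qed
qed

text \<open>The measure is the one represented by the functional that sends p to the real part of
  the trace of p(h). Each positivity condition concerns an operator q(h) g q(h) with g one of 1, K -
  h, K + h, which are positive because 0 <= h <= K.\<close>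

lemma spectral_distribution_exists:
  assumes h: "h \<in> M" "positive_op h" and K: "norm h \<le> K" "0 < K"
  shows "\<exists>\<mu>. bounded_prob K \<mu> \<and> (\<forall>n. complex_of_real (\<integral>t. t ^ n \<partial>\<mu>) = \<tau> (op_power h n))"
proof -
  define Q where "Q p = peval ((o\<^sub>L) h) p id_blinfun" for p
  note Q = peval_op[OF h, folded Q_def]
  note lin = linear_op_compose[of h]
  define l where "l p = Re (\<tau> (Q p))" for p
  have Qcl: "clinear_op (Q p)" for p using Q(1) by (rule M_clinear)
  have Qlin: "Q [:a, b:] = a *\<^sub>R id_blinfun + b *\<^sub>R h" for a b
    using peval_linear_factor[OF lin, of a b id_blinfun] by (simp add: Q_def op_compose_id_right)
  have l_pos: "0 \<le> l p" if "positive_op (Q p)" for p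
    using trace_positive[OF Q(1) that] by (simp add: l_def complex_nonneg_Reals_iff)
  have sandwich: "positive_op (Q (p * (q * q)))" if "positive_op (Q p)" for p q
  proof -
    have "Q (p * (q * q)) = Q (q * p * q)" by (simp add: mult_ac)
    also have "\<dots> = Q q o\<^sub>L Q p o\<^sub>L Q q" by (simp only: Q(4))
    finally show ?thesis using that Qcl Q(3) by (simp add: positive_op_sandwich)
  qed
  have Q1: "Q 1 = id_blinfun" by (simp add: Q_def peval_1[OF lin])
  obtain \<mu> where \<mu>: "bounded_prob K \<mu>" "\<And>j. (\<integral>t. t ^ j \<partial>\<mu>) = l ([:0, 1:] ^ j)"
  proof (rule poly_functional_measure[of l K])
    show "l (p + q) = l p + l q" for p q
      using trace_add[OF Q(1) Q(1)] by (simp add: l_def) (simp add: Q_def peval_add[OF lin])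
    show "l (smult c p) = c * l p" for c p
    proof -
      have "Q (smult c p) = c *\<^sub>R Q p" by (simp add: Q_def peval_smult[OF lin])
      then show ?thesis using trace_scaleR[OF Q(1)] by (simp add: l_def)
    qed
    show "l 1 = 1" by (simp add: l_def Q1 trace_one)
    show "0 < K" by (rule K)
    show "0 \<le> l (q * q)" for q
      using positive_op_square[OF Qcl Q(3), of q] by (intro l_pos) (simp add: Q(4))
    show "0 \<le> l ([:K, -1:] * (q * q))" for q
    proof (intro l_pos sandwich)
      have "0 \<le> inner \<xi> ((K *\<^sub>R id_blinfun + (-1) *\<^sub>R h) \<xi>)" for \<xi>
      proof -
        have "inner \<xi> (h \<xi>) \<le> norm h * (norm \<xi>)\<^sup>2" by (rule inner_op_le)
        also have "\<dots> \<le> K * (norm \<xi>)\<^sup>2" using K by (intro mult_right_mono) auto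
        finally show ?thesis
          by (simp add: blinfun.bilinear_simps inner_diff_right power2_norm_eq_inner)
      qed
      then show "positive_op (Q [:K, -1:])"
        using Qcl[of "[:K, -1:]"] Q(3)[of "[:K, -1:]"] by (simp add: positive_op_iff Qlin)
    qed
    show "0 \<le> l ([:K, 1:] * (q * q))" for q
    proof (intro l_pos sandwich)
      have "0 \<le> inner \<xi> ((K *\<^sub>R id_blinfun + 1 *\<^sub>R h) \<xi>)" for \<xi>
        using h(2) K by (simp add: positive_op_iff blinfun.bilinear_simps inner_add_right)
      then show "positive_op (Q [:K, 1:])"
        using Qcl[of "[:K, 1:]"] Q(3)[of "[:K, 1:]"] by (simp add: positive_op_iff Qlin)
    qed
  qed (use that in blast)
  have Qm: "Q ([:0, 1:] ^ n) = op_power h n" for n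
    by (simp add: Q_def peval_monom[OF lin] op_power_eq_funpow)
  \<comment> \<open>The functional sees only real parts of traces. Since h^n is a sandwich of 1 or
    of h, it is positive, and its trace is real anyway.\<close>
  have "positive_op (Q ([:0, 1:] ^ n))" for n
  proof -
    have "[:0, 1:] ^ n = [:0, 1:] ^ (n mod 2) * ([:0, 1:] ^ (n div 2) * [:0, 1::real:] ^ (n div 2))"
      by (metis mod_mult_div_eq mult_2 power_add)
    moreover have "positive_op (Q ([:0, 1:] ^ (n mod 2)))"
    proof (cases "n mod 2 = 0")
      case True
      then show ?thesis
        using positive_op_square[OF clinear_op_id self_adjoint_id] by (simp add: Q1 op_compose_distribs)
    next
      case False
      then have "Q ([:0, 1:] ^ (n mod 2)) = h" by (simp add: Qlin)
      then show ?thesis using h by simp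
    qed
    ultimately show ?thesis using sandwich by metis
  qed
  then have "Im (\<tau> (op_power h n)) = 0" for n
    using trace_positive[OF Q(1)] Qm by (metis complex_nonneg_Reals_iff)
  then have "complex_of_real (\<integral>t. t ^ n \<partial>\<mu>) = \<tau> (op_power h n)" for n
    by (simp add: \<mu>(2) l_def Qm complex_eq_iff)
  then show ?thesis using \<mu>(1) by blast
qed

lemma spectral_distribution_properties:
  assumes h: "h \<in> M" "positive_op h" and K: "norm h \<le> K" "0 < K"
  shows "bounded_prob K (spectral_distribution \<tau> h)"
    "complex_of_real (\<integral>t. t ^ n \<partial>spectral_distribution \<tau> h) = \<tau> (op_power h n)"
proof -
  obtain \<mu> where \<mu>: "bounded_prob K \<mu>" "\<And>n. complex_of_real (\<integral>t. t ^ n \<partial>\<mu>) = \<tau> (op_power h n)"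
    using spectral_distribution_exists[OF assms] by blast
  have "spectral_distribution \<tau> h = \<mu>"
    unfolding spectral_distribution_def
  proof (rule the_equality)
    show "compact_prob \<mu> \<and> (\<forall>n. complex_of_real (\<integral>t. t ^ n \<partial>\<mu>) = \<tau> (op_power h n))"
      using \<mu> compact_prob_iff_bounded_prob by blast
    fix \<nu> assume "compact_prob \<nu> \<and> (\<forall>n. complex_of_real (\<integral>t. t ^ n \<partial>\<nu>) = \<tau> (op_power h n))"
    then show "\<nu> = \<mu>"
      using \<mu> compact_prob_iff_bounded_prob by (intro moments_determine) (auto simp flip: of_real_eq_iff[where 'a=complex])
  qed
  then show "bounded_prob K (spectral_distribution \<tau> h)"
    "complex_of_real (\<integral>t. t ^ n \<partial>spectral_distribution \<tau> h) = \<tau> (op_power h n)"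
    using \<mu> by simp_all
qed

text \<open>Only even powers of the modulus are star-words in \<open>x\<close>. The odd moments are
  not controlled by star-moments in this way, but symmetrization will discard them.\<close>

lemma op_abs_distribution:
  assumes x: "x \<in> M" and K: "norm x \<le> K" "0 < K"
  defines "\<mu> \<equiv> spectral_distribution \<tau> (op_abs x)"
  shows "bounded_prob K \<mu>"
    "(\<integral>t. t ^ (2 * k) \<partial>\<mu>) = Re (\<tau> (star_word x (concat (replicate k [True, False]))))"
proof -
  note abs = op_abs_properties[OF x]
  have nK: "norm (op_abs x) \<le> K" using abs(4) K by linarith
  note sp = spectral_distribution_properties[OF abs(1,2) nK K(2), folded \<mu>_def]
  show "bounded_prob K \<mu>" by (rule sp)
  have "complex_of_real (\<integral>t. t ^ (2 * k) \<partial>\<mu>) = \<tau> (op_power (op_abs x) (2 * k))" by (rule sp)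
  also have "op_power (op_abs x) (2 * k) = star_word x (concat (replicate k [True, False]))"
    by (simp only: op_power_square abs(3) op_power_adj_compose)
  finally show "(\<integral>t. t ^ (2 * k) \<partial>\<mu>) = Re (\<tau> (star_word x (concat (replicate k [True, False]))))"
    by (metis Re_complex_of_real)
qed

section \<open>Star-moments under a scalar shift\<close>

lemma star_word_in_M: "x \<in> M \<Longrightarrow> star_word x w \<in> M"
proof (induction w)
  case Nil
  then show ?case by (simp add: star_word_def op_prod_def M_id)
next
  case (Cons b w)
  have "star_word x (b # w) = (if b then adj x else x) o\<^sub>L star_word x w"
    by (simp add: star_word_def op_prod_def)
  then show ?case using Cons M_adj(2) by (auto intro: M_compose)
qed

lemma adj_diff_scalar:
  assumes "x \<in> M" shows "adj (x - scalar_op z) = adj x - scalar_op (cnj z)"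
proof (rule adj_eqI)
  show "is_adjoint (x - scalar_op z) (adj x - scalar_op (cnj z))"
    using M_adj(1)[OF assms]
    by (simp add: is_adjoint_def blinfun.diff_left cinner_diff_left cinner_diff_right
        cinner_scaleC_left cinner_scaleC_right)
qed

text \<open>The prefix \<open>v\<close> of unshifted letters carries the induction: expanding the
  first shifted letter either moves that letter into the prefix or replaces it by a scalar.\<close>

lemma star_moments_shift:
  assumes a: "\<And>n. a_seq n \<in> M" "a \<in> M" and conv: "converges_in_star_moments \<tau> a_seq a"
  shows "(\<lambda>n. \<tau> (star_word (a_seq n) v o\<^sub>L star_word (a_seq n - scalar_op z) w))
    \<longlonglongrightarrow> \<tau> (star_word a v o\<^sub>L star_word (a - scalar_op z) w)"
proof (induction w arbitrary: v)
  case Nil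
  have "star_word x [] = id_blinfun" for x :: "'h oper" by (simp add: star_word_def op_prod_def)
  then show ?case using conv by (simp add: converges_in_star_moments_def op_compose_id_right)
next
  case (Cons b w)
  \<comment> \<open>The adjoint of a shifted operator is shifted by the conjugate scalar.\<close>
  define c where "c = (if b then cnj z else z)"
  have step: "\<tau> (star_word x v o\<^sub>L star_word (x - scalar_op z) (b # w))
      = \<tau> (star_word x (v @ [b]) o\<^sub>L star_word (x - scalar_op z) w)
        - c * \<tau> (star_word x v o\<^sub>L star_word (x - scalar_op z) w)" if x: "x \<in> M" for x
  proof -
    define xb where "xb = (if b then adj x else x)"
    define W where "W = star_word (x - scalar_op z) w"
    have W: "W \<in> M" unfolding W_def using x M_scalar by (intro star_word_in_M M_diff)
    have V: "star_word x u \<in> M" for u using x by (rule star_word_in_M)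
    have "star_word (x - scalar_op z) (b # w) = (xb - scalar_op c) o\<^sub>L W"
      by (simp add: star_word_def op_prod_def W_def xb_def c_def adj_diff_scalar[OF x])
    moreover have "star_word x (v @ [b]) = star_word x v o\<^sub>L xb"
      by (simp add: star_word_append) (simp add: star_word_def op_prod_def xb_def op_compose_distribs)
    moreover have "star_word x v o\<^sub>L (scalar_op c o\<^sub>L W) = scalar_op c o\<^sub>L (star_word x v o\<^sub>L W)"
      using M_clinear[OF V[of v]] by (auto intro!: blinfun_eqI simp: clinear_op_def)
    ultimately have "star_word x v o\<^sub>L star_word (x - scalar_op z) (b # w)
        = (star_word x (v @ [b]) o\<^sub>L W) - (scalar_op c o\<^sub>L (star_word x v o\<^sub>L W))"
      by (simp add: op_compose_distribs op_compose_assoc)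
    then show ?thesis
      using V W by (simp add: W_def[symmetric] trace_diff trace_scalar M_compose M_scalar)
  qed
  show ?case
    unfolding step[OF a(1)] step[OF a(2)] by (intro tendsto_intros Cons)
qed

lemma op_abs_moments_tendsto:
  assumes "\<And>n. a_seq n \<in> M" "a \<in> M" "converges_in_star_moments \<tau> a_seq a"
  shows "(\<lambda>n. \<integral>t. t ^ (2 * k) \<partial>spectral_distribution \<tau> (op_abs (a_seq n - scalar_op z)))
    \<longlonglongrightarrow> (\<integral>t. t ^ (2 * k) \<partial>spectral_distribution \<tau> (op_abs (a - scalar_op z)))"
proof -
  have eq: "(\<integral>t. t ^ (2 * k) \<partial>spectral_distribution \<tau> (op_abs x))
      = Re (\<tau> (star_word x (concat (replicate k [True, False]))))" if "x \<in> M" for x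
    using op_abs_distribution(2)[OF that, of "norm x + 1"] by (simp add: add_nonneg_pos)
  have x: "x \<in> M \<Longrightarrow> x - scalar_op z \<in> M" for x by (intro M_diff M_scalar)
  have "star_word x [] = id_blinfun" for x :: "'h oper" by (simp add: star_word_def op_prod_def)
  then have "(\<lambda>n. \<tau> (star_word (a_seq n - scalar_op z) w)) \<longlonglongrightarrow> \<tau> (star_word (a - scalar_op z) w)" for w
    using star_moments_shift[OF assms, of "[]" z w] by (simp add: op_compose_id_left)
  then show ?thesis
    unfolding eq[OF x[OF assms(1)]] eq[OF x[OF assms(2)]] by (intro tendsto_Re)
qed

end

section \<open>Symmetrization\<close>

context
  fixes \<nu> :: "real measure" and K :: real
  assumes \<nu>: "bounded_prob K \<nu>"
begin

text \<open>The symmetrization is realized as the law of a fair random sign times a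
  \<nu>-distributed variable, so that integrals against it follow from product measures.\<close>

definition coin_sign :: "bool \<times> real \<Rightarrow> real" where
  "coin_sign x = (if fst x then snd x else - snd x)"

definition coin_measure :: "real measure" where
  "coin_measure = distr (measure_pmf (bernoulli_pmf (1/2)) \<Otimes>\<^sub>M \<nu>) borel coin_sign"

lemma sets_\<nu> [measurable_cong]: "sets \<nu> = sets borel" and prob_\<nu>: "prob_space \<nu>"
  using \<nu> by (simp_all add: bounded_prob_def)

lemma measurable_coin_sign [measurable]:
  "coin_sign \<in> borel_measurable (measure_pmf (bernoulli_pmf (1/2)) \<Otimes>\<^sub>M \<nu>)"
  unfolding coin_sign_def by measurable

lemma nn_integral_coin_measure:
  assumes [measurable]: "f \<in> borel_measurable borel"
  shows "(\<integral>\<^sup>+t. f t \<partial>coin_measure) = ((\<integral>\<^sup>+t. f t \<partial>\<nu>) + (\<integral>\<^sup>+t. f (- t) \<partial>\<nu>)) / 2"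
proof -
  interpret \<nu>: prob_space \<nu> by (rule prob_\<nu>)
  have "(\<integral>\<^sup>+t. f t \<partial>coin_measure)
      = (\<integral>\<^sup>+b. \<integral>\<^sup>+t. f (coin_sign (b, t)) \<partial>\<nu> \<partial>measure_pmf (bernoulli_pmf (1/2)))"
    unfolding coin_measure_def
    by (subst \<nu>.nn_integral_fst) (simp_all add: nn_integral_distr)
  also have "\<dots> = (\<integral>\<^sup>+t. f t \<partial>\<nu>) * inverse 2 + (\<integral>\<^sup>+t. f (- t) \<partial>\<nu>) * inverse 2"
    by (simp add: coin_sign_def)
  finally show ?thesis
    by (simp add: divide_ennreal_def distrib_right)
qed

lemma symmetrization_eq_coin_measure: "symmetrization \<nu> = coin_measure"
proof -
  have "emeasure coin_measure B = (emeasure \<nu> B + emeasure \<nu> (uminus ` B)) / 2"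
    if B: "B \<in> sets borel" for B
  proof -
    have eq: "uminus ` B = uminus -` B" by (force simp: image_iff)
    have "uminus -` B \<inter> space borel \<in> sets borel" using B by (intro measurable_sets) auto
    then have B': "uminus ` B \<in> sets borel" by (simp add: eq)
    have "emeasure coin_measure B = (\<integral>\<^sup>+t. indicator B t \<partial>coin_measure)"
      using B by (simp add: coin_measure_def)
    also have "\<dots> = ((\<integral>\<^sup>+t. indicator B t \<partial>\<nu>) + (\<integral>\<^sup>+t. indicator B (- t) \<partial>\<nu>)) / 2"
      using B by (intro nn_integral_coin_measure) simp
    also have "(\<lambda>t. indicator B (- t) :: ennreal) = indicator (uminus ` B)"
      by (auto simp: eq indicator_def)
    finally show ?thesis using B B' by (simp add: sets_\<nu>)
  qed
  then have "symmetrization \<nu> = measure_of UNIV (sets borel) (emeasure coin_measure)"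
    unfolding symmetrization_def by (intro measure_of_eq) (auto simp: sets.sigma_sets_eq[of borel, simplified])
  also have "\<dots> = coin_measure"
    using measure_of_of_measure[of coin_measure] by (simp add: coin_measure_def)
  finally show ?thesis .
qed

lemma bounded_prob_symmetrization: "bounded_prob K (symmetrization \<nu>)"
  unfolding bounded_prob_def symmetrization_eq_coin_measure
proof (intro conjI)
  interpret pair_prob_space "measure_pmf (bernoulli_pmf (1/2))" \<nu>
    using prob_\<nu> by (simp add: pair_prob_space_def pair_sigma_finite_def prob_space_measure_pmf
        prob_space_imp_sigma_finite)
  show "prob_space coin_measure" unfolding coin_measure_def by (rule prob_space_distr) measurable
  show "AE t in coin_measure. \<bar>t\<bar> \<le> K"
  proof -
    have "AE t in \<nu>. \<bar>t\<bar> \<le> K" using \<nu> by (simp add: bounded_prob_def)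
    define f :: "real \<Rightarrow> ennreal" where "f t = (if \<bar>t\<bar> \<le> K then 0 else 1)" for t
    have [measurable]: "f \<in> borel_measurable borel" unfolding f_def by measurable
    have "AE t in \<nu>. f t = 0"
      using \<open>AE t in \<nu>. \<bar>t\<bar> \<le> K\<close> by (rule eventually_mono) (simp add: f_def)
    then have z: "(\<integral>\<^sup>+t. f t \<partial>\<nu>) = 0"
      by (subst nn_integral_0_iff_AE) auto
    have "f (- t) = f t" for t by (simp add: f_def)
    then have "(\<integral>\<^sup>+t. f t \<partial>coin_measure) = 0"
      by (subst nn_integral_coin_measure) (simp_all add: z)
    then have "AE t in coin_measure. f t = 0"
      by (subst (asm) nn_integral_0_iff_AE) (auto simp: coin_measure_def)
    then show ?thesis by (rule eventually_mono) (auto simp: f_def split: if_splits)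
  qed
qed (simp add: coin_measure_def)

lemma integral_symmetrization:
  fixes f :: "real \<Rightarrow> real"
  assumes [measurable]: "f \<in> borel_measurable borel" and B: "\<And>t. \<bar>t\<bar> \<le> K \<Longrightarrow> \<bar>f t\<bar> \<le> B"
  shows "(\<integral>t. f t \<partial>symmetrization \<nu>) = ((\<integral>t. f t \<partial>\<nu>) + (\<integral>t. f (- t) \<partial>\<nu>)) / 2"
proof -
  interpret pair_prob_space "measure_pmf (bernoulli_pmf (1/2))" \<nu>
    using prob_\<nu> by (simp add: pair_prob_space_def pair_sigma_finite_def prob_space_measure_pmf
        prob_space_imp_sigma_finite)
  have "integrable coin_measure f"
    using bounded_prob_integrable[OF bounded_prob_symmetrization assms(1) B]
    by (simp add: symmetrization_eq_coin_measure)
  then have int: "integrable (measure_pmf (bernoulli_pmf (1/2)) \<Otimes>\<^sub>M \<nu>) (\<lambda>x. f (coin_sign x))"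
    unfolding coin_measure_def by (simp add: integrable_distr_eq)
  have "(\<integral>t. f t \<partial>coin_measure)
      = (\<integral>b. \<integral>t. f (coin_sign (b, t)) \<partial>\<nu> \<partial>measure_pmf (bernoulli_pmf (1/2)))"
    unfolding coin_measure_def using integral_fst'[OF int] by (simp add: integral_distr)
  also have "\<dots> = (\<integral>t. f t \<partial>\<nu>) * (1/2) + (\<integral>t. f (- t) \<partial>\<nu>) * (1/2)"
    by (simp add: coin_sign_def)
  finally show ?thesis by (simp add: symmetrization_eq_coin_measure)
qed

lemma integral_odd_symmetrization:
  fixes f :: "real \<Rightarrow> real"
  assumes [measurable]: "f \<in> borel_measurable borel" and "\<And>t. \<bar>t\<bar> \<le> K \<Longrightarrow> \<bar>f t\<bar> \<le> B"
    and odd: "\<And>t. f (- t) = - f t"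
  shows "(\<integral>t. f t \<partial>symmetrization \<nu>) = 0"
  by (subst integral_symmetrization[OF assms(1,2)]) (simp_all add: odd)

lemma moment_symmetrization:
  "(\<integral>t. t ^ k \<partial>symmetrization \<nu>) = (if even k then \<integral>t. t ^ k \<partial>\<nu> else 0)"
proof -
  have "(\<integral>t. t ^ k \<partial>symmetrization \<nu>) = ((\<integral>t. t ^ k \<partial>\<nu>) + (\<integral>t. (- t) ^ k \<partial>\<nu>)) / 2"
    by (rule integral_symmetrization[where B = "K ^ k"]) (auto simp: power_abs intro: power_mono)
  then show ?thesis by (cases "even k") (simp_all add: power_minus_odd)
qed

end

section \<open>Free pairs of commutative operator algebras\<close>

text \<open>Padding with zero coefficients lets polynomials of different degrees be summed over a
  common range.\<close>

lemma word_poly_ev_Cons_bound: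
  assumes "degree q \<le> D"
  shows "word_poly_ev \<phi> v ((b, q) # qs) = (\<Sum>j\<le>D. coeff q j * word_poly_ev \<phi> (v @ replicate j b) qs)"
proof -
  have "(\<Sum>j\<le>degree q. coeff q j * word_poly_ev \<phi> (v @ replicate j b) qs)
      = (\<Sum>j\<le>D. coeff q j * word_poly_ev \<phi> (v @ replicate j b) qs)"
    by (rule sum.mono_neutral_left) (use assms in \<open>auto simp: coeff_eq_0\<close>)
  then show ?thesis by simp
qed

lemma word_poly_ev_head_linear:
  "word_poly_ev \<phi> v ((b, p + smult c q) # qs)
    = word_poly_ev \<phi> v ((b, p) # qs) + c * word_poly_ev \<phi> v ((b, q) # qs)"
proof -
  define D where "D = max (degree p) (degree q)"
  have D: "degree p \<le> D" "degree q \<le> D" "degree (p + smult c q) \<le> D"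
    by (auto simp: D_def intro!: degree_add_le order_trans[OF degree_smult_le])
  show ?thesis
    unfolding word_poly_ev_Cons_bound[OF D(1)] word_poly_ev_Cons_bound[OF D(2)]
      word_poly_ev_Cons_bound[OF D(3)]
    by (simp add: sum.distrib sum_distrib_left algebra_simps)
qed

lemma word_poly_ev_linear:
  "word_poly_ev \<phi> v (rs @ (b, p + smult c q) # qs)
    = word_poly_ev \<phi> v (rs @ (b, p) # qs) + c * word_poly_ev \<phi> v (rs @ (b, q) # qs)"
proof (induction rs arbitrary: v)
  case Nil
  show ?case unfolding append_Nil by (rule word_poly_ev_head_linear)
next
  case (Cons r rs)
  show ?case
    unfolding append_Cons word_poly_ev.simps(2) Cons
    by (simp add: sum.distrib sum_distrib_left algebra_simps)
qed

definition moment_functional :: "(nat \<Rightarrow> real) \<Rightarrow> real poly \<Rightarrow> real" where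
  "moment_functional s p = (\<Sum>i\<le>degree p. coeff p i * s i)"

text \<open>\<open>L b f\<close> is the action of \<open>f(X\<^bsub>b\<^esub>)\<close>, \<open>Q b\<close> projects onto the reduced words whose first
  letter is of type \<open>b\<close>, and \<open>m b f\<close> is the expectation of \<open>f(X\<^bsub>b\<^esub>)\<close>. The common
  unit \<open>P\<close> of the two algebras need not be the identity.\<close>

locale free_fock =
  fixes L :: "bool \<Rightarrow> (real \<Rightarrow> real) \<Rightarrow> 'v::real_inner \<Rightarrow> 'v" and P :: "'v \<Rightarrow> 'v"
    and Q :: "bool \<Rightarrow> 'v \<Rightarrow> 'v" and m :: "bool \<Rightarrow> (real \<Rightarrow> real) \<Rightarrow> real"
    and pts :: "bool \<Rightarrow> real set" and \<Omega> :: 'v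
  assumes L_linear: "linear (L b f)"
    and L_mult: "L b f (L b g v) = L b (\<lambda>t. f t * g t) v"
    and L_sym: "inner (L b f u) v = inner u (L b f v)"
    and L_one: "L b (\<lambda>_. 1) = P"
    and L_add: "L b (\<lambda>t. f t + g t) v = L b f v + L b g v"
    and L_scale: "L b (\<lambda>t. c * f t) v = c *\<^sub>R L b f v"
    and L_cong: "(\<And>x. x \<in> pts b \<Longrightarrow> f x = g x) \<Longrightarrow> L b f = L b g"
    and Q_linear: "linear (Q b)"
    and Q_idem: "Q b (Q b v) = Q b v"
    and Q_sym: "inner (Q b u) v = inner u (Q b v)"
    and Q_orth: "Q b (Q (\<not> b) v) = 0"
    and compress: "Q b u = 0 \<Longrightarrow> L b f u - Q b (L b f u) = m b f *\<^sub>R P u"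
    and vacuum: "P \<Omega> = \<Omega>" "Q b \<Omega> = 0" "norm \<Omega> = 1"
begin

section \<open>Uniform and L^2 norm estimates for the two actions\<close>

abbreviation X :: "bool \<Rightarrow> 'v \<Rightarrow> 'v" where "X b \<equiv> L b (\<lambda>t. t)"

lemma P_linear: "linear P" using L_linear[of True "\<lambda>_. 1"] by (simp add: L_one)

lemma L_P: "L b f (P v) = L b f v" and P_L: "P (L b f v) = L b f v"
  using L_mult[of b f "\<lambda>_. 1" v] L_mult[of b "\<lambda>_. 1" f v] by (simp_all add: L_one)

lemma P_P: "P (P v) = P v"
  using L_P[of True "\<lambda>_. 1" v] by (simp add: L_one)

lemma P_sym: "inner (P u) v = inner u (P v)"
  using L_sym[of True "\<lambda>_. 1" u v] by (simp add: L_one)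

lemma norm_projection_le:
  assumes "\<And>u v. inner (E u) v = inner u (E v)" "\<And>v. E (E v) = E v"
  shows "norm (E v) \<le> norm v"
proof -
  have "(norm (E v))\<^sup>2 = inner v (E v)"
    using assms by (metis power2_norm_eq_inner)
  also have "\<dots> \<le> norm v * norm (E v)" by (rule norm_cauchy_schwarz)
  finally show ?thesis
    by (cases "norm (E v) = 0") (auto simp: power2_eq_square mult_le_cancel_right)
qed

lemma norm_Q: "norm (Q b v) \<le> norm v"
  by (rule norm_projection_le) (rule Q_sym, rule Q_idem)

lemma norm_P: "norm (P v) \<le> norm v"
  by (rule norm_projection_le) (rule P_sym, rule P_P)

lemma norm_Q_compl: "norm (v - Q b v) \<le> norm v"
  by (rule norm_projection_le)
     (simp_all add: inner_diff_left inner_diff_right Q_sym linear_diff[OF Q_linear] Q_idem)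

lemma L_const_diff: "L b (\<lambda>t. c - f t) v = c *\<^sub>R P v - L b f v"
proof -
  have "L b (\<lambda>t. c - f t) v = L b (\<lambda>t. c * 1 + (-1) * f t) v" by simp
  also have "\<dots> = c *\<^sub>R P v - L b f v"
    by (subst L_add, subst L_scale, subst L_scale) (simp add: L_one)
  finally show ?thesis .
qed

text \<open>With \<open>g = sqrt (K\<^sup>2 - f\<^sup>2)\<close> one has \<open>\<parallel>f v\<parallel>\<^sup>2 + \<parallel>g v\<parallel>\<^sup>2 = K\<^sup>2 \<parallel>P v\<parallel>\<^sup>2\<close>.\<close>

lemma norm_L:
  assumes "\<And>x. x \<in> pts b \<Longrightarrow> \<bar>f x\<bar> \<le> K" "0 \<le> K"
  shows "norm (L b f v) \<le> K * norm v"
proof -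
  define g where "g t = sqrt (K\<^sup>2 - (f t)\<^sup>2)" for t
  have sq: "(norm (L b h v))\<^sup>2 = inner v (L b (\<lambda>t. h t * h t) v)" for h
    by (simp add: power2_norm_eq_inner L_sym L_mult)
  have "L b (\<lambda>t. g t * g t) = L b (\<lambda>t. K\<^sup>2 - f t * f t)"
  proof (rule L_cong)
    fix x assume "x \<in> pts b"
    then have "(f x)\<^sup>2 \<le> K\<^sup>2" using assms by (metis abs_le_square_iff abs_of_nonneg)
    then show "g x * g x = K\<^sup>2 - f x * f x" by (simp add: g_def power2_eq_square)
  qed
  then have "(norm (L b f v))\<^sup>2 + (norm (L b g v))\<^sup>2 = K\<^sup>2 * inner v (P v)"
    unfolding sq by (simp add: L_const_diff inner_diff_right)
  also have "inner v (P v) = (norm (P v))\<^sup>2"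
    by (metis P_P P_sym power2_norm_eq_inner)
  finally have "(norm (L b f v))\<^sup>2 \<le> (K * norm (P v))\<^sup>2"
    using zero_le_power2[of "norm (L b g v)"] unfolding power_mult_distrib by linarith
  then have "norm (L b f v) \<le> K * norm (P v)"
    using assms(2) by (rule_tac power2_le_imp_le) auto
  also have "\<dots> \<le> K * norm v" using norm_P assms(2) by (rule mult_left_mono)
  finally show ?thesis .
qed

lemma vacuum_expectation: "inner \<Omega> (L b f \<Omega>) = m b f"
proof -
  have "inner \<Omega> (L b f \<Omega>) = inner \<Omega> (L b f \<Omega> - Q b (L b f \<Omega>))"
    by (simp add: inner_diff_right Q_sym[symmetric] vacuum)
  also have "\<dots> = m b f"
    by (simp add: compress vacuum) (simp add: vacuum power2_norm_eq_inner[symmetric])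
  finally show ?thesis .
qed

lemma m_square_nonneg: "0 \<le> m b (\<lambda>t. f t * f t)"
  by (metis L_mult L_sym inner_ge_zero vacuum_expectation)

text \<open>The squared norm of f u is the inner product of u with f^2 u, and compression replaces
  f^2 by its mean. On vectors without a leading letter of type b, f thus costs its L^2 norm instead
  of its supremum; this is where second moments enter.\<close>

lemma norm_L_Q_compl:
  assumes "Q b u = 0"
  shows "norm (L b f u) \<le> sqrt (m b (\<lambda>t. f t * f t)) * norm u"
proof -
  let ?c = "m b (\<lambda>t. f t * f t)"
  have "(norm (L b f u))\<^sup>2 = inner u (L b (\<lambda>t. f t * f t) u)"
    by (simp add: power2_norm_eq_inner L_sym L_mult)
  also have "\<dots> = inner u (L b (\<lambda>t. f t * f t) u - Q b (L b (\<lambda>t. f t * f t) u))"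
    using assms by (simp add: inner_diff_right Q_sym[symmetric])
  also have "\<dots> = ?c * inner u (P u)" by (simp add: compress assms)
  also have "\<dots> \<le> ?c * (norm u * norm u)"
    by (intro mult_left_mono m_square_nonneg order_trans[OF norm_cauchy_schwarz] norm_P) simp
  also have "\<dots> = (sqrt ?c * norm u)\<^sup>2"
    by (simp add: power_mult_distrib m_square_nonneg) (simp add: power2_eq_square)
  finally have "(norm (L b f u))\<^sup>2 \<le> (sqrt ?c * norm u)\<^sup>2" .
  then show ?thesis
    by (rule power2_le_imp_le) (simp add: m_square_nonneg)
qed

text \<open>Freeness in operator form: a centred element applied to a vector without a leading
  letter of its own type produces such a letter.\<close>

lemma L_centred_range: "m b f = 0 \<Longrightarrow> Q b u = 0 \<Longrightarrow> Q b (L b f u) = L b f u"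
  using compress[of b u f] by simp

text \<open>Annihilating a leading letter is the adjoint of creating one, so it obeys the same L^2
  bound.\<close>

lemma norm_annihilate:
  "norm (L b f (Q b r) - Q b (L b f (Q b r))) \<le> sqrt (m b (\<lambda>t. f t * f t)) * norm r"
proof -
  define w where "w = L b f (Q b r) - Q b (L b f (Q b r))"
  have Qw: "Q b w = 0" by (simp add: w_def linear_diff[OF Q_linear] Q_idem)
  have "(norm w)\<^sup>2 = inner w (L b f (Q b r))"
    by (simp add: power2_norm_eq_inner) (metis Qw Q_sym w_def inner_diff_right inner_zero_left diff_zero)
  also have "\<dots> = inner (L b f w) (Q b r)" by (rule L_sym[symmetric])
  also have "\<dots> \<le> norm (L b f w) * norm (Q b r)" by (rule norm_cauchy_schwarz)
  also have "\<dots> \<le> (sqrt (m b (\<lambda>t. f t * f t)) * norm w) * norm r"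
    by (intro mult_mono norm_L_Q_compl Qw norm_Q) (auto simp: m_square_nonneg)
  finally have "norm w * norm w \<le> (sqrt (m b (\<lambda>t. f t * f t)) * norm r) * norm w"
    by (simp add: power2_eq_square mult_ac)
  then show ?thesis
    unfolding w_def[symmetric]
    by (cases "norm w = 0") (auto simp: mult_le_cancel_right m_square_nonneg)
qed

text \<open>A product of \<open>d\<close> centred factors of alternating types is the sum of one term that
  annihilates \<open>d\<close> letters (\<open>r\<close>) and of terms ending with the creation or replacement of a letter
  of the type of the leftmost factor (\<open>z\<close>). Multiplying by one more factor preserves this shape,
  and the factors enter through their \<open>L\<^sup>2\<close> norms, with one exception in each term.\<close>

lemma haagerup_step:
  assumes "m b f = 0" and c: "sqrt (m b (\<lambda>t. f t * f t)) \<le> c"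
    and K: "\<And>x. x \<in> pts b \<Longrightarrow> \<bar>f x\<bar> \<le> K" "0 \<le> K"
    and z: "Q b z = 0"
  obtains z' r' where "L b f (z + r) = z' + r'" "Q b z' = z'"
    "norm z' \<le> c * norm z + (c + K) * norm r" "norm r' \<le> c * norm r"
proof -
  \<comment> \<open>\<open>r'\<close> loses its leading letter. \<open>z'\<close> collects the
    letter created on \<open>z\<close>, the letter created on the rest of \<open>r\<close>, and the
    letter replaced in \<open>r\<close>; only the replacement costs the supremum
    \<open>K\<close>.\<close>
  define r' where "r' = L b f (Q b r) - Q b (L b f (Q b r))"
  define z' where "z' = L b f z + L b f (r - Q b r) + Q b (L b f (Q b r))"
  have c0: "0 \<le> c" using c m_square_nonneg[of b f] by (meson order_trans real_sqrt_ge_zero)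
  have Qr: "Q b (r - Q b r) = 0" by (simp add: linear_diff[OF Q_linear] Q_idem)
  have c': "norm (L b f u) \<le> c * norm u" if "Q b u = 0" for u
    using norm_L_Q_compl[OF that, of f] mult_right_mono[OF c norm_ge_zero[of u]] by linarith
  show ?thesis
  proof (rule that)
    show "L b f (z + r) = z' + r'"
      by (simp add: z'_def r'_def linear_add[OF L_linear] linear_diff[OF L_linear])
    show "Q b z' = z'"
      by (simp add: z'_def linear_add[OF Q_linear] Q_idem L_centred_range assms(1) z Qr)
    show "norm r' \<le> c * norm r"
      using norm_annihilate[of b f r] mult_right_mono[OF c norm_ge_zero[of r]]
      by (simp add: r'_def)
    have "norm (L b f (r - Q b r)) \<le> c * norm r"
      using c'[OF Qr] mult_left_mono[OF norm_Q_compl[of r b] c0] by linarith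
    moreover have "norm (Q b (L b f (Q b r))) \<le> K * norm r"
      using norm_Q[of b "L b f (Q b r)"] norm_L[of b f K, OF K, of "Q b r"]
        mult_left_mono[OF norm_Q[of b r] K(2)] by linarith
    moreover have "norm z' \<le> norm (L b f z) + norm (L b f (r - Q b r)) + norm (Q b (L b f (Q b r)))"
      unfolding z'_def by (intro order_trans[OF norm_triangle_ineq] add_mono norm_triangle_ineq order_refl)
    ultimately show "norm z' \<le> c * norm z + (c + K) * norm r"
      using c'[OF z] by (simp add: distrib_right)
  qed
qed

text \<open>Two Haagerup steps per power give the recursion |z| -> q |z| + 4AB |r| and |r| -> q |r|,
  which solves to the stated bound. Writing q^n / q for q^(n-1) avoids a separate case n =
  0.\<close>

lemma norm_funpow_product:
  assumes m: "m True f = 0" "m False g = 0"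
    and c: "sqrt (m True (\<lambda>t. f t * f t)) \<le> c" "sqrt (m False (\<lambda>t. g t * g t)) \<le> d" "c * d \<le> q"
    and f: "\<And>x. x \<in> pts True \<Longrightarrow> \<bar>f x\<bar> \<le> A" and g: "\<And>x. x \<in> pts False \<Longrightarrow> \<bar>g x\<bar> \<le> B"
    and le: "c \<le> A" "d \<le> B" "0 < q"
  shows "norm (((\<lambda>v. L False g (L True f v)) ^^ n) v) \<le> (q ^ n + n * (4 * A * B) * q ^ n / q) * norm v"
proof -
  let ?G = "\<lambda>v. L False g (L True f v)"
  have c0: "0 \<le> c" "0 \<le> d"
    using c m_square_nonneg by (meson order_trans real_sqrt_ge_zero)+
  then have A0: "0 \<le> A" "0 \<le> B" using le by linarith+
  have "\<exists>z r. (?G ^^ n) v = z + r \<and> Q False z = z \<and> norm r \<le> q ^ n * norm v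
      \<and> norm z \<le> n * (4 * A * B) * q ^ n / q * norm v"
  proof (induction n)
    case 0
    have "Q False 0 = 0" by (rule linear_0[OF Q_linear])
    then show ?case by (intro exI[of _ 0] exI[of _ v]) simp
  next
    case (Suc n)
    then obtain z r where zr: "(?G ^^ n) v = z + r" "Q False z = z"
      and r: "norm r \<le> q ^ n * norm v" and z: "norm z \<le> n * (4 * A * B) * q ^ n / q * norm v" by blast
    have "Q True z = 0" using Q_orth[of True z] zr(2) by simp
    then obtain z1 r1 where 1: "L True f (z + r) = z1 + r1" "Q True z1 = z1"
      "norm z1 \<le> c * norm z + (c + A) * norm r" "norm r1 \<le> c * norm r"
      using haagerup_step[OF m(1) c(1) f A0(1)] by metis
    have "Q False z1 = 0" using Q_orth[of False z1] 1(2) by simp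
    then obtain z2 r2 where 2: "L False g (z1 + r1) = z2 + r2" "Q False z2 = z2"
      "norm z2 \<le> d * norm z1 + (d + B) * norm r1" "norm r2 \<le> d * norm r1"
      using haagerup_step[OF m(2) c(2) g A0(2)] by metis
    have "norm r2 \<le> d * (c * norm r)"
      using 2(4) mult_left_mono[OF 1(4) c0(2)] by linarith
    also have "\<dots> = (c * d) * norm r" by (simp add: mult_ac)
    also have "\<dots> \<le> q * (q ^ n * norm v)" using c(3) r le(3) c0 by (intro mult_mono) auto
    finally have r2: "norm r2 \<le> q ^ Suc n * norm v" by (simp add: mult_ac)
    have "norm z2 \<le> d * (c * norm z + (c + A) * norm r) + (d + B) * (c * norm r)"
      using 2(3) mult_left_mono[OF 1(3) c0(2)] mult_left_mono[OF 1(4), of "d + B"] c0 A0 by linarith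
    also have "\<dots> = (c * d) * norm z + (d * (c + A) + (d + B) * c) * norm r"
      by (simp add: algebra_simps)
    also have "\<dots> \<le> q * norm z + (4 * A * B) * norm r"
    proof (intro add_mono mult_right_mono c(3))
      \<comment> \<open>Each L^2 bound is at most the corresponding supremum bound, whence the
        constant 4AB.\<close>
      have "d * (c + A) + (d + B) * c \<le> B * (A + A) + (B + B) * A"
        using c0 A0 le by (intro add_mono mult_mono) auto
      then show "d * (c + A) + (d + B) * c \<le> 4 * A * B" by (simp add: algebra_simps)
    qed auto
    also have "\<dots> \<le> q * (n * (4 * A * B) * q ^ n / q * norm v) + (4 * A * B) * (q ^ n * norm v)"
      using z r le(3) A0 by (intro add_mono mult_left_mono) auto
    also have "\<dots> = Suc n * (4 * A * B) * q ^ Suc n / q * norm v"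
      using le(3) by (simp add: field_simps)
    finally have "norm z2 \<le> Suc n * (4 * A * B) * q ^ Suc n / q * norm v" .
    moreover have "(?G ^^ Suc n) v = z2 + r2" using zr(1) 1(1) 2(1) by simp
    ultimately show ?case using 2(2) r2 by blast
  qed
  then obtain z r where "(?G ^^ n) v = z + r" "norm r \<le> q ^ n * norm v"
    "norm z \<le> n * (4 * A * B) * q ^ n / q * norm v" by blast
  then show ?thesis using norm_triangle_ineq[of z r] by (simp add: distrib_right)
qed

section \<open>The sum of the two variables and its lower bound\<close>

definition S :: "'v \<Rightarrow> 'v" where "S v = X True v + X False v"

lemma S_linear: "linear S"
  unfolding S_def by (intro linear_compose_add L_linear)

lemma S_sym: "inner (S u) v = inner u (S v)"
  by (simp add: S_def inner_add_left inner_add_right L_sym)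

lemma P_S: "P (S v) = S v"
  by (simp add: S_def linear_add[OF P_linear] P_L)

lemma norm_S:
  assumes "\<And>b x. x \<in> pts b \<Longrightarrow> \<bar>x\<bar> \<le> R" "0 \<le> R"
  shows "norm (S v) \<le> 2 * R * norm v"
proof -
  have "norm (X b v) \<le> R * norm v" for b
    by (rule norm_L) (use assms in auto)
  from this[of True] this[of False] show ?thesis
    using norm_triangle_ineq[of "X True v" "X False v"] by (simp add: S_def)
qed

text \<open>On the range of \<open>P\<close> one has \<open>X + Y = (1 + Y X\<^sup>-\<^sup>1) X\<close>, and if \<open>\<parallel>G\<^sup>N\<parallel> \<le> 1/2\<close> then
  \<open>1 - (-G)\<^sup>N = (\<Sum>k<N. (-G)\<^sup>k) (1 + G)\<close> bounds \<open>1 + G\<close> from below.\<close>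

lemma S_bounded_below:
  assumes m: "m True inverse = 0" "m False (\<lambda>t. t) = 0"
    and c: "sqrt (m True (\<lambda>t. inverse t * inverse t)) \<le> c" "sqrt (m False (\<lambda>t. t * t)) \<le> d" "c * d \<le> q"
    and gap: "\<And>x. x \<in> pts True \<Longrightarrow> \<eta> \<le> \<bar>x\<bar>" and R: "\<And>x. x \<in> pts False \<Longrightarrow> \<bar>x\<bar> \<le> R"
    and le: "c \<le> 1 / \<eta>" "d \<le> R" "0 < q" "0 < \<eta>"
    and N: "q ^ N + N * (4 * (1/\<eta>) * R) * q ^ N / q \<le> 1/2"
    and v: "P v = v"
  shows "\<eta> / (2 * (1 + (\<Sum>k<N. (R / \<eta>) ^ k))) * norm v \<le> norm (S v)"
proof -
  define u where "u = X True v"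
  define G where "G w = X False (L True inverse w)" for w
  define G' where "G' w = - G w" for w
  have d0: "0 \<le> d" using c m_square_nonneg by (meson order_trans real_sqrt_ge_zero)
  have R0: "0 \<le> R" using d0 le by linarith
  have inv: "\<bar>inverse x\<bar> \<le> 1 / \<eta>" if "x \<in> pts True" for x
  proof -
    have "inverse \<bar>x\<bar> \<le> inverse \<eta>" using gap[OF that] le(4) by (rule le_imp_inverse_le)
    then show ?thesis by (simp add: abs_inverse inverse_eq_divide)
  qed
  \<comment> \<open>Only values on the spectrum matter, and 0 is not in it; so the action of
    \<open>inverse\<close> inverts that of X on the range of \<open>P\<close>.\<close>
  have "L True (\<lambda>t. inverse t * t) = L True (\<lambda>_. 1)"
    using gap le(4) by (intro L_cong) force
  then have v_eq: "v = L True inverse u"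
    using v by (simp add: u_def L_mult L_one)
  have Su: "S v = u + G u"
    using v_eq by (simp add: S_def u_def G_def)
  have G_lin: "linear G"
    unfolding G_def using linear_compose[OF L_linear L_linear] by (simp add: o_def)
  then have G'_lin: "linear G'" unfolding G'_def by (rule linear_compose_neg)
  have GN: "norm ((G ^^ N) w) \<le> 1/2 * norm w" for w
  proof -
    have "norm ((G ^^ N) w) \<le> (q ^ N + N * (4 * (1/\<eta>) * R) * q ^ N / q) * norm w"
      unfolding G_def by (rule norm_funpow_product[OF m c inv R le(1-3)])
    also have "\<dots> \<le> 1/2 * norm w" using N by (rule mult_right_mono) simp
    finally show ?thesis .
  qed
  have nG': "norm (G' w) \<le> (R / \<eta>) * norm w" for w
  proof -
    have "norm (G' w) \<le> R * norm (L True inverse w)"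
      unfolding G'_def G_def norm_minus_cancel by (rule norm_L[OF R R0])
    also have "\<dots> \<le> R * ((1 / \<eta>) * norm w)"
      using le(4) by (intro mult_left_mono norm_L inv R0) auto
    finally show ?thesis by simp
  qed
  have G'_pow: "(G' ^^ k) w = (if even k then (G ^^ k) w else - (G ^^ k) w)" for k w
    by (induction k) (auto simp: G'_def linear_neg[OF G_lin])
  then have norm_eq: "norm ((G' ^^ k) w) = norm ((G ^^ k) w)" for k w by simp
  have nG'k: "norm ((G' ^^ k) w) \<le> (R / \<eta>) ^ k * norm w" for k w
  proof (induction k)
    case (Suc k)
    have "norm ((G' ^^ Suc k) w) \<le> (R / \<eta>) * norm ((G' ^^ k) w)" using nG' by simp
    also have "\<dots> \<le> (R / \<eta>) * ((R / \<eta>) ^ k * norm w)"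
      using Suc R0 le(4) by (intro mult_left_mono) auto
    finally show ?case by simp
  qed simp
  have tele: "u - (G' ^^ k) u = (\<Sum>i<k. (G' ^^ i) (u + G u))" for k
  proof (induction k)
    case (Suc k)
    have lin: "linear (G' ^^ k)"
    proof (induction k)
      case (Suc k)
      then show ?case using linear_compose[OF Suc G'_lin] by (simp add: o_def)
    qed (simp add: id_def linear_id[unfolded id_def])
    have "(G' ^^ k) (u + G u) = (G' ^^ k) (u - G' u)" by (simp add: G'_def)
    also have "\<dots> = (G' ^^ k) u - (G' ^^ Suc k) u"
      by (simp add: linear_diff[OF lin] funpow_swap1)
    finally have "(G' ^^ k) (u + G u) = (G' ^^ k) u - (G' ^^ Suc k) u" .
    then show ?case unfolding sum.lessThan_Suc Suc[symmetric] by simp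
  qed simp
  define \<Sigma> where "\<Sigma> = (\<Sum>k<N. (R / \<eta>) ^ k)"
  have "norm u \<le> norm ((G' ^^ N) u) + norm (u - (G' ^^ N) u)"
    using norm_triangle_ineq[of "(G' ^^ N) u" "u - (G' ^^ N) u"] by simp
  also have "norm (u - (G' ^^ N) u) \<le> (\<Sum>k<N. (R / \<eta>) ^ k * norm (S v))"
    unfolding tele Su by (intro order_trans[OF norm_sum] sum_mono nG'k)
  also have "\<dots> = \<Sigma> * norm (S v)" by (simp add: \<Sigma>_def sum_distrib_right)
  finally have "norm u \<le> 1/2 * norm u + \<Sigma> * norm (S v)" using GN[of u] by (simp add: norm_eq)
  then have "norm u \<le> 2 * \<Sigma> * norm (S v)" by simp
  \<comment> \<open>Passing from \<Sigma> to 1 + \<Sigma> makes the denominator visibly positive,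
    without appeal to N > 0.\<close>
  also have "\<dots> \<le> 2 * (1 + \<Sigma>) * norm (S v)" by (simp add: distrib_left distrib_right)
  finally have u: "norm u \<le> 2 * (1 + \<Sigma>) * norm (S v)" .
  have \<Sigma>0: "0 \<le> \<Sigma>" unfolding \<Sigma>_def using R0 le(4) by (intro sum_nonneg) auto
  have "norm v \<le> 1 / \<eta> * norm u"
    by (subst v_eq) (rule norm_L, use inv le(4) in auto)
  then have "\<eta> * norm v \<le> norm u" using le(4) by (simp add: field_simps)
  then have "\<eta> * norm v \<le> 2 * (1 + \<Sigma>) * norm (S v)" using u by linarith
  then show ?thesis using \<Sigma>0 unfolding \<Sigma>_def[symmetric] by (simp add: field_simps)
qed

section \<open>The joint law in the vacuum state\<close>

primrec word_op :: "bool list \<Rightarrow> 'v \<Rightarrow> 'v" where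
  "word_op [] v = v"
| "word_op (b # w) v = X b (word_op w v)"

definition law :: "bool list \<Rightarrow> real" where
  "law w = inner \<Omega> (word_op w \<Omega>)"

lemma word_op_append: "word_op (v @ w) u = word_op v (word_op w u)"
  by (induction v) simp_all

lemma word_op_linear: "linear (word_op w)"
proof (induction w)
  case (Cons b w)
  then show ?case using linear_compose[OF Cons L_linear[of b "\<lambda>t. t"]] by (simp add: o_def)
qed (simp add: linear_id[unfolded id_def])

lemma word_op_replicate: "P u = u \<Longrightarrow> word_op (replicate n b) u = L b (\<lambda>t. t ^ n) u"
  by (induction n) (simp_all add: L_one L_mult)

lemma law_replicate: "law (replicate n b) = m b (\<lambda>t. t ^ n)"
  by (simp add: law_def word_op_replicate vacuum vacuum_expectation)

lemma L_sum: "L b (\<lambda>t. \<Sum>i\<le>n. c i * f i t) v = (\<Sum>i\<le>n. c i *\<^sub>R L b (f i) v)" for n :: nat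
  by (induction n) (simp_all add: L_add L_scale)

lemma sum_word_op: "(\<Sum>w | length w = n. word_op w v) = (S ^^ n) v"
proof (induction n)
  case (Suc n)
  have fin: "finite {w :: bool list. length w = n}"
    using finite_lists_length_eq[of "UNIV :: bool set" n] by simp
  have "{w :: bool list. length w = Suc n} = (#) True ` {w. length w = n} \<union> (#) False ` {w. length w = n}"
    by (auto simp: length_Suc_conv image_iff)
  then have "(\<Sum>w | length w = Suc n. word_op w v)
      = (\<Sum>w\<in>(#) True ` {w. length w = n}. word_op w v) + (\<Sum>w\<in>(#) False ` {w. length w = n}. word_op w v)"
    using fin by (simp only:) (rule sum.union_disjoint, auto)
  also have "\<dots> = (\<Sum>w | length w = n. X True (word_op w v)) + (\<Sum>w | length w = n. X False (word_op w v))"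
    by (simp add: sum.reindex)
  also have "\<dots> = S (\<Sum>w | length w = n. word_op w v)"
    by (simp add: S_def linear_sum[OF L_linear])
  finally show ?case using Suc by simp
qed simp

lemma sum_law: "(\<Sum>w | length w = n. law w) = inner \<Omega> ((S ^^ n) \<Omega>)"
  unfolding law_def sum_word_op[symmetric] by (rule inner_sum_right[symmetric])

lemma moment_functional_law:
  "moment_functional (\<lambda>n. \<Sum>w | length w = n. law w) p = inner \<Omega> (peval S p \<Omega>)"
  by (simp add: moment_functional_def sum_law peval_def inner_sum_right)

lemma inner_peval: "inner u (peval S p v) = inner (peval S p u) v"
  by (induction p arbitrary: u v)
     (simp_all add: peval_pCons[OF S_linear] inner_add_left inner_add_right S_sym[symmetric]
       peval_commute[OF S_linear])

text \<open>Symmetry of \<open>S\<close> moves one factor q to the other side. Positivity and the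
  gap inequality of the moment functional thereby become statements about the single vector q(S)
  \<Omega>.\<close>

lemma inner_peval_square: "inner \<Omega> (peval S (p * (q * q)) \<Omega>) = inner (peval S q \<Omega>) (peval S p (peval S q \<Omega>))"
proof -
  have eq: "p * (q * q) = q * (p * q)" by (simp add: mult_ac)
  show ?thesis unfolding eq peval_mult[OF S_linear] by (rule inner_peval)
qed

lemma P_peval: "P (peval S q \<Omega>) = peval S q \<Omega>"
  by (induction q)
     (simp_all add: peval_pCons[OF S_linear] linear_0[OF P_linear] linear_add[OF P_linear]
       linear_scale[OF P_linear] P_S vacuum)

section \<open>Freeness of the vacuum law\<close>

primrec poly_op :: "(bool \<times> real poly) list \<Rightarrow> 'v" where
  "poly_op [] = \<Omega>"
| "poly_op (q # qs) = L (fst q) (poly (snd q)) (poly_op qs)"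

abbreviation real_polys :: "(bool \<times> real poly) list \<Rightarrow> (bool \<times> complex poly) list" where
  "real_polys \<equiv> map (\<lambda>(b, p). (b, map_poly complex_of_real p))"

lemma P_poly_op: "P (poly_op qs) = poly_op qs"
  by (cases qs) (simp_all add: vacuum P_L)

lemma word_poly_ev_law:
  "word_poly_ev (\<lambda>w. complex_of_real (law w)) v (real_polys qs)
    = complex_of_real (inner \<Omega> (word_op v (poly_op qs)))"
proof (induction qs arbitrary: v)
  case Nil
  then show ?case by (simp add: law_def)
next
  case (Cons q qs)
  obtain b p where q: "q = (b, p)" by (cases q)
  have deg: "degree (map_poly complex_of_real p) = degree p" by (rule degree_map_poly) simp
  have coeff: "coeff (map_poly complex_of_real p) j = complex_of_real (coeff p j)" for j
    by (rule coeff_map_poly) simp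
  have "word_op v (poly_op (q # qs)) = word_op v (\<Sum>j\<le>degree p. coeff p j *\<^sub>R L b (\<lambda>t. t ^ j) (poly_op qs))"
    by (simp add: q poly_altdef[abs_def] L_sum)
  also have "\<dots> = (\<Sum>j\<le>degree p. coeff p j *\<^sub>R word_op (v @ replicate j b) (poly_op qs))"
    by (simp add: linear_sum[OF word_op_linear] linear_scale[OF word_op_linear] word_op_append
        word_op_replicate P_poly_op)
  finally have "inner \<Omega> (word_op v (poly_op (q # qs)))
      = (\<Sum>j\<le>degree p. coeff p j * inner \<Omega> (word_op (v @ replicate j b) (poly_op qs)))"
    by (simp add: inner_sum_right)
  then show ?case by (simp add: q deg coeff Cons)
qed

text \<open>By alternation each centred factor meets a vector without a leading letter of its type
  and creates one. The whole product therefore lies in the range of a \<open>Q b\<close>, which is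
  orthogonal to \<Omega>.\<close>

lemma poly_op_range:
  assumes "distinct_adj (map fst qs)" "\<forall>q\<in>set qs. m (fst q) (poly (snd q)) = 0" "qs \<noteq> []"
  shows "Q (fst (hd qs)) (poly_op qs) = poly_op qs"
  using assms
proof (induction qs)
  case (Cons q qs)
  have "Q (fst q) (poly_op qs) = 0"
  proof (cases qs)
    case Nil
    then show ?thesis by (simp add: vacuum)
  next
    case (Cons q' qs')
    then have "Q (fst q') (poly_op qs) = poly_op qs"
      using Cons.prems \<open>qs = _\<close> Cons.IH by simp
    moreover have "fst q' = (\<not> fst q)" using Cons Cons.prems by auto
    ultimately show ?thesis using Q_orth[of "fst q" "poly_op qs"] by simp
  qed
  then show ?case using Cons.prems by (simp add: L_centred_range)
qed simp

text \<open>The Fock space is real whereas freeness is tested on complex polynomials. The induction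
  splits one factor at a time into real and imaginary part and moves the real polynomials obtained
  into \<open>rs\<close>.\<close>

lemma law_free:
  fixes qs :: "(bool \<times> complex poly) list"
  defines "\<phi> \<equiv> \<lambda>w. complex_of_real (law w)"
  assumes "distinct_adj (map fst (real_polys rs @ qs))" "rs \<noteq> [] \<or> qs \<noteq> []"
    and "\<forall>q\<in>set rs. m (fst q) (poly (snd q)) = 0"
    and "\<forall>q\<in>set qs. word_poly_ev \<phi> [] [q] = 0"
  shows "word_poly_ev \<phi> [] (real_polys rs @ qs) = 0"
  using assms(2-)
proof (induction qs arbitrary: rs)
  case Nil
  have map: "map fst (real_polys rs) = map fst rs" by (induction rs) auto
  have "inner \<Omega> (poly_op rs) = inner \<Omega> (Q (fst (hd rs)) (poly_op rs))"
    using Nil(2,3) Nil(1)[unfolded append_Nil2 map] by (subst poly_op_range) simp_all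
  also have "\<dots> = 0" by (simp add: Q_sym[symmetric] vacuum)
  finally show ?case using word_poly_ev_law[of "[]" rs] by (simp add: \<phi>_def)
next
  case (Cons q qs)
  obtain b p where q: "q = (b, p)" by (cases q)
  define pr pi where "pr = map_poly Re p" and "pi = map_poly Im p"
  have p: "p = map_poly complex_of_real pr + smult \<i> (map_poly complex_of_real pi)"
    by (rule poly_eqI) (simp add: pr_def pi_def coeff_map_poly complex_eq_iff)
  have ev1: "word_poly_ev \<phi> [] [(b, map_poly complex_of_real r)] = complex_of_real (m b (poly r))" for r
    using word_poly_ev_law[of "[]" "[(b, r)]"] by (simp add: \<phi>_def vacuum_expectation)
  have "word_poly_ev \<phi> [] [(b, p)] = 0" using Cons.prems q by simp
  \<comment> \<open>The moments are real, so a centred complex polynomial has centred real and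
    imaginary parts.\<close>
  then have "complex_of_real (m b (poly pr)) + \<i> * complex_of_real (m b (poly pi)) = 0"
    by (subst (asm) p) (simp only: word_poly_ev_head_linear ev1)
  then have centred: "m b (poly pr) = 0" "m b (poly pi) = 0"
    by (simp_all add: complex_eq_iff)
  have *: "word_poly_ev \<phi> [] (real_polys rs @ (b, map_poly complex_of_real r) # qs) = 0"
    if "m b (poly r) = 0" for r
    using Cons.IH[of "rs @ [(b, r)]"] Cons.prems that q by simp
  have "word_poly_ev \<phi> [] (real_polys rs @ q # qs)
      = word_poly_ev \<phi> [] (real_polys rs @ (b, map_poly complex_of_real pr) # qs)
        + \<i> * word_poly_ev \<phi> [] (real_polys rs @ (b, map_poly complex_of_real pi) # qs)"
    unfolding q by (subst p) (rule word_poly_ev_linear)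
  then show ?case using * centred by simp
qed

end

section \<open>Finitely supported functions as an inner product space\<close>

instantiation poly_mapping :: (type, real_vector) real_vector
begin

lift_definition scaleR_poly_mapping :: "real \<Rightarrow> ('a \<Rightarrow>\<^sub>0 'b) \<Rightarrow> 'a \<Rightarrow>\<^sub>0 'b"
  is "\<lambda>r f k. r *\<^sub>R f k"
proof -
  fix r :: real and f :: "'a \<Rightarrow> 'b"
  assume "finite {k. f k \<noteq> 0}"
  then show "finite {k. r *\<^sub>R f k \<noteq> 0}" by (rule rev_finite_subset) auto
qed

instance
  by standard (transfer; simp add: fun_eq_iff scaleR_add_right scaleR_add_left)+

end

lemma lookup_scaleR [simp]: "Poly_Mapping.lookup (r *\<^sub>R f) k = r *\<^sub>R Poly_Mapping.lookup f k"
  by (simp add: scaleR_poly_mapping.rep_eq)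

text \<open>For real values this is the algebraic span of an orthonormal basis indexed by the keys.
  It is a pre-Hilbert space, which suffices since no limits of vectors are taken.\<close>

instantiation poly_mapping :: (type, real_inner) real_inner
begin

definition inner_poly_mapping :: "('a \<Rightarrow>\<^sub>0 'b) \<Rightarrow> ('a \<Rightarrow>\<^sub>0 'b) \<Rightarrow> real" where
  "inner_poly_mapping f g = (\<Sum>k\<in>Poly_Mapping.keys f. inner (Poly_Mapping.lookup f k) (Poly_Mapping.lookup g k))"

definition norm_poly_mapping :: "('a \<Rightarrow>\<^sub>0 'b) \<Rightarrow> real" where
  "norm_poly_mapping f = sqrt (inner f f)"

definition dist_poly_mapping :: "('a \<Rightarrow>\<^sub>0 'b) \<Rightarrow> ('a \<Rightarrow>\<^sub>0 'b) \<Rightarrow> real" where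
  "dist_poly_mapping f g = norm (f - g)"

definition sgn_poly_mapping :: "('a \<Rightarrow>\<^sub>0 'b) \<Rightarrow> 'a \<Rightarrow>\<^sub>0 'b" where
  "sgn_poly_mapping f = inverse (norm f) *\<^sub>R f"

definition uniformity_poly_mapping :: "(('a \<Rightarrow>\<^sub>0 'b) \<times> ('a \<Rightarrow>\<^sub>0 'b)) filter" where
  "uniformity_poly_mapping = (INF e\<in>{0<..}. principal {(f, g). dist f g < e})"

definition open_poly_mapping :: "('a \<Rightarrow>\<^sub>0 'b) set \<Rightarrow> bool" where
  "open_poly_mapping U \<longleftrightarrow> (\<forall>f\<in>U. eventually (\<lambda>(f', g). f' = f \<longrightarrow> g \<in> U) uniformity)"

lemma inner_poly_mapping_superset:
  fixes f g :: "'a \<Rightarrow>\<^sub>0 'b"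
  assumes "finite A" "Poly_Mapping.keys f \<subseteq> A"
  shows "inner f g = (\<Sum>k\<in>A. inner (Poly_Mapping.lookup f k) (Poly_Mapping.lookup g k))"
  unfolding inner_poly_mapping_def
  by (rule sum.mono_neutral_left) (use assms in \<open>auto simp: in_keys_iff\<close>)

instance
proof
  fix f g h :: "'a \<Rightarrow>\<^sub>0 'b" and r :: real
  define A where "A = Poly_Mapping.keys f \<union> Poly_Mapping.keys g \<union> Poly_Mapping.keys (f + g) \<union> Poly_Mapping.keys (r *\<^sub>R f)"
  have A: "finite A" "Poly_Mapping.keys f \<subseteq> A" "Poly_Mapping.keys g \<subseteq> A" "Poly_Mapping.keys (f + g) \<subseteq> A" "Poly_Mapping.keys (r *\<^sub>R f) \<subseteq> A"
    by (auto simp: A_def)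
  show "inner f g = inner g f"
    by (simp add: inner_poly_mapping_superset[OF A(1)] A inner_commute)
  show "inner (f + g) h = inner f h + inner g h"
    by (simp add: inner_poly_mapping_superset[OF A(1)] A lookup_add inner_add_left sum.distrib)
  show "inner (r *\<^sub>R f) g = r * inner f g"
    by (simp add: inner_poly_mapping_superset[OF A(1)] A sum_distrib_left)
  show "0 \<le> inner f f"
    by (simp add: inner_poly_mapping_def sum_nonneg)
  show "(inner f f = 0) = (f = 0)"
  proof
    assume "inner f f = 0"
    then have "\<forall>k\<in>Poly_Mapping.keys f. inner (Poly_Mapping.lookup f k) (Poly_Mapping.lookup f k) = 0"
      unfolding inner_poly_mapping_def by (subst (asm) sum_nonneg_eq_0_iff) auto
    then show "f = 0" by (auto intro!: poly_mapping_eqI simp: in_keys_iff)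
  qed (simp add: inner_poly_mapping_def)
qed (simp_all add: norm_poly_mapping_def dist_poly_mapping_def sgn_poly_mapping_def
    uniformity_poly_mapping_def open_poly_mapping_def)

end

abbreviation unit_vec :: "'a \<Rightarrow> 'a \<Rightarrow>\<^sub>0 real" where "unit_vec k \<equiv> Poly_Mapping.single k 1"

lemma inner_unit_vec: "inner f (unit_vec k) = Poly_Mapping.lookup f k" for f :: "'a \<Rightarrow>\<^sub>0 real"
proof -
  have "inner f (unit_vec k) = inner (unit_vec k) f" by (rule inner_commute)
  also have "\<dots> = Poly_Mapping.lookup f k" by (simp add: inner_poly_mapping_def)
  finally show ?thesis .
qed

lemma linear_eq_unit_vecI:
  fixes F G :: "('a \<Rightarrow>\<^sub>0 real) \<Rightarrow> 'v::real_vector"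
  assumes "linear F" "linear G" "\<And>k. F (unit_vec k) = G (unit_vec k)"
  shows "F v = G v"
proof -
  have "v = (\<Sum>k\<in>Poly_Mapping.keys v. Poly_Mapping.lookup v k *\<^sub>R unit_vec k)"
    by (rule poly_mapping_eqI)
       (simp add: lookup_sum lookup_single when_def if_distrib in_keys_iff cong: if_cong)
  moreover have "F (\<Sum>k\<in>K. c k *\<^sub>R unit_vec k) = G (\<Sum>k\<in>K. c k *\<^sub>R unit_vec k)" for K c
    by (simp add: linear_sum[OF assms(1)] linear_sum[OF assms(2)] linear_scale[OF assms(1)]
        linear_scale[OF assms(2)] assms(3))
  ultimately show ?thesis by metis
qed

definition linear_extension :: "('a \<Rightarrow> 'v) \<Rightarrow> ('a \<Rightarrow>\<^sub>0 real) \<Rightarrow> 'v::real_vector" where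
  "linear_extension g f = (\<Sum>k\<in>Poly_Mapping.keys f. Poly_Mapping.lookup f k *\<^sub>R g k)"

lemma linear_extension_superset:
  assumes "finite A" "Poly_Mapping.keys f \<subseteq> A"
  shows "linear_extension g f = (\<Sum>k\<in>A. Poly_Mapping.lookup f k *\<^sub>R g k)"
  unfolding linear_extension_def
  by (rule sum.mono_neutral_left) (use assms in \<open>auto simp: in_keys_iff\<close>)

lemma linear_linear_extension: "linear (linear_extension g)"
proof (rule linearI)
  fix f f' :: "'a \<Rightarrow>\<^sub>0 real" and r :: real
  define A where "A = Poly_Mapping.keys f \<union> Poly_Mapping.keys f' \<union> Poly_Mapping.keys (f + f') \<union> Poly_Mapping.keys (r *\<^sub>R f)"
  have A: "finite A" "Poly_Mapping.keys f \<subseteq> A" "Poly_Mapping.keys f' \<subseteq> A" "Poly_Mapping.keys (f + f') \<subseteq> A" "Poly_Mapping.keys (r *\<^sub>R f) \<subseteq> A"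
    by (auto simp: A_def)
  show "linear_extension g (f + f') = linear_extension g f + linear_extension g f'"
    by (simp add: linear_extension_superset[OF A(1)] A lookup_add scaleR_add_left sum.distrib)
  show "linear_extension g (r *\<^sub>R f) = r *\<^sub>R linear_extension g f"
    by (simp add: linear_extension_superset[OF A(1)] A scaleR_sum_right)
qed

lemma linear_extension_unit [simp]: "linear_extension g (unit_vec k) = g k"
  by (simp add: linear_extension_def)

section \<open>Matrices of multiplication operators\<close>

text \<open>The Householder reflection exchanging \<open>e\<^sub>0\<close> and \<open>(sqrt (w k))\<^sub>k\<close> turns multiplication
  operators on \<open>L\<^sup>2\<close> of the measure with weights \<open>w\<close> into matrices whose vacuum vector, the constant
  function \<open>1\<close>, is \<open>e\<^sub>0\<close>.\<close>

lemma householder_exists: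
  fixes w :: "nat \<Rightarrow> real"
  assumes N: "0 < N" and w: "\<And>k. k < N \<Longrightarrow> 0 \<le> w k" "(\<Sum>k<N. w k) = 1"
  obtains H :: "nat \<Rightarrow> nat \<Rightarrow> real"
  where "\<And>k l. k < N \<Longrightarrow> l < N \<Longrightarrow> (\<Sum>i<N. H k i * H l i) = of_bool (k = l)"
    "\<And>k l. H k l = H l k" "\<And>k. k < N \<Longrightarrow> H k 0 = sqrt (w k)"
proof -
  define u where "u k = sqrt (w k) - of_bool (k = 0)" for k
  define s where "s = (\<Sum>k<N. u k * u k)"
  \<comment> \<open>If u vanishes, the two vectors to be exchanged already agree and the reflection
    degenerates to the identity.\<close>
  define c where "c = (if s = 0 then 0 else 2 / s)"
  define H where "H k i = of_bool (k = i) - c * u k * u i" for k i :: nat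
  have delta: "(\<Sum>k<N. of_bool (k = l) * g k) = g l" if "l < N" for l and g :: "nat \<Rightarrow> real"
    using that by (simp add: of_bool_def if_distrib[of "\<lambda>x. x * _"] cong: if_cong)
  have "s = (\<Sum>k<N. w k - 2 * (of_bool (k = 0) * sqrt (w k)) + of_bool (k = 0) * 1)"
    unfolding s_def by (rule sum.cong) (auto simp: u_def algebra_simps w)
  also have "\<dots> = 2 - 2 * sqrt (w 0)"
    using N w(2) delta[of 0] by (simp add: sum.distrib sum_subtractf sum_distrib_left[symmetric])
  finally have s: "s = - 2 * u 0" by (simp add: u_def)
  have u0: "u k = 0" if "s = 0" "k < N" for k
  proof -
    have "\<forall>k\<in>{..<N}. u k * u k = 0"
      using that(1) unfolding s_def by (subst (asm) sum_nonneg_eq_0_iff) auto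
    then show ?thesis using that by simp
  qed
  have cs: "c * c * s = 2 * c" by (simp add: c_def)
  have "(\<Sum>i<N. H k i * H l i) = of_bool (k = l)" if kl: "k < N" "l < N" for k l
  proof -
    have "(\<Sum>i<N. H k i * H l i)
        = (\<Sum>i<N. of_bool (i = k) * of_bool (l = i) - of_bool (i = k) * (c * u l * u i)
            - of_bool (i = l) * (c * u k * u i) + c * c * u k * u l * (u i * u i))"
      by (rule sum.cong) (auto simp: H_def algebra_simps)
    also have "\<dots> = of_bool (l = k) - c * u l * u k - c * u k * u l + c * c * u k * u l * s"
      unfolding sum.distrib sum_subtractf s_def delta[OF kl(1)] delta[OF kl(2)] sum_distrib_left ..
    also have "c * c * u k * u l * s = (c * c * s) * u k * u l" by (simp add: mult_ac)
    finally show ?thesis unfolding cs by (simp add: mult_ac eq_commute[of l k])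
  qed
  moreover have "H k 0 = sqrt (w k)" if "k < N" for k
  proof (cases "s = 0")
    case True
    then show ?thesis using u0[OF True that] by (simp add: H_def c_def u_def)
  next
    case False
    then have "c * u 0 = -1" using s by (simp add: c_def)
    then have "c * u k * u 0 = - u k" by (metis mult.commute mult.left_commute mult_minus1)
    then show ?thesis by (simp add: H_def u_def)
  qed
  moreover have "H k l = H l k" for k l by (simp add: H_def)
  ultimately show ?thesis using that by blast
qed

text \<open>\<open>A f\<close> is the matrix of multiplication by f in an orthonormal basis of L^2
  whose vector number 0 is the constant function 1; its entry at (0, 0) is therefore the
  expectation. The conjuncts are what the Fock space uses of it.\<close>

definition multiplication_matrices ::
    "nat \<Rightarrow> (nat \<Rightarrow> real) \<Rightarrow> (nat \<Rightarrow> real) \<Rightarrow> ((real \<Rightarrow> real) \<Rightarrow> nat \<Rightarrow> nat \<Rightarrow> real) \<Rightarrow> bool" where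
  "multiplication_matrices N w x A \<longleftrightarrow>
     (\<forall>f i j. A f i j = A f j i) \<and>
     (\<forall>f g i l. i < N \<longrightarrow> l < N \<longrightarrow> (\<Sum>j<N. A f i j * A g j l) = A (\<lambda>t. f t * g t) i l) \<and>
     (\<forall>i j. i < N \<longrightarrow> j < N \<longrightarrow> A (\<lambda>_. 1) i j = of_bool (i = j)) \<and>
     (\<forall>f. A f 0 0 = (\<Sum>k<N. w k * f (x k))) \<and>
     (\<forall>f g i j. A (\<lambda>t. f t + g t) i j = A f i j + A g i j) \<and>
     (\<forall>c f i j. A (\<lambda>t. c * f t) i j = c * A f i j) \<and>
     (\<forall>f g i j. (\<forall>k<N. f (x k) = g (x k)) \<longrightarrow> A f i j = A g i j)"

lemma multiplication_matrices_exist: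
  fixes w x :: "nat \<Rightarrow> real"
  assumes N: "0 < N" and w: "\<And>k. k < N \<Longrightarrow> 0 \<le> w k" "(\<Sum>k<N. w k) = 1"
  shows "\<exists>A. multiplication_matrices N w x A"
proof -
  obtain H :: "nat \<Rightarrow> nat \<Rightarrow> real"
    where H: "\<And>k l. k < N \<Longrightarrow> l < N \<Longrightarrow> (\<Sum>i<N. H k i * H l i) = of_bool (k = l)"
      "\<And>k l. H k l = H l k" "\<And>k. k < N \<Longrightarrow> H k 0 = sqrt (w k)"
    using householder_exists[OF assms] by blast
  define A where "A f i j = (\<Sum>k<N. H i k * f (x k) * H j k)" for f :: "real \<Rightarrow> real" and i j
  have mult: "(\<Sum>j<N. A f i j * A g j l) = A (\<lambda>t. f t * g t) i l" for f g i l
  proof -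
    have "(\<Sum>j<N. A f i j * A g j l)
        = (\<Sum>j<N. \<Sum>k<N. \<Sum>k'<N. (H i k * f (x k) * g (x k') * H l k') * (H k j * H k' j))"
      unfolding A_def sum_product by (intro sum.cong refl) (simp add: H(2) mult_ac)
    also have "\<dots> = (\<Sum>k<N. \<Sum>k'<N. (H i k * f (x k) * g (x k') * H l k') * (\<Sum>j<N. H k j * H k' j))"
      by (subst sum.swap, rule sum.cong[OF refl], subst sum.swap) (simp add: sum_distrib_left)
    also have "\<dots> = (\<Sum>k<N. \<Sum>k'<N. (H i k * f (x k) * g (x k') * H l k') * of_bool (k = k'))"
      by (intro sum.cong refl) (simp add: H(1))
    also have "\<dots> = (\<Sum>k<N. H i k * f (x k) * g (x k) * H l k)"
      by (intro sum.cong refl) (simp add: of_bool_def if_distrib[of "\<lambda>y. _ * y"] cong: if_cong)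
    finally show ?thesis by (simp add: A_def mult_ac)
  qed
  have one: "A (\<lambda>_. 1) i j = of_bool (i = j)" if "i < N" "j < N" for i j
    using H(1)[OF that] by (simp add: A_def)
  have zero: "A f 0 0 = (\<Sum>k<N. w k * f (x k))" for f
    unfolding A_def
  proof (rule sum.cong[OF refl])
    fix k assume "k \<in> {..<N}"
    then have "H 0 k = sqrt (w k)" "0 \<le> w k" using H(2)[of 0 k] H(3) w by auto
    then show "H 0 k * f (x k) * H 0 k = w k * f (x k)" by simp
  qed
  have lin: "A (\<lambda>t. f t + g t) i j = A f i j + A g i j" "A (\<lambda>t. c * f t) i j = c * A f i j"
    "A f i j = A f j i" for f g c i j
    by (simp_all add: A_def distrib_left distrib_right sum.distrib sum_distrib_left mult_ac)
  have cong: "A f i j = A g i j" if "\<And>k. k < N \<Longrightarrow> f (x k) = g (x k)" for f g i j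
    unfolding A_def using that by (intro sum.cong refl) simp
  show ?thesis
    unfolding multiplication_matrices_def
    by (intro exI[of _ A] conjI allI impI) (rule lin(3), rule mult, erule one, assumption, rule zero,
      rule lin(1), rule lin(2), rule cong, blast)
qed

section \<open>The free Fock space over two finite-dimensional spaces\<close>

text \<open>The orthonormal basis consists of the alternating words in letters \<open>(b, i)\<close> with
  \<open>1 \<le> i < N b\<close>; the index \<open>0\<close> belongs to the vacuum of the \<open>b\<close>-th algebra and is never written.
  Words that are not of this form are annihilated.\<close>

type_synonym fock_word = "(bool \<times> nat) list"

definition reduced :: "(bool \<Rightarrow> nat) \<Rightarrow> fock_word \<Rightarrow> bool" where
  "reduced N w \<longleftrightarrow> distinct_adj (map fst w) \<and> (\<forall>(b, i)\<in>set w. 0 < i \<and> i < N b)"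

definition starts :: "bool \<Rightarrow> fock_word \<Rightarrow> bool" where
  "starts b w \<longleftrightarrow> w \<noteq> [] \<and> fst (hd w) = b"

text \<open>The default 0 is the vacuum index of the b-th algebra. A reduced word then splits
  uniquely into an index below \<open>N b\<close> and a reduced word not starting with b.\<close>

definition head_index :: "bool \<Rightarrow> fock_word \<Rightarrow> nat" where
  "head_index b w = (if starts b w then snd (hd w) else 0)"

definition tail_word :: "bool \<Rightarrow> fock_word \<Rightarrow> fock_word" where
  "tail_word b w = (if starts b w then tl w else w)"

definition cons_index :: "bool \<Rightarrow> nat \<Rightarrow> fock_word \<Rightarrow> fock_word" where
  "cons_index b i w = (if i = 0 then w else (b, i) # w)"

context
  fixes N :: "bool \<Rightarrow> nat"
  assumes N: "\<And>b. 0 < N b"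
begin

lemma head_index_less: "reduced N w \<Longrightarrow> head_index b w < N b"
  using N by (cases w) (auto simp: head_index_def starts_def reduced_def)

lemma not_starts_tail_word: "reduced N w \<Longrightarrow> \<not> starts b (tail_word b w)"
  by (cases w; cases "tl w") (auto simp: tail_word_def starts_def reduced_def)

lemma reduced_tail_word: "reduced N w \<Longrightarrow> reduced N (tail_word b w)"
  by (cases w; cases "tl w") (auto simp: tail_word_def starts_def reduced_def)

lemma cons_head_tail: "reduced N w \<Longrightarrow> cons_index b (head_index b w) (tail_word b w) = w"
  by (cases w) (auto simp: cons_index_def head_index_def tail_word_def starts_def reduced_def)

lemma reduced_cons_index: "reduced N w \<Longrightarrow> \<not> starts b w \<Longrightarrow> j < N b \<Longrightarrow> reduced N (cons_index b j w)"
  by (cases w) (auto simp: cons_index_def starts_def reduced_def)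

lemma head_cons_index: "\<not> starts b w \<Longrightarrow> head_index b (cons_index b j w) = j"
  and tail_cons_index: "\<not> starts b w \<Longrightarrow> tail_word b (cons_index b j w) = w"
  by (auto simp: cons_index_def starts_def head_index_def tail_word_def)

end

locale fock_model =
  fixes N :: "bool \<Rightarrow> nat" and w x :: "bool \<Rightarrow> nat \<Rightarrow> real"
    and A :: "bool \<Rightarrow> (real \<Rightarrow> real) \<Rightarrow> nat \<Rightarrow> nat \<Rightarrow> real"
  assumes N: "\<And>b. 0 < N b"
    and A: "\<And>b. multiplication_matrices (N b) (w b) (x b) (A b)"
begin

lemmas A_facts = A[unfolded multiplication_matrices_def]
lemmas A_sym = A_facts[THEN conjunct1, rule_format]
  and A_mult = A_facts[THEN conjunct2, THEN conjunct1, rule_format]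
  and A_one = A_facts[THEN conjunct2, THEN conjunct2, THEN conjunct1, rule_format]
  and A_00 = A_facts[THEN conjunct2, THEN conjunct2, THEN conjunct2, THEN conjunct1, rule_format]
  and A_add = A_facts[THEN conjunct2, THEN conjunct2, THEN conjunct2, THEN conjunct2, THEN conjunct1, rule_format]
  and A_scale = A_facts[THEN conjunct2, THEN conjunct2, THEN conjunct2, THEN conjunct2, THEN conjunct2, THEN conjunct1, rule_format]
  and A_cong = A_facts[THEN conjunct2, THEN conjunct2, THEN conjunct2, THEN conjunct2, THEN conjunct2, THEN conjunct2, rule_format]

text \<open>For fixed b the span of the reduced words is the tensor product of the b-th one-variable
  space (head index) with the span of the reduced words not starting with b (tail), and f acts on
  the first factor by its matrix. Other words go to 0, so the unit is the projection
  \<open>P\<close> rather than the identity.\<close>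

definition L :: "bool \<Rightarrow> (real \<Rightarrow> real) \<Rightarrow> (fock_word \<Rightarrow>\<^sub>0 real) \<Rightarrow> fock_word \<Rightarrow>\<^sub>0 real" where
  "L b f = linear_extension (\<lambda>v. if reduced N v
     then \<Sum>j<N b. A b f j (head_index b v) *\<^sub>R unit_vec (cons_index b j (tail_word b v)) else 0)"

definition Q :: "bool \<Rightarrow> (fock_word \<Rightarrow>\<^sub>0 real) \<Rightarrow> fock_word \<Rightarrow>\<^sub>0 real" where
  "Q b = linear_extension (\<lambda>v. if starts b v then unit_vec v else 0)"

definition P :: "(fock_word \<Rightarrow>\<^sub>0 real) \<Rightarrow> fock_word \<Rightarrow>\<^sub>0 real" where
  "P = linear_extension (\<lambda>v. if reduced N v then unit_vec v else 0)"

definition vac :: "fock_word \<Rightarrow>\<^sub>0 real" where "vac = unit_vec []"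

lemma lin: "linear (L b f)" "linear (Q b)" "linear P"
  by (simp_all add: L_def Q_def P_def linear_linear_extension)

lemma L_unit: "L b f (unit_vec v) = (if reduced N v
    then \<Sum>j<N b. A b f j (head_index b v) *\<^sub>R unit_vec (cons_index b j (tail_word b v)) else 0)"
  and Q_unit: "Q b (unit_vec v) = (if starts b v then unit_vec v else 0)"
  and P_unit: "P (unit_vec v) = (if reduced N v then unit_vec v else 0)"
  by (simp_all add: L_def Q_def P_def)

lemmas word_facts = head_index_less[where N = N, OF N] not_starts_tail_word[where N = N, OF N]
  reduced_tail_word[where N = N, OF N] cons_head_tail[where N = N, OF N]
  reduced_cons_index[where N = N, OF N] head_cons_index[where N = N, OF N]
  tail_cons_index[where N = N, OF N]

lemma L_unit_cons:
  assumes "reduced N v" "\<not> starts b v" "i < N b"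
  shows "L b f (unit_vec (cons_index b i v)) = (\<Sum>j<N b. A b f j i *\<^sub>R unit_vec (cons_index b j v))"
  using assms by (simp add: L_unit word_facts)

text \<open>Exchanging u and v only transposes the matrix \<open>A b f\<close>, which reduces
  symmetry of the action to symmetry of the matrix.\<close>

lemma lookup_L_unit:
  "Poly_Mapping.lookup (L b f (unit_vec v)) u = (if reduced N v \<and> reduced N u \<and> tail_word b u = tail_word b v
     then A b f (head_index b u) (head_index b v) else 0)"
proof (cases "reduced N v")
  case v: True
  note t = word_facts(3)[OF v, of b] word_facts(2)[OF v, of b]
  have *: "Poly_Mapping.lookup (L b f (unit_vec v)) u
      = (\<Sum>j<N b. if cons_index b j (tail_word b v) = u then A b f j (head_index b v) else 0)"
    using v by (simp add: L_unit lookup_sum lookup_single when_def if_distrib cong: if_cong)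
  show ?thesis
  proof (cases "reduced N u \<and> tail_word b u = tail_word b v")
    case True
    then have "cons_index b j (tail_word b v) = u \<longleftrightarrow> j = head_index b u" for j
      using word_facts(4)[where w = u and b = b] word_facts(6)[OF t(2), of j] by auto
    moreover have "head_index b u < N b" using True word_facts(1) by simp
    ultimately show ?thesis using True v by (simp add: *)
  next
    case False
    then have "cons_index b j (tail_word b v) \<noteq> u" if "j < N b" for j
      using word_facts(5)[OF t that] word_facts(7)[OF t(2)] by auto
    then show ?thesis using False by (auto simp: * intro!: sum.neutral)
  qed
qed (simp add: L_unit)

sublocale free_fock L P Q "\<lambda>b f. \<Sum>k<N b. w b k * f (x b k)" "\<lambda>b. x b ` {..<N b}" vac
proof (rule free_fock.intro)
  note lin_comp = linear_compose[unfolded o_def]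
  fix b :: bool and f g :: "real \<Rightarrow> real" and u v :: "fock_word \<Rightarrow>\<^sub>0 real" and c :: real
  show "linear (L b f)" "linear (Q b)" by (rule lin)+
  show "L b f (L b g v) = L b (\<lambda>t. f t * g t) v"
  proof (rule linear_eq_unit_vecI[where F = "\<lambda>v. L b f (L b g v)" and G = "L b (\<lambda>t. f t * g t)"])
    fix k
    show "L b f (L b g (unit_vec k)) = L b (\<lambda>t. f t * g t) (unit_vec k)"
    proof (cases "reduced N k")
      case True
      let ?i = "head_index b k" and ?t = "tail_word b k"
      note t = word_facts(3)[OF True, of b] word_facts(2)[OF True, of b]
      have "L b f (L b g (unit_vec k))
          = (\<Sum>j<N b. A b g j ?i *\<^sub>R (\<Sum>l<N b. A b f l j *\<^sub>R unit_vec (cons_index b l ?t)))"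
        using True by (simp add: L_unit[of b g] linear_sum[OF lin(1)] linear_scale[OF lin(1)] L_unit_cons[OF t])
      also have "\<dots> = (\<Sum>l<N b. (\<Sum>j<N b. A b f l j * A b g j ?i) *\<^sub>R unit_vec (cons_index b l ?t))"
        by (simp add: scaleR_sum_right scaleR_sum_left mult.commute) (rule sum.swap)
      also have "\<dots> = L b (\<lambda>t. f t * g t) (unit_vec k)"
        using True word_facts(1)[OF True] by (simp add: L_unit A_mult)
      finally show ?thesis .
    qed (simp add: L_unit linear_0[OF lin(1)])
  qed (rule lin_comp[OF lin(1) lin(1)], rule lin(1))
  show "inner (L b f u) v = inner u (L b f v)"
  proof -
    have lin_inner: "linear (\<lambda>u. inner u a)" "linear (\<lambda>u. inner a u)" for a :: "fock_word \<Rightarrow>\<^sub>0 real"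
      by (rule bounded_linear.linear, rule bounded_linear_inner_left bounded_linear_inner_right)+
    have "inner (L b f (unit_vec k)) (unit_vec l) = inner (unit_vec k) (L b f (unit_vec l))" for k l
      by (simp add: inner_unit_vec inner_commute[of "unit_vec k"] lookup_L_unit A_sym)
    then have "inner (L b f (unit_vec k)) v = inner (unit_vec k) (L b f v)" for k
      by (rule linear_eq_unit_vecI[of "\<lambda>v. inner (L b f (unit_vec k)) v" "\<lambda>v. inner (unit_vec k) (L b f v)",
            OF lin_inner(2) lin_comp[OF lin(1) lin_inner(2)]])
    then show ?thesis
      by (rule linear_eq_unit_vecI[of "\<lambda>u. inner (L b f u) v" "\<lambda>u. inner u (L b f v)",
            OF lin_comp[OF lin(1) lin_inner(1)] lin_inner(1)])
  qed
  show "L b (\<lambda>_. 1) = P"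
  proof
    fix v show "L b (\<lambda>_. 1) v = P v"
    proof (rule linear_eq_unit_vecI[where F = "L b (\<lambda>_. 1)" and G = "P"])
      fix k
      have "(\<Sum>j<N b. A b (\<lambda>_. 1) j (head_index b k) *\<^sub>R unit_vec (cons_index b j (tail_word b k)))
          = unit_vec k" if k: "reduced N k"
      proof -
        have "(\<Sum>j<N b. A b (\<lambda>_. 1) j (head_index b k) *\<^sub>R unit_vec (cons_index b j (tail_word b k)))
            = (\<Sum>j<N b. if j = head_index b k then unit_vec (cons_index b j (tail_word b k)) else 0)"
          using word_facts(1)[OF k, of b] by (intro sum.cong refl) (simp add: A_one)
        then show ?thesis using word_facts(1)[OF k, of b] word_facts(4)[OF k, of b] by simp
      qed
      then show "L b (\<lambda>_. 1) (unit_vec k) = P (unit_vec k)" by (simp add: L_unit P_unit)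
    qed (rule lin)+
  qed
  show "L b (\<lambda>t. f t + g t) v = L b f v + L b g v"
    by (rule linear_eq_unit_vecI[where F = "L b (\<lambda>t. f t + g t)" and G = "\<lambda>v. L b f v + L b g v"])
       (simp_all add: lin linear_compose_add L_unit A_add scaleR_add_left sum.distrib)
  show "L b (\<lambda>t. c * f t) v = c *\<^sub>R L b f v"
    by (rule linear_eq_unit_vecI[where F = "L b (\<lambda>t. c * f t)" and G = "\<lambda>v. c *\<^sub>R L b f v"])
       (simp_all add: lin linear_compose_scale_right L_unit A_scale scaleR_sum_right)
  show "L b f = L b g" if "\<And>y. y \<in> x b ` {..<N b} \<Longrightarrow> f y = g y"
  proof -
    have "A b f = A b g" using that by (intro ext A_cong) auto
    then show ?thesis by (simp only: L_def)
  qed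
  show "Q b (Q b v) = Q b v"
    by (rule linear_eq_unit_vecI[where F = "\<lambda>v. Q b (Q b v)" and G = "Q b",
          OF lin_comp[OF lin(2) lin(2)] lin(2)])
       (simp add: Q_unit linear_0[OF lin(2)])
  show "Q b (Q (\<not> b) v) = 0"
    by (rule linear_eq_unit_vecI[where F = "\<lambda>v. Q b (Q (\<not> b) v)" and G = "\<lambda>_. 0",
          OF lin_comp[OF lin(2) lin(2)] linear_zero])
       (simp add: Q_unit linear_0[OF lin(2)] starts_def)
  show "inner (Q b u) v = inner u (Q b v)"
  proof -
    have lin_inner: "linear (\<lambda>u. inner u a)" "linear (\<lambda>u. inner a u)" for a :: "fock_word \<Rightarrow>\<^sub>0 real"
      by (rule bounded_linear.linear, rule bounded_linear_inner_left bounded_linear_inner_right)+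
    have "inner (Q b (unit_vec k)) (unit_vec l) = inner (unit_vec k) (Q b (unit_vec l))" for k l
      by (auto simp: Q_unit inner_unit_vec lookup_single when_def)
    then have "inner (Q b (unit_vec k)) v = inner (unit_vec k) (Q b v)" for k
      by (rule linear_eq_unit_vecI[of "\<lambda>v. inner (Q b (unit_vec k)) v" "\<lambda>v. inner (unit_vec k) (Q b v)",
            OF lin_inner(2) lin_comp[OF lin(2) lin_inner(2)]])
    then show ?thesis
      by (rule linear_eq_unit_vecI[of "\<lambda>u. inner (Q b u) v" "\<lambda>u. inner u (Q b v)",
            OF lin_comp[OF lin(2) lin_inner(1)] lin_inner(1)])
  qed
  show "L b f u - Q b (L b f u) = (\<Sum>k<N b. w b k * f (x b k)) *\<^sub>R P u" if "Q b u = 0"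
  proof -
    \<comment> \<open>The compression law is conditional on Q b u = 0. Precomposing with the
      projection \<open>D\<close> makes it an identity of linear maps, which can be checked on basis
      words.\<close>
    define D where "D v = v - Q b v" for v
    have D: "linear D" unfolding D_def by (intro linear_compose_sub lin linear_id[unfolded id_def])
    have "D (L b f (D v)) = A b f 0 0 *\<^sub>R P (D v)" for v
    proof (rule linear_eq_unit_vecI[where F = "\<lambda>v. D (L b f (D v))" and G = "\<lambda>v. A b f 0 0 *\<^sub>R P (D v)"])
      fix k
      show "D (L b f (D (unit_vec k))) = A b f 0 0 *\<^sub>R P (D (unit_vec k))"
      proof (cases "starts b k \<or> \<not> reduced N k")
        case True
        then show ?thesis
          by (auto simp: D_def Q_unit L_unit P_unit linear_0[OF lin(1)] linear_0[OF lin(2)] linear_0[OF lin(3)])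
      next
        case False
        then have k: "D (unit_vec k) = unit_vec k" "head_index b k = 0" "tail_word b k = k"
          by (auto simp: D_def Q_unit head_index_def tail_word_def)
        have Dj: "D (unit_vec (cons_index b j k)) = (if j = 0 then unit_vec k else 0)" for j
          using False by (auto simp: D_def Q_unit cons_index_def starts_def)
        have "D (L b f (unit_vec k)) = (\<Sum>j<N b. if j = 0 then A b f 0 0 *\<^sub>R unit_vec k else 0)"
        proof -
          have "D (L b f (unit_vec k)) = (\<Sum>j<N b. A b f j 0 *\<^sub>R D (unit_vec (cons_index b j k)))"
            using False by (simp add: L_unit k linear_sum[OF D] linear_scale[OF D])
          then show ?thesis by (simp only: Dj) (intro sum.cong refl, simp)
        qed
        then show ?thesis using False N by (simp add: k P_unit)
      qed
    qed (intro linear_compose_scale_right lin_comp[OF D lin(3)] lin_comp[OF lin_comp[OF D lin(1)] D])+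
    from this[of u] show ?thesis using that by (simp add: D_def A_00)
  qed
  show "P vac = vac" by (simp add: vac_def P_unit reduced_def)
  show "Q b vac = 0" by (simp add: vac_def Q_unit starts_def)
  show "norm vac = 1" by (simp add: vac_def norm_eq_sqrt_inner inner_unit_vec)
qed

end

section \<open>Limits of free laws\<close>

text \<open>With c equal to minus the mean this expands a centred power: one term keeps the block of
  n letters, the other deletes it.\<close>

lemma word_poly_ev_monom_shift:
  "word_poly_ev \<phi> v ((b, monom 1 n + smult c 1) # qs)
    = word_poly_ev \<phi> (v @ replicate n b) qs + c * word_poly_ev \<phi> v qs"
proof -
  have "word_poly_ev \<phi> v ((b, monom 1 n) # qs) = word_poly_ev \<phi> (v @ replicate n b) qs"
  proof -
    have "word_poly_ev \<phi> v ((b, monom 1 n) # qs)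
        = (\<Sum>j\<le>n. coeff (monom 1 n) j * word_poly_ev \<phi> (v @ replicate j b) qs)"
      by (rule word_poly_ev_Cons_bound) (rule degree_monom_le)
    also have "\<dots> = (\<Sum>j\<le>n. if j = n then word_poly_ev \<phi> (v @ replicate j b) qs else 0)"
      by (intro sum.cong) (auto simp: coeff_monom)
    finally show ?thesis by simp
  qed
  moreover have "word_poly_ev \<phi> v ((b, 1) # qs) = word_poly_ev \<phi> v qs" by simp
  ultimately show ?thesis by (simp only: word_poly_ev_head_linear)
qed

lemma word_blocks:
  "\<exists>bs. w = concat (map (\<lambda>(b, n). replicate n b) bs) \<and> distinct_adj (map fst bs) \<and> (\<forall>(b, n)\<in>set bs. 0 < n)"
  for w :: "bool list"
proof (induction w)
  case Nil
  show ?case by (rule exI[of _ "[]"]) simp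
next
  case (Cons a w)
  then obtain bs where bs: "w = concat (map (\<lambda>(b, n). replicate n b) bs)" "distinct_adj (map fst bs)"
    "\<forall>(b, n)\<in>set bs. 0 < n" by blast
  show ?case
  proof (cases "bs \<noteq> [] \<and> fst (hd bs) = a")
    case True
    then obtain n bs' where bs': "bs = (a, n) # bs'" by (cases bs) auto
    then show ?thesis using bs by (intro exI[of _ "(a, Suc n) # bs'"]) (cases bs'; auto)
  next
    case False
    then show ?thesis using bs by (intro exI[of _ "(a, 1) # bs"]) (cases bs; auto)
  qed
qed

lemma free_joint_law_unit:
  assumes "free_joint_law \<mu> \<nu> \<phi>" "prob_space \<mu>" shows "\<phi> [] = 1"
proof -
  have "\<phi> (replicate 0 True) = complex_of_real (\<integral>t. t ^ 0 \<partial>\<mu>)"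
    using assms(1) unfolding free_joint_law_def by blast
  then show ?thesis using assms(2) by (simp add: prob_space.prob_space)
qed

text \<open>Expanding the vanishing expectation of an alternating product of centred powers expresses
  \<open>\<phi> w\<close> through moments and values of \<open>\<phi>\<close> on shorter words.\<close>

lemma free_joint_law_convergent:
  assumes free: "\<And>n. free_joint_law (\<mu>s n) (\<nu>s n) (\<phi>s n)"
    and prob: "\<And>n. prob_space (\<mu>s n)"
    and mom: "\<And>k. convergent (\<lambda>n. \<integral>t. t ^ k \<partial>\<mu>s n)" "\<And>k. convergent (\<lambda>n. \<integral>t. t ^ k \<partial>\<nu>s n)"
  shows "convergent (\<lambda>n. \<phi>s n w)"
proof (induction "length w" arbitrary: w rule: less_induct)
  case less
  define c where "c n b k = complex_of_real (\<integral>t. t ^ k \<partial>(if b then \<mu>s n else \<nu>s n))" for n b k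
  define qs where "qs n = map (\<lambda>(b, k). (b, monom 1 k + smult (- c n b k) 1))" for n :: nat
  define flat where "flat = concat \<circ> map (\<lambda>(b :: bool, n). replicate n b)"
  have c: "convergent (\<lambda>n. c n b k)" for b k
    using mom[of k] unfolding c_def by (cases b) (auto simp: convergent_def intro: tendsto_of_real)
  have c': "\<phi>s n (replicate k b) = c n b k" for n b k
    using free[of n] unfolding free_joint_law_def c_def by (cases b) simp_all
  \<comment> \<open>Multiplying out the centred blocks yields \<open>v @ flat bs\<close> and
    otherwise strictly shorter words, to which the outer induction hypothesis applies.\<close>
  have expand: "convergent (\<lambda>n. word_poly_ev (\<phi>s n) v (qs n bs) - \<phi>s n (v @ flat bs))"
    if "length (v @ flat bs) \<le> length w" "\<forall>(b, n)\<in>set bs. 0 < n" for v bs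
    using that
  proof (induction bs arbitrary: v)
    case Nil
    then show ?case by (simp add: qs_def flat_def convergent_const)
  next
    case (Cons bk bs)
    obtain b k where bk: "bk = (b, k)" by (cases bk)
    have "0 < k" using Cons.prems bk by auto
    have flat: "flat (bk # bs) = replicate k b @ flat bs" by (simp add: flat_def bk)
    have 1: "convergent (\<lambda>n. word_poly_ev (\<phi>s n) (v @ replicate k b) (qs n bs) - \<phi>s n ((v @ replicate k b) @ flat bs))"
      using Cons.prems flat by (intro Cons.IH) auto
    have short: "length (v @ flat bs) < length w" using Cons.prems flat \<open>0 < k\<close> by auto
    then have "convergent (\<lambda>n. word_poly_ev (\<phi>s n) v (qs n bs) - \<phi>s n (v @ flat bs))"
      using Cons.prems by (intro Cons.IH) auto
    from convergent_add[OF this less[OF short]]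
    have 2: "convergent (\<lambda>n. word_poly_ev (\<phi>s n) v (qs n bs))" by simp
    have "word_poly_ev (\<phi>s n) v (qs n (bk # bs))
        = word_poly_ev (\<phi>s n) (v @ replicate k b) (qs n bs) - c n b k * word_poly_ev (\<phi>s n) v (qs n bs)" for n
      unfolding qs_def bk list.map prod.case word_poly_ev_monom_shift by simp
    then have "word_poly_ev (\<phi>s n) v (qs n (bk # bs)) - \<phi>s n (v @ flat (bk # bs))
        = (word_poly_ev (\<phi>s n) (v @ replicate k b) (qs n bs) - \<phi>s n ((v @ replicate k b) @ flat bs))
          - c n b k * word_poly_ev (\<phi>s n) v (qs n bs)" for n
      by (simp add: flat)
    then show ?case
      using convergent_diff[OF 1 convergent_mult[OF c[of b k] 2]] by (simp only:)
  qed
  obtain bs where bs: "w = flat bs" "distinct_adj (map fst bs)" "\<forall>(b, n)\<in>set bs. 0 < n"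
    using word_blocks[of w] by (auto simp: flat_def)
  show ?case
  proof (cases "bs = []")
    case True
    then show ?thesis using bs free_joint_law_unit[OF free prob] by (simp add: flat_def convergent_const)
  next
    case False
    have "word_poly_ev (\<phi>s n) [] (qs n bs) = 0" for n
    proof -
      have "word_poly_ev (\<phi>s n) [] [q] = 0" if q: "q \<in> set (qs n bs)" for q
      proof -
        obtain bk where bk: "q = (case bk of (b, k) \<Rightarrow> (b, monom 1 k + smult (- c n b k) 1))"
          using q unfolding qs_def set_map by blast
        obtain b k where "bk = (b, k)" by (cases bk)
        with bk have "q = (b, monom 1 k + smult (- c n b k) 1)" by (simp only: prod.case)
        then show ?thesis
          using free_joint_law_unit[OF free prob, of n] by (simp only: word_poly_ev_monom_shift) (simp add: c')
      qed
      moreover have "map fst (qs n bs) = map fst bs" by (simp add: qs_def case_prod_beta comp_def)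
      moreover have "qs n bs \<noteq> []" using False by (simp add: qs_def)
      ultimately show ?thesis
        using free[of n] bs(2) unfolding free_joint_law_def by metis
    qed
    then have "convergent (\<lambda>n. - \<phi>s n w)" using expand[of "[]" bs] bs by simp
    then show ?thesis using convergent_minus_iff[of "\<lambda>n. \<phi>s n w"] by simp
  qed
qed

text \<open>The sequence that alternates between the two laws has constant moments, so it converges;
  its even and odd subsequences then have the same limit.\<close>

lemma free_joint_law_unique:
  assumes "free_joint_law \<mu> \<nu> \<phi>" "free_joint_law \<mu> \<nu> \<psi>" "prob_space \<mu>"
  shows "\<phi> = \<psi>"
proof
  fix w
  have "convergent (\<lambda>n. (if even n then \<phi> else \<psi>) w)"
    by (rule free_joint_law_convergent[of "\<lambda>_. \<mu>" "\<lambda>_. \<nu>"]) (use assms in \<open>auto simp: convergent_const\<close>)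
  then obtain l where l: "(\<lambda>n. (if even n then \<phi> else \<psi>) w) \<longlonglongrightarrow> l" by (auto simp: convergent_def)
  have "strict_mono (\<lambda>n::nat. 2 * n)" "strict_mono (\<lambda>n::nat. Suc (2 * n))"
    by (auto simp: strict_mono_def)
  from LIMSEQ_subseq_LIMSEQ[OF l this(1)] LIMSEQ_subseq_LIMSEQ[OF l this(2)]
  show "\<phi> w = \<psi> w" by (simp add: o_def LIMSEQ_const_iff)
qed

text \<open>The constants \<open>e n q\<close> allow every polynomial to be recentred for the n-th
  law.\<close>

lemma word_poly_ev_tendsto:
  assumes \<phi>: "\<And>w. (\<lambda>n. \<phi>s n w) \<longlonglongrightarrow> \<phi> w" and e: "\<And>q. q \<in> set qs \<Longrightarrow> (\<lambda>n. e n q) \<longlonglongrightarrow> 0"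
  shows "(\<lambda>n. word_poly_ev (\<phi>s n) v (map (\<lambda>q. (fst q, snd q + smult (e n q) 1)) qs)) \<longlonglongrightarrow> word_poly_ev \<phi> v qs"
  using e
proof (induction qs arbitrary: v)
  case Nil
  then show ?case by (simp add: \<phi>)
next
  case (Cons q qs)
  let ?r = "\<lambda>n. map (\<lambda>q. (fst q, snd q + smult (e n q) 1)) qs"
  have IH: "(\<lambda>n. word_poly_ev (\<phi>s n) v (?r n)) \<longlonglongrightarrow> word_poly_ev \<phi> v qs" for v
    using Cons by simp
  have eq: "word_poly_ev (\<phi>s n) v (map (\<lambda>q. (fst q, snd q + smult (e n q) 1)) (q # qs))
      = (\<Sum>j\<le>degree (snd q). coeff (snd q) j * word_poly_ev (\<phi>s n) (v @ replicate j (fst q)) (?r n))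
        + e n q * word_poly_ev (\<phi>s n) v (?r n)" for n
    unfolding list.map word_poly_ev_head_linear by simp
  have "(\<lambda>n. (\<Sum>j\<le>degree (snd q). coeff (snd q) j * word_poly_ev (\<phi>s n) (v @ replicate j (fst q)) (?r n))
        + e n q * word_poly_ev (\<phi>s n) v (?r n))
      \<longlonglongrightarrow> (\<Sum>j\<le>degree (snd q). coeff (snd q) j * word_poly_ev \<phi> (v @ replicate j (fst q)) qs)
        + 0 * word_poly_ev \<phi> v qs"
    by (intro tendsto_intros IH Cons.prems) simp
  then show ?case unfolding eq by simp
qed

text \<open>A polynomial centred for the limit is only nearly centred for \<open>\<phi>s n\<close>.
  Subtracting its mean restores exact centring, freeness applies, and the corrections vanish in the
  limit.\<close>

lemma free_joint_law_limit:
  assumes free: "\<And>n. free_joint_law (\<mu>s n) (\<nu>s n) (\<phi>s n)" and prob: "\<And>n. prob_space (\<mu>s n)"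
    and \<phi>: "\<And>w. (\<lambda>n. \<phi>s n w) \<longlonglongrightarrow> \<phi> w"
    and mom: "\<And>k. (\<lambda>n. \<integral>t. t ^ k \<partial>\<mu>s n) \<longlonglongrightarrow> (\<integral>t. t ^ k \<partial>\<mu>)" "\<And>k. (\<lambda>n. \<integral>t. t ^ k \<partial>\<nu>s n) \<longlonglongrightarrow> (\<integral>t. t ^ k \<partial>\<nu>)"
  shows "free_joint_law \<mu> \<nu> \<phi>"
  unfolding free_joint_law_def
proof (intro conjI allI impI)
  fix k
  have "\<phi>s n (replicate k True) = complex_of_real (\<integral>t. t ^ k \<partial>\<mu>s n)"
    "\<phi>s n (replicate k False) = complex_of_real (\<integral>t. t ^ k \<partial>\<nu>s n)" for n
    using free[of n] unfolding free_joint_law_def by blast+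
  then show "\<phi> (replicate k True) = complex_of_real (\<integral>t. t ^ k \<partial>\<mu>)"
    "\<phi> (replicate k False) = complex_of_real (\<integral>t. t ^ k \<partial>\<nu>)"
    using LIMSEQ_unique[OF \<phi>[of "replicate k True"]] LIMSEQ_unique[OF \<phi>[of "replicate k False"]]
      tendsto_of_real[OF mom(1)[of k]] tendsto_of_real[OF mom(2)[of k]] by simp_all
next
  fix qs
  assume qs: "qs \<noteq> [] \<and> distinct_adj (map fst qs) \<and> (\<forall>q\<in>set qs. word_poly_ev \<phi> [] [q] = 0)"
  define e where "e n q = - word_poly_ev (\<phi>s n) [] [q]" for n q
  let ?r = "\<lambda>n. map (\<lambda>q. (fst q, snd q + smult (e n q) 1)) qs"
  have "(\<lambda>n. e n q) \<longlonglongrightarrow> 0" if "q \<in> set qs" for q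
  proof -
    have "(\<lambda>n. word_poly_ev (\<phi>s n) [] [q]) \<longlonglongrightarrow> word_poly_ev \<phi> [] [q]"
      using word_poly_ev_tendsto[of \<phi>s \<phi> "[q]" "\<lambda>_ _. 0" "[]", OF \<phi>] by simp
    then show ?thesis using that qs tendsto_minus by (fastforce simp: e_def)
  qed
  then have "(\<lambda>n. word_poly_ev (\<phi>s n) [] (?r n)) \<longlonglongrightarrow> word_poly_ev \<phi> [] qs"
    by (intro word_poly_ev_tendsto \<phi>)
  moreover have "word_poly_ev (\<phi>s n) [] (?r n) = 0" for n
  proof -
    have "word_poly_ev (\<phi>s n) [] [(fst q, snd q + smult (e n q) 1)] = 0" for q
    proof -
      have "word_poly_ev (\<phi>s n) [] [(fst q, snd q + smult (e n q) 1)]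
          = word_poly_ev (\<phi>s n) [] [q] + e n q * word_poly_ev (\<phi>s n) [] [(fst q, 1)]"
        unfolding word_poly_ev_head_linear by simp
      then show ?thesis using free_joint_law_unit[OF free prob, of n] by (simp add: e_def)
    qed
    then have "\<forall>q\<in>set (?r n). word_poly_ev (\<phi>s n) [] [q] = 0" unfolding set_map by blast
    moreover have "map fst (?r n) = map fst qs" by (simp add: comp_def)
    moreover have "?r n \<noteq> []" using qs by simp
    moreover have "rs \<noteq> [] \<and> distinct_adj (map fst rs) \<and> (\<forall>q\<in>set rs. word_poly_ev (\<phi>s n) [] [q] = 0)
        \<longrightarrow> word_poly_ev (\<phi>s n) [] rs = 0" for rs
      using free[of n] unfolding free_joint_law_def by blast
    ultimately show ?thesis using qs by presburger
  qed
  ultimately show "word_poly_ev \<phi> [] qs = 0" by (simp add: LIMSEQ_const_iff)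
qed

section \<open>Free convolution of finitely supported measures\<close>

lemma moment_functional_bound:
  assumes "degree p \<le> D" shows "moment_functional s p = (\<Sum>i\<le>D. coeff p i * s i)"
  unfolding moment_functional_def
  by (rule sum.mono_neutral_left) (use assms in \<open>auto simp: coeff_eq_0\<close>)

lemma moment_functional_add: "moment_functional s (p + q) = moment_functional s p + moment_functional s q"
proof -
  define D where "D = max (degree p) (degree q)"
  have D: "degree p \<le> D" "degree q \<le> D" "degree (p + q) \<le> D" by (auto simp: D_def degree_add_le)
  show ?thesis
    unfolding moment_functional_bound[OF D(1)] moment_functional_bound[OF D(2)] moment_functional_bound[OF D(3)]
    by (simp add: sum.distrib distrib_right)
qed

lemma moment_functional_smult: "moment_functional s (smult c p) = c * moment_functional s p"
  unfolding moment_functional_bound[OF degree_smult_le] by (simp add: moment_functional_def sum_distrib_left mult_ac)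

lemma moment_functional_monom: "moment_functional s ([:0, 1:] ^ n) = s n"
proof -
  have "[:0, 1:] ^ n = monom (1::real) n" by (simp add: monom_altdef)
  then have "moment_functional s ([:0, 1:] ^ n) = (\<Sum>i\<le>n. coeff (monom 1 n) i * s i)"
    by (simp add: moment_functional_bound[OF degree_monom_le])
  also have "\<dots> = (\<Sum>i\<le>n. if i = n then s i else 0)" by (intro sum.cong) (auto simp: coeff_monom)
  finally show ?thesis by simp
qed

lemma moment_functional_tendsto:
  "(\<And>i. (\<lambda>n. ss n i) \<longlonglongrightarrow> s i) \<Longrightarrow> (\<lambda>n. moment_functional (ss n) p) \<longlonglongrightarrow> moment_functional s p"
  unfolding moment_functional_def by (intro tendsto_intros)

text \<open>The Fock space varies with the discretization, so only the numbers \<open>l\<close> and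
  \<open>s\<close> are exported, with equations and weak inequalities that survive a limit.\<close>

lemma finite_free_law_exists:
  fixes w x :: "bool \<Rightarrow> nat \<Rightarrow> real" and R \<eta> q c d :: real and N :: "bool \<Rightarrow> nat"
  defines "m \<equiv> \<lambda>b f. \<Sum>k<N b. w b k * f (x b k)"
  assumes N: "\<And>b. 0 < N b" and w: "\<And>b k. k < N b \<Longrightarrow> 0 \<le> w b k" "\<And>b. (\<Sum>k<N b. w b k) = 1"
    and R: "\<And>b k. k < N b \<Longrightarrow> \<bar>x b k\<bar> \<le> R" and gap: "\<And>k. k < N True \<Longrightarrow> \<eta> \<le> \<bar>x True k\<bar>"
    and m: "m True inverse = 0" "m False (\<lambda>t. t) = 0"
    and c: "sqrt (m True (\<lambda>t. inverse t * inverse t)) \<le> c" "sqrt (m False (\<lambda>t. t * t)) \<le> d" "c * d \<le> q"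
    and le: "c \<le> 1 / \<eta>" "d \<le> R" "0 < q" "0 < \<eta>" "0 \<le> R"
    and M: "q ^ M + M * (4 * (1/\<eta>) * R) * q ^ M / q \<le> 1/2"
  defines "\<delta> \<equiv> \<eta> / (2 * (1 + (\<Sum>k<M. (R / \<eta>) ^ k)))"
  obtains l :: "bool list \<Rightarrow> real" and s :: "nat \<Rightarrow> real"
  where "\<And>n b. l (replicate n b) = m b (\<lambda>t. t ^ n)"
    "\<And>qs. qs \<noteq> [] \<Longrightarrow> distinct_adj (map fst qs) \<Longrightarrow>
      (\<forall>q\<in>set qs. word_poly_ev (\<lambda>w. complex_of_real (l w)) [] [q] = 0) \<Longrightarrow>
      word_poly_ev (\<lambda>w. complex_of_real (l w)) [] qs = 0"
    "\<And>n. s n = (\<Sum>w | length w = n. l w)"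
    "\<And>p. 0 \<le> moment_functional s (p * p)"
    "\<And>p. 0 \<le> moment_functional s ([:2 * R, -1:] * (p * p))"
    "\<And>p. 0 \<le> moment_functional s ([:2 * R, 1:] * (p * p))"
    "\<And>p. \<delta>\<^sup>2 * moment_functional s (p * p) \<le> moment_functional s ([:0, 1:] ^ 2 * (p * p))"
proof -
  have "\<exists>A. multiplication_matrices (N b) (w b) (x b) A" for b
    by (rule multiplication_matrices_exist) (rule N w | assumption)+
  then obtain A where A: "\<And>b. multiplication_matrices (N b) (w b) (x b) (A b)" by metis
  interpret fock_model N w x A
    by (rule fock_model.intro) (rule N A)+
  define s where "s n = (\<Sum>w | length w = n. law w)" for n
  have mf: "moment_functional s p = inner vac (peval S p vac)" for p
    unfolding s_def by (rule moment_functional_law)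
  have mf2: "moment_functional s (p * (q * q)) = inner (peval S q vac) (peval S p (peval S q vac))" for p q
    unfolding mf by (rule inner_peval_square)
  have SR: "norm (S v) \<le> 2 * R * norm v" for v
    by (rule norm_S) (use R le in auto)
  have inner_S: "\<bar>inner v (S v)\<bar> \<le> 2 * R * inner v v" for v
  proof -
    have "\<bar>inner v (S v)\<bar> \<le> norm v * norm (S v)" by (rule Cauchy_Schwarz_ineq2)
    also have "\<dots> \<le> norm v * (2 * R * norm v)" by (intro mult_left_mono SR) simp
    finally show ?thesis by (simp add: power2_norm_eq_inner[symmetric] power2_eq_square mult_ac)
  qed
  have below: "\<delta> * norm v \<le> norm (S v)" if "P v = v" for v
    unfolding \<delta>_def
    by (rule S_bounded_below[OF m[unfolded m_def] c(1,2)[unfolded m_def] c(3) _ _ le(1-4) M that])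
       (use R gap in auto)
  have \<delta>0: "0 \<le> \<delta>"
    unfolding \<delta>_def using le by (intro divide_nonneg_nonneg mult_nonneg_nonneg add_nonneg_nonneg sum_nonneg) auto
  show ?thesis
  proof (rule that[of law s])
    show "law (replicate n b) = m b (\<lambda>t. t ^ n)" for n b
      by (simp add: law_replicate m_def)
    show "word_poly_ev (\<lambda>w. complex_of_real (law w)) [] qs = 0"
      if "qs \<noteq> []" "distinct_adj (map fst qs)"
        "\<forall>q\<in>set qs. word_poly_ev (\<lambda>w. complex_of_real (law w)) [] [q] = 0" for qs
      using law_free[of "[]" qs] that by simp
    show "s n = (\<Sum>w | length w = n. law w)" for n by (rule s_def)
    show "0 \<le> moment_functional s (p * p)" for p
      using mf2[of 1 p] by (simp add: peval_1[OF S_linear])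
    show "0 \<le> moment_functional s ([:2 * R, -1:] * (p * p))" for p
      unfolding mf2 peval_linear_factor[OF S_linear] using inner_S[of "peval S p vac"]
      by (simp add: inner_diff_right)
    show "0 \<le> moment_functional s ([:2 * R, 1:] * (p * p))" for p
      unfolding mf2 peval_linear_factor[OF S_linear] using inner_S[of "peval S p vac"]
      by (simp add: inner_add_right)
    show "\<delta>\<^sup>2 * moment_functional s (p * p) \<le> moment_functional s ([:0, 1:] ^ 2 * (p * p))" for p
    proof -
      let ?v = "peval S p vac"
      have "moment_functional s ([:0, 1:] ^ 2 * (p * p)) = (norm (S ?v))\<^sup>2"
        unfolding mf2 peval_monom[OF S_linear] power2_norm_eq_inner S_sym
        by (simp add: numeral_2_eq_2)
      moreover have "moment_functional s (p * p) = (norm ?v)\<^sup>2"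
        using mf2[of 1 p] by (simp add: peval_1[OF S_linear] power2_norm_eq_inner)
      moreover have "(\<delta> * norm ?v)\<^sup>2 \<le> (norm (S ?v))\<^sup>2"
        using below[OF P_peval] \<delta>0 by (intro power_mono) auto
      ultimately show ?thesis by (simp add: power_mult_distrib)
    qed
  qed
qed

section \<open>Discretization\<close>

lemma finite_range_discretization:
  fixes g :: "real \<Rightarrow> real"
  assumes \<mu>: "prob_space \<mu>" "sets \<mu> = sets borel" and G: "AE t in \<mu>. t \<in> G" "G \<in> sets borel"
    and g: "g \<in> borel_measurable borel" "finite (g ` G)"
  shows "\<exists>(n :: nat) (w :: nat \<Rightarrow> real) x. 0 < n \<and> (\<forall>k<n. 0 \<le> w k \<and> x k \<in> g ` G) \<and> (\<Sum>k<n. w k) = 1 \<and>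
    (\<forall>f :: real \<Rightarrow> real. f \<in> borel_measurable borel \<longrightarrow> (\<Sum>k<n. w k * f (x k)) = (\<integral>t. f (g t) \<partial>\<mu>))"
proof -
  interpret prob_space \<mu> by (rule \<mu>)
  note [measurable_cong] = \<mu>(2) and [measurable] = g(1)
  define V where "V = g ` G"
  obtain x where x: "bij_betw x {0..<card V} V"
    using ex_bij_betw_nat_finite[of V] g(2) by (auto simp: V_def)
  define w where "w k = measure \<mu> (g -` {x k} \<inter> G)" for k
  have "G \<noteq> {}" using G(1) by auto
  then have "0 < card V" using g(2) by (simp add: V_def card_gt_0_iff)
  have sets: "g -` {v} \<inter> G \<in> sets \<mu>" for v
  proof -
    have "g -` {v} \<inter> space borel \<in> sets borel" by (rule measurable_sets[OF g(1)]) simp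
    then show ?thesis using G(2) \<mu>(2) by simp
  qed
  have int: "(\<Sum>k<card V. w k * f (x k)) = (\<integral>t. f (g t) \<partial>\<mu>)" if [measurable]: "f \<in> borel_measurable borel"
    for f :: "real \<Rightarrow> real"
  proof -
    have "(\<integral>t. f (g t) \<partial>\<mu>) = (\<integral>t. (\<Sum>v\<in>V. f v * indicator (g -` {v} \<inter> G) t) \<partial>\<mu>)"
    proof (rule integral_cong_AE)
      show "AE t in \<mu>. f (g t) = (\<Sum>v\<in>V. f v * indicator (g -` {v} \<inter> G) t)"
        using G(1)
      proof (rule eventually_mono)
        fix t assume t: "t \<in> G"
        have "(\<Sum>v\<in>V. f v * indicator (g -` {v} \<inter> G) t) = (\<Sum>v\<in>V. if v = g t then f v else 0)"
          by (rule sum.cong) (use t in \<open>auto simp: indicator_def\<close>)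
        also have "\<dots> = f (g t)" using t g(2) by (simp add: V_def)
        finally show "f (g t) = (\<Sum>v\<in>V. f v * indicator (g -` {v} \<inter> G) t)" ..
      qed
      have "(\<lambda>t. f (g t)) \<in> borel_measurable borel" by measurable
      then show "(\<lambda>t. f (g t)) \<in> borel_measurable \<mu>"
        by (simp add: \<mu>(2) cong: measurable_cong_sets)
      show "(\<lambda>t. \<Sum>v\<in>V. f v * indicator (g -` {v} \<inter> G) t) \<in> borel_measurable \<mu>"
        by (intro borel_measurable_sum borel_measurable_times borel_measurable_indicator sets) simp
    qed
    also have "\<dots> = (\<Sum>v\<in>V. f v * measure \<mu> (g -` {v} \<inter> G))"
      using sets by (simp add: integrable_real_mult_indicator less_top[symmetric])
    also have "\<dots> = (\<Sum>k<card V. f (x k) * w k)"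
      unfolding w_def using sum.reindex_bij_betw[OF x, of "\<lambda>v. f v * measure \<mu> (g -` {v} \<inter> G)"]
      by (simp add: atLeast0LessThan)
    finally show ?thesis by (simp add: mult.commute)
  qed
  have "(\<Sum>k<card V. w k) = 1" using int[of "\<lambda>_. 1"] by (simp add: prob_space)
  moreover have "x k \<in> g ` G" if "k < card V" for k
    using bij_betwE[OF x] that by (auto simp: V_def)
  moreover have "0 \<le> w k" for k by (simp add: w_def)
  ultimately show ?thesis
    using \<open>0 < card V\<close> int by (intro exI[of _ "card V"] exI[of _ w] exI[of _ x]) simp
qed

text \<open>Rounding \<open>\<mu>\<close> away from zero and \<open>\<nu>\<close> towards zero can only decrease \<open>m\<^sub>-\<^sub>2(\<mu>)\<close> and
  \<open>m\<^sub>2(\<nu>)\<close>.\<close>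

definition round_up :: "nat \<Rightarrow> real \<Rightarrow> real" where
  "round_up n t = sgn t * (real_of_int \<lceil>\<bar>t\<bar> * real (Suc n)\<rceil> / real (Suc n))"

definition round_down :: "nat \<Rightarrow> real \<Rightarrow> real" where
  "round_down n t = sgn t * (real_of_int \<lfloor>\<bar>t\<bar> * real (Suc n)\<rfloor> / real (Suc n))"

lemma round_measurable [measurable]:
  "round_up n \<in> borel_measurable borel" "round_down n \<in> borel_measurable borel"
proof -
  have [measurable]: "(sgn :: real \<Rightarrow> real) \<in> borel_measurable borel"
    unfolding sgn_if[abs_def] by measurable
  have "round_up n = (\<lambda>t. sgn t * (- real_of_int \<lfloor>- (\<bar>t\<bar> * real (Suc n))\<rfloor> / real (Suc n)))"
    by (simp add: round_up_def[abs_def] ceiling_def)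
  then show "round_up n \<in> borel_measurable borel" by simp
  show "round_down n \<in> borel_measurable borel" unfolding round_down_def[abs_def] by measurable
qed

lemma round_odd: "round_up n (- t) = - round_up n t" "round_down n (- t) = - round_down n t"
  by (simp_all add: round_up_def round_down_def sgn_minus)

lemma round_finite: "finite (round_up n ` {t. \<bar>t\<bar> \<le> R})" "finite (round_down n ` {t. \<bar>t\<bar> \<le> R})"
proof -
  let ?S = "(\<lambda>(s, k). s * (real_of_int k / real (Suc n))) ` ({-1, 0, 1} \<times> {0..\<lceil>R * real (Suc n)\<rceil>})"
  have fin: "finite ?S" by simp
  have s: "sgn t \<in> {-1, 0, 1}" for t :: real by (auto simp: sgn_if)
  have "round_up n t \<in> ?S" "round_down n t \<in> ?S" if "\<bar>t\<bar> \<le> R" for t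
  proof -
    have "\<bar>t\<bar> * real (Suc n) \<le> R * real (Suc n)" using that by (rule mult_right_mono) simp
    then have "\<lceil>\<bar>t\<bar> * real (Suc n)\<rceil> \<le> \<lceil>R * real (Suc n)\<rceil>" by (rule ceiling_mono)
    moreover have "\<lfloor>\<bar>t\<bar> * real (Suc n)\<rfloor> \<le> \<lceil>\<bar>t\<bar> * real (Suc n)\<rceil>" by (rule floor_le_ceiling)
    moreover have "0 \<le> \<lfloor>\<bar>t\<bar> * real (Suc n)\<rfloor>" by simp
    ultimately have "\<lceil>\<bar>t\<bar> * real (Suc n)\<rceil> \<in> {0..\<lceil>R * real (Suc n)\<rceil>}"
      "\<lfloor>\<bar>t\<bar> * real (Suc n)\<rfloor> \<in> {0..\<lceil>R * real (Suc n)\<rceil>}"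
      unfolding atLeastAtMost_iff by (intro conjI; linarith)+
    then show "round_up n t \<in> ?S" "round_down n t \<in> ?S"
      unfolding round_up_def round_down_def using s[of t] by force+
  qed
  then have "round_up n ` {t. \<bar>t\<bar> \<le> R} \<subseteq> ?S" "round_down n ` {t. \<bar>t\<bar> \<le> R} \<subseteq> ?S" by blast+
  then show "finite (round_up n ` {t. \<bar>t\<bar> \<le> R})" "finite (round_down n ` {t. \<bar>t\<bar> \<le> R})"
    using fin finite_subset by blast+
qed

lemma round_bounds:
  "\<bar>t\<bar> \<le> \<bar>round_up n t\<bar>" "\<bar>round_up n t - t\<bar> \<le> 1 / real (Suc n)"
  "\<bar>round_down n t\<bar> \<le> \<bar>t\<bar>" "\<bar>round_down n t - t\<bar> \<le> 1 / real (Suc n)"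
  "t \<noteq> 0 \<Longrightarrow> 1 / real (Suc n) \<le> \<bar>round_up n t\<bar>"
proof -
  let ?N = "real (Suc n)"
  define u where "u = real_of_int \<lceil>\<bar>t\<bar> * ?N\<rceil> / ?N"
  define d where "d = real_of_int \<lfloor>\<bar>t\<bar> * ?N\<rfloor> / ?N"
  have N: "0 < ?N" by simp
  have u: "\<bar>t\<bar> \<le> u" "u \<le> \<bar>t\<bar> + 1 / ?N"
  proof -
    have "\<bar>t\<bar> * ?N \<le> u * ?N" "u * ?N \<le> (\<bar>t\<bar> + 1 / ?N) * ?N"
      using ceiling_correct[of "\<bar>t\<bar> * ?N"] N by (simp_all add: u_def distrib_right)
    then show "\<bar>t\<bar> \<le> u" "u \<le> \<bar>t\<bar> + 1 / ?N" using N by (simp_all only: mult_le_cancel_right_pos)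
  qed
  have d: "d \<le> \<bar>t\<bar>" "\<bar>t\<bar> \<le> d + 1 / ?N" "0 \<le> d"
  proof -
    have "d * ?N \<le> \<bar>t\<bar> * ?N" "\<bar>t\<bar> * ?N \<le> (d + 1 / ?N) * ?N"
      using floor_correct[of "\<bar>t\<bar> * ?N"] N by (simp_all add: d_def distrib_right)
    then show "d \<le> \<bar>t\<bar>" "\<bar>t\<bar> \<le> d + 1 / ?N" using N by (simp_all only: mult_le_cancel_right_pos)
    show "0 \<le> d" by (simp add: d_def)
  qed
  have rr: "round_up n t = sgn t * u" "round_down n t = sgn t * d"
    by (simp_all add: round_up_def round_down_def u_def d_def)
  have t: "t = sgn t * \<bar>t\<bar>" by (simp add: sgn_mult_abs)
  have sgn: "\<bar>sgn t * y\<bar> = (if t = 0 then 0 else \<bar>y\<bar>)" for y by (simp add: abs_mult)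
  have diff: "sgn t * y - t = sgn t * (y - \<bar>t\<bar>)" for y using t by (metis right_diff_distrib)
  show "\<bar>t\<bar> \<le> \<bar>round_up n t\<bar>" "\<bar>round_down n t\<bar> \<le> \<bar>t\<bar>"
    using u d by (auto simp: rr sgn)
  show "\<bar>round_up n t - t\<bar> \<le> 1 / real (Suc n)" "\<bar>round_down n t - t\<bar> \<le> 1 / real (Suc n)"
    using u d N unfolding rr diff sgn by auto
  show "1 / real (Suc n) \<le> \<bar>round_up n t\<bar>" if "t \<noteq> 0"
  proof -
    have "1 \<le> \<lceil>\<bar>t\<bar> * ?N\<rceil>" using that N by (simp add: one_le_ceiling)
    then have "1 / ?N \<le> u" unfolding u_def using N by (intro divide_right_mono) auto
    then show ?thesis using that by (simp add: rr sgn)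
  qed
qed

lemma rounded_moment_tendsto:
  assumes \<mu>: "bounded_prob R \<mu>" and g: "\<And>n. g n \<in> borel_measurable borel"
    and close: "\<And>n t. \<bar>g n t - t\<bar> \<le> 1 / real (Suc n)"
  shows "(\<lambda>n. \<integral>t. g n t ^ k \<partial>\<mu>) \<longlonglongrightarrow> (\<integral>t. t ^ k \<partial>\<mu>)"
proof (rule integral_dominated_convergence[where w = "\<lambda>_. (R + 1) ^ k"])
  interpret prob_space \<mu> using \<mu> by (simp add: bounded_prob_def)
  show "(\<lambda>t. t ^ k) \<in> borel_measurable \<mu>" "\<And>n. (\<lambda>t. g n t ^ k) \<in> borel_measurable \<mu>"
    using g by (auto intro!: bounded_prob_measurable[OF \<mu>])
  show "integrable \<mu> (\<lambda>_. (R + 1) ^ k)" by simp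
  have "(\<lambda>n. g n t) \<longlonglongrightarrow> t" for t
  proof (rule LIM_zero_cancel, rule Lim_null_comparison)
    show "\<forall>\<^sub>F n in sequentially. norm (g n t - t) \<le> 1 / real (Suc n)" using close by simp
    show "(\<lambda>n. 1 / real (Suc n)) \<longlonglongrightarrow> 0"
      using LIMSEQ_inverse_real_of_nat by (simp add: inverse_eq_divide)
  qed
  then show "AE t in \<mu>. (\<lambda>n. g n t ^ k) \<longlonglongrightarrow> t ^ k" by (intro AE_I2 tendsto_power)
  show "AE t in \<mu>. norm (g n t ^ k) \<le> (R + 1) ^ k" for n
  proof -
    have "AE t in \<mu>. \<bar>t\<bar> \<le> R" using \<mu> by (simp add: bounded_prob_def)
    then show ?thesis
    proof (rule eventually_mono)
      fix t assume "\<bar>t\<bar> \<le> R"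
      moreover have "1 / real (Suc n) \<le> 1" by simp
      ultimately have "\<bar>g n t\<bar> \<le> R + 1" using close[of n t] by linarith
      then show "norm (g n t ^ k) \<le> (R + 1) ^ k" by (simp add: power_abs power_mono)
    qed
  qed
qed

section \<open>The gap at zero of a free convolution\<close>

text \<open>Symmetry of the measure in the form in which it is applied: to the rounded variable and
  to the inverse of the rounded variable, both odd and bounded on [-R, R].\<close>

definition odd_integrals_vanish :: "real \<Rightarrow> real measure \<Rightarrow> bool" where
  "odd_integrals_vanish R \<mu> \<longleftrightarrow> (\<forall>f B. f \<in> borel_measurable borel \<longrightarrow> (\<forall>t. \<bar>t\<bar> \<le> R \<longrightarrow> \<bar>f t\<bar> \<le> B) \<longrightarrow>
     (\<forall>t. f (- t) = - f t) \<longrightarrow> (\<integral>t. f t \<partial>\<mu>) = (0::real))"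

text \<open>The definite description is resolved by two uniqueness facts: the marginals determine
  the joint law, and the moments determine the measure.\<close>

lemma free_add_conv_eqI:
  assumes "compact_prob \<rho>" "free_joint_law \<mu> \<nu> \<phi>" "prob_space \<mu>"
    and mom: "\<And>n. complex_of_real (\<integral>t. t ^ n \<partial>\<rho>) = (\<Sum>w | length w = n. \<phi> w)"
  shows "\<mu> \<boxplus> \<nu> = \<rho>"
  unfolding free_add_conv_def
proof (rule the_equality)
  show "compact_prob \<rho> \<and> (\<exists>\<phi>. free_joint_law \<mu> \<nu> \<phi> \<and>
      (\<forall>n. complex_of_real (\<integral>t. t ^ n \<partial>\<rho>) = (\<Sum>w | length w = n. \<phi> w)))"
    using assms by blast
  fix \<rho>' assume *: "compact_prob \<rho>' \<and> (\<exists>\<phi>. free_joint_law \<mu> \<nu> \<phi> \<and>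
      (\<forall>n. complex_of_real (\<integral>t. t ^ n \<partial>\<rho>') = (\<Sum>w | length w = n. \<phi> w)))"
  then obtain \<psi> where \<psi>: "free_joint_law \<mu> \<nu> \<psi>"
    "\<And>n. complex_of_real (\<integral>t. t ^ n \<partial>\<rho>') = (\<Sum>w | length w = n. \<psi> w)" by blast
  have "\<psi> = \<phi>" by (rule free_joint_law_unique[OF \<psi>(1) assms(2,3)])
  then have "complex_of_real (\<integral>t. t ^ n \<partial>\<rho>') = complex_of_real (\<integral>t. t ^ n \<partial>\<rho>)" for n
    using \<psi>(2) mom by simp
  then show "\<rho>' = \<rho>" using * assms(1) by (intro moments_determine) (auto simp only: of_real_eq_iff)
qed

text \<open>Rounding up can leave [-R, R] by at most 1, so the sum is bounded by 2(R + 1).\<close>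

definition rounded_free_law ::
    "real \<Rightarrow> real \<Rightarrow> real measure \<Rightarrow> real measure \<Rightarrow> nat \<Rightarrow> (bool list \<Rightarrow> real) \<Rightarrow> (nat \<Rightarrow> real) \<Rightarrow> bool" where
  "rounded_free_law R \<delta> \<mu> \<nu> n l s \<longleftrightarrow>
    (\<forall>k. l (replicate k True) = (\<integral>t. round_up n t ^ k \<partial>\<mu>)) \<and>
    (\<forall>k. l (replicate k False) = (\<integral>t. round_down n t ^ k \<partial>\<nu>)) \<and>
    (\<forall>qs. qs \<noteq> [] \<and> distinct_adj (map fst qs) \<and>
      (\<forall>q\<in>set qs. word_poly_ev (\<lambda>w. complex_of_real (l w)) [] [q] = 0) \<longrightarrow>
      word_poly_ev (\<lambda>w. complex_of_real (l w)) [] qs = 0) \<and>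
    (\<forall>k. s k = (\<Sum>w | length w = k. l w)) \<and>
    (\<forall>p. 0 \<le> moment_functional s (p * p)) \<and>
    (\<forall>p. 0 \<le> moment_functional s ([:2 * (R + 1), -1:] * (p * p))) \<and>
    (\<forall>p. 0 \<le> moment_functional s ([:2 * (R + 1), 1:] * (p * p))) \<and>
    (\<forall>p. \<delta>\<^sup>2 * moment_functional s (p * p) \<le> moment_functional s ([:0, 1:] ^ 2 * (p * p)))"

text \<open>The constants c and d are computed from the unrounded measures and dominate those of
  every rounding. Hence q, M and \<open>\<delta>\<close> do not depend on n.\<close>

lemma rounded_free_law_exists:
  fixes R \<eta> q :: real and M :: nat
  assumes \<mu>: "bounded_prob R \<mu>" "odd_integrals_vanish R \<mu>" "AE t in \<mu>. \<eta> \<le> \<bar>t\<bar>"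
    and \<nu>: "bounded_prob R \<nu>" "odd_integrals_vanish R \<nu>"
    and q: "sqrt (\<integral>t. inverse t * inverse t \<partial>\<mu>) * sqrt (\<integral>t. t * t \<partial>\<nu>) \<le> q" "0 < q" and \<eta>: "0 < \<eta>"
    and M: "q ^ M + M * (4 * (1/\<eta>) * (R + 1)) * q ^ M / q \<le> 1/2"
  defines "\<delta> \<equiv> \<eta> / (2 * (1 + (\<Sum>k<M. ((R + 1) / \<eta>) ^ k)))"
  shows "\<exists>l s. rounded_free_law R \<delta> \<mu> \<nu> n l s"
proof -
  have R0: "0 \<le> R" using \<mu>(1) by (rule bounded_prob_nonneg)
  have p\<mu>: "prob_space \<mu>" "sets \<mu> = sets borel" and a\<mu>: "AE t in \<mu>. \<bar>t\<bar> \<le> R"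
    and p\<nu>: "prob_space \<nu>" "sets \<nu> = sets borel" and a\<nu>: "AE t in \<nu>. \<bar>t\<bar> \<le> R"
    using \<mu> \<nu> by (auto simp: bounded_prob_def)
  interpret \<mu>: prob_space \<mu> by (rule p\<mu>)
  interpret \<nu>: prob_space \<nu> by (rule p\<nu>)
  have [measurable]: "(\<lambda>t. t) \<in> borel_measurable \<mu>" "round_up n \<in> borel_measurable \<mu>"
    by (rule bounded_prob_measurable[OF \<mu>(1)], simp)+
  have [measurable]: "(\<lambda>t. t) \<in> borel_measurable \<nu>" "round_down n \<in> borel_measurable \<nu>"
    by (rule bounded_prob_measurable[OF \<nu>(1)], simp)+
  define G where "G = {t. \<eta> \<le> \<bar>t\<bar> \<and> \<bar>t\<bar> \<le> R}"
  have "closed G" unfolding G_def by (intro closed_Collect_conj closed_Collect_le continuous_intros)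
  then have Gb: "G \<in> sets borel" by (rule borel_closed)
  have Ga: "AE t in \<mu>. t \<in> G" using \<mu>(3) a\<mu> by eventually_elim (simp add: G_def)
  have finG: "finite (round_up n ` G)"
    by (rule finite_subset[OF _ round_finite(1)[of n R]]) (auto simp: G_def)
  define H where "H = {t. \<bar>t\<bar> \<le> R}"
  have "closed H" unfolding H_def by (intro closed_Collect_le continuous_intros)
  then have Hb: "H \<in> sets borel" by (rule borel_closed)
  obtain n1 :: nat and w1 x1 :: "nat \<Rightarrow> real" where d1: "0 < n1" "\<forall>k<n1. 0 \<le> w1 k \<and> x1 k \<in> round_up n ` G" "(\<Sum>k<n1. w1 k) = 1"
    "\<forall>f :: real \<Rightarrow> real. f \<in> borel_measurable borel \<longrightarrow> (\<Sum>k<n1. w1 k * f (x1 k)) = (\<integral>t. f (round_up n t) \<partial>\<mu>)"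
    using finite_range_discretization[OF p\<mu> Ga Gb round_measurable(1) finG] by blast
  have Ha: "AE t in \<nu>. t \<in> H" using a\<nu> by (simp add: H_def)
  obtain n2 :: nat and w2 x2 :: "nat \<Rightarrow> real" where d2: "0 < n2" "\<forall>k<n2. 0 \<le> w2 k \<and> x2 k \<in> round_down n ` H" "(\<Sum>k<n2. w2 k) = 1"
    "\<forall>f :: real \<Rightarrow> real. f \<in> borel_measurable borel \<longrightarrow> (\<Sum>k<n2. w2 k * f (x2 k)) = (\<integral>t. f (round_down n t) \<partial>\<nu>)"
    using finite_range_discretization[OF p\<nu> Ha Hb round_measurable(2) round_finite(2)[of n R, folded H_def]] by blast
  define N where "N b = (if b then n1 else n2)" for b
  define w where "w b = (if b then w1 else w2)" for b
  define x where "x b = (if b then x1 else x2)" for b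
  define c where "c = sqrt (\<integral>t. inverse t * inverse t \<partial>\<mu>)"
  define d where "d = sqrt (\<integral>t. t * t \<partial>\<nu>)"
  have inv_le: "inverse s * inverse s \<le> inverse r * inverse r" if "\<bar>r\<bar> \<le> \<bar>s\<bar>" "r \<noteq> 0" for r s :: real
  proof -
    have "inverse \<bar>s\<bar> \<le> inverse \<bar>r\<bar>" using that by (intro le_imp_inverse_le) auto
    then have "inverse \<bar>s\<bar> * inverse \<bar>s\<bar> \<le> inverse \<bar>r\<bar> * inverse \<bar>r\<bar>" by (intro mult_mono) auto
    then show ?thesis by (simp flip: abs_inverse)
  qed
  have sq_le: "s * s \<le> r * r" if "\<bar>s\<bar> \<le> \<bar>r\<bar>" for r s :: real
    using that by (metis abs_le_square_iff power2_eq_square)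
  have G0: "t \<noteq> 0" if "t \<in> G" for t using that \<eta> by (auto simp: G_def)
  have inv\<eta>: "inverse t * inverse t \<le> (1/\<eta>)\<^sup>2" if "t \<in> G" for t
    using inv_le[of \<eta> t] that \<eta> by (simp add: G_def power2_eq_square inverse_eq_divide)
  have int_inv: "integrable \<mu> (\<lambda>t. inverse t * inverse t)" "integrable \<mu> (\<lambda>t. inverse (round_up n t) * inverse (round_up n t))"
  proof -
    show "integrable \<mu> (\<lambda>t. inverse t * inverse t)"
    proof (rule \<mu>.integrable_const_bound[where B = "(1/\<eta>)\<^sup>2"])
      show "AE t in \<mu>. norm (inverse t * inverse t) \<le> (1/\<eta>)\<^sup>2"
        using Ga by (rule eventually_mono) (use inv\<eta> in simp)
    qed measurable
    show "integrable \<mu> (\<lambda>t. inverse (round_up n t) * inverse (round_up n t))"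
    proof (rule \<mu>.integrable_const_bound[where B = "(1/\<eta>)\<^sup>2"])
      show "AE t in \<mu>. norm (inverse (round_up n t) * inverse (round_up n t)) \<le> (1/\<eta>)\<^sup>2"
        using Ga
      proof (rule eventually_mono)
        fix t assume t: "t \<in> G"
        show "norm (inverse (round_up n t) * inverse (round_up n t)) \<le> (1/\<eta>)\<^sup>2"
          using inv_le[OF round_bounds(1)[of t n] G0[OF t]] inv\<eta>[OF t] by simp
      qed
    qed measurable
  qed
  have int_sq: "integrable \<nu> (\<lambda>t. t * t)" "integrable \<nu> (\<lambda>t. round_down n t * round_down n t)"
  proof -
    show "integrable \<nu> (\<lambda>t. t * t)"
      by (rule bounded_prob_integrable[OF \<nu>(1), of _ "R * R"]) (use sq_le[of _ R] R0 in auto)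
    show "integrable \<nu> (\<lambda>t. round_down n t * round_down n t)"
    proof (rule bounded_prob_integrable[OF \<nu>(1), of _ "R * R"])
      fix t :: real assume "\<bar>t\<bar> \<le> R"
      then have "\<bar>round_down n t\<bar> \<le> R" using round_bounds(3)[of n t] by linarith
      then show "\<bar>round_down n t * round_down n t\<bar> \<le> R * R" using sq_le[of "round_down n t" R] R0 by simp
    qed simp
  qed
  have c\<eta>: "c \<le> 1 / \<eta>"
  proof -
    have "(\<integral>t. inverse t * inverse t \<partial>\<mu>) \<le> (\<integral>t. (1/\<eta>)\<^sup>2 \<partial>\<mu>)"
      by (rule integral_mono_AE) (use int_inv Ga inv\<eta> in \<open>auto elim!: eventually_mono\<close>)
    then have "(\<integral>t. inverse t * inverse t \<partial>\<mu>) \<le> (1/\<eta>)\<^sup>2" by (simp add: \<mu>.prob_space)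
    then have "c \<le> sqrt ((1/\<eta>)\<^sup>2)" unfolding c_def by (rule real_sqrt_le_mono)
    then show ?thesis using \<eta> by simp
  qed
  have dR: "d \<le> R + 1"
  proof -
    have "(\<integral>t. t * t \<partial>\<nu>) \<le> (\<integral>t. R\<^sup>2 \<partial>\<nu>)"
    proof (rule integral_mono_AE)
      show "AE t in \<nu>. t * t \<le> R\<^sup>2"
        using a\<nu> by (rule eventually_mono) (use sq_le R0 in \<open>auto simp: power2_eq_square\<close>)
    qed (use int_sq in auto)
    then have "(\<integral>t. t * t \<partial>\<nu>) \<le> R\<^sup>2" by (simp add: \<nu>.prob_space)
    then have "d \<le> sqrt (R\<^sup>2)" unfolding d_def by (rule real_sqrt_le_mono)
    then show ?thesis using R0 by simp
  qed
  have m1: "(\<Sum>k<N True. w True k * f (x True k)) = (\<integral>t. f (round_up n t) \<partial>\<mu>)"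
    and m2: "(\<Sum>k<N False. w False k * f (x False k)) = (\<integral>t. f (round_down n t) \<partial>\<nu>)"
    if "f \<in> borel_measurable borel" for f :: "real \<Rightarrow> real"
    using d1(4) d2(4) that by (simp_all add: N_def w_def x_def)
  have xR: "\<bar>x b k\<bar> \<le> R + 1" if k: "k < N b" for b k
  proof (cases b)
    case True
    then obtain t where "\<bar>t\<bar> \<le> R" "x b k = round_up n t"
      using d1(2) k by (auto simp: N_def x_def G_def)
    moreover have "1 / real (Suc n) \<le> 1" by simp
    ultimately show ?thesis using round_bounds(2)[of n t] by linarith
  next
    case False
    then obtain t where "\<bar>t\<bar> \<le> R" "x b k = round_down n t"
      using d2(2) k by (auto simp: N_def x_def H_def)
    then show ?thesis using round_bounds(3)[of n t] by linarith
  qed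
  have x\<eta>: "\<eta> \<le> \<bar>x True k\<bar>" if k: "k < N True" for k
  proof -
    obtain t where "\<eta> \<le> \<bar>t\<bar>" "x True k = round_up n t"
      using d1(2) k by (auto simp: N_def x_def G_def)
    then show ?thesis using round_bounds(1)[of t n] by linarith
  qed
  have odd_inv: "(\<integral>t. inverse (round_up n t) \<partial>\<mu>) = 0"
  proof -
    \<comment> \<open>The bound must hold for all t, also inside the gap. The grid provides it:
      nonzero values are at least 1 / Suc n in modulus, and the inverse of 0 is 0.\<close>
    have "\<bar>inverse (round_up n t)\<bar> \<le> real (Suc n)" for t
    proof (cases "t = 0")
      case False
      then have "inverse \<bar>round_up n t\<bar> \<le> inverse (1 / real (Suc n))"
        using round_bounds(5)[OF False, of n] by (intro le_imp_inverse_le) auto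
      then show ?thesis by (simp add: abs_inverse)
    qed (simp add: round_up_def)
    moreover have "(\<lambda>t. inverse (round_up n t)) \<in> borel_measurable borel" by measurable
    moreover have "inverse (round_up n (- t)) = - inverse (round_up n t)" for t by (simp add: round_odd)
    ultimately show ?thesis using \<mu>(2) unfolding odd_integrals_vanish_def by blast
  qed
  have odd_id: "(\<integral>t. round_down n t \<partial>\<nu>) = 0"
  proof -
    have "\<bar>round_down n t\<bar> \<le> R" if "\<bar>t\<bar> \<le> R" for t using round_bounds(3)[of n t] that by linarith
    moreover have "round_down n (- t) = - round_down n t" for t by (simp add: round_odd)
    ultimately show ?thesis using \<nu>(2) round_measurable unfolding odd_integrals_vanish_def by blast
  qed
  have c1: "sqrt (\<integral>t. inverse (round_up n t) * inverse (round_up n t) \<partial>\<mu>) \<le> c"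
    unfolding c_def
  proof (rule real_sqrt_le_mono, rule integral_mono_AE)
    show "AE t in \<mu>. inverse (round_up n t) * inverse (round_up n t) \<le> inverse t * inverse t"
      using Ga by (rule eventually_mono) (use inv_le round_bounds(1) G0 in blast)
  qed (rule int_inv)+
  have c2: "sqrt (\<integral>t. round_down n t * round_down n t \<partial>\<nu>) \<le> d"
    unfolding d_def
    by (rule real_sqrt_le_mono, rule integral_mono) (use int_sq sq_le round_bounds(3) in auto)
  obtain l :: "bool list \<Rightarrow> real" and s :: "nat \<Rightarrow> real" where
    l: "\<And>n b. l (replicate n b) = (\<Sum>k<N b. w b k * x b k ^ n)"
    and rest: "\<And>qs. qs \<noteq> [] \<Longrightarrow> distinct_adj (map fst qs) \<Longrightarrow>
      (\<forall>q\<in>set qs. word_poly_ev (\<lambda>w. complex_of_real (l w)) [] [q] = 0) \<Longrightarrow>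
      word_poly_ev (\<lambda>w. complex_of_real (l w)) [] qs = 0"
    "\<And>n. s n = (\<Sum>w | length w = n. l w)"
    "\<And>p. 0 \<le> moment_functional s (p * p)"
    "\<And>p. 0 \<le> moment_functional s ([:2 * (R + 1), -1:] * (p * p))"
    "\<And>p. 0 \<le> moment_functional s ([:2 * (R + 1), 1:] * (p * p))"
    "\<And>p. \<delta>\<^sup>2 * moment_functional s (p * p) \<le> moment_functional s ([:0, 1:] ^ 2 * (p * p))"
  proof (rule finite_free_law_exists[of N w x "R + 1" \<eta> c d q M, folded \<delta>_def])
    show "0 < N b" for b using d1 d2 by (simp add: N_def)
    show "0 \<le> w b k" if "k < N b" for b k using d1(2) d2(2) that by (cases b) (simp_all add: N_def w_def)
    show "(\<Sum>k<N b. w b k) = 1" for b using d1(3) d2(3) by (simp add: N_def w_def)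
    show "\<bar>x b k\<bar> \<le> R + 1" if "k < N b" for b k using xR[OF that] .
    show "\<eta> \<le> \<bar>x True k\<bar>" if "k < N True" for k using x\<eta>[OF that] .
    show "(\<Sum>k<N True. w True k * inverse (x True k)) = 0" by (subst m1) (simp_all add: odd_inv)
    show "(\<Sum>k<N False. w False k * x False k) = 0" using m2[of "\<lambda>t. t"] odd_id by simp
    show "sqrt (\<Sum>k<N True. w True k * (inverse (x True k) * inverse (x True k))) \<le> c"
      using m1[of "\<lambda>t. inverse t * inverse t"] c1 by simp
    show "sqrt (\<Sum>k<N False. w False k * (x False k * x False k)) \<le> d"
      using m2[of "\<lambda>t. t * t"] c2 by simp
    show "c * d \<le> q" using q(1) by (simp add: c_def d_def)
  qed (use c\<eta> dR q \<eta> R0 M in auto)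
  have "l (replicate k True) = (\<integral>t. round_up n t ^ k \<partial>\<mu>)" "l (replicate k False) = (\<integral>t. round_down n t ^ k \<partial>\<nu>)" for k
    using m1[of "\<lambda>t. t ^ k"] m2[of "\<lambda>t. t ^ k"] by (simp_all add: l)
  then show ?thesis
    unfolding rounded_free_law_def using rest
    by (intro exI[of _ l] exI[of _ s] conjI allI impI) (assumption | elim conjE)+
qed

text \<open>The bound is uniform over all admissible pairs because it will be applied to a whole
  sequence. For one pair, the laws of the rounded measures converge to the free joint law, and the
  limiting moment functional represents the convolution and inherits the gap inequality.\<close>

lemma free_convolution_gap:
  assumes q: "0 < q" "q < 1" and \<eta>: "0 < \<eta>" and R: "0 \<le> R"
  shows "\<exists>\<delta>>0. \<forall>\<mu> \<nu>. bounded_prob R \<mu> \<longrightarrow> odd_integrals_vanish R \<mu> \<longrightarrow> (AE t in \<mu>. \<eta> \<le> \<bar>t\<bar>) \<longrightarrow>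
    bounded_prob R \<nu> \<longrightarrow> odd_integrals_vanish R \<nu> \<longrightarrow>
    sqrt (\<integral>t. inverse t * inverse t \<partial>\<mu>) * sqrt (\<integral>t. t * t \<partial>\<nu>) \<le> q \<longrightarrow>
    {-\<delta><..<\<delta>} \<inter> msupp (\<mu> \<boxplus> \<nu>) = {}"
proof -
  \<comment> \<open>As q < 1, the factor q^n beats the linear growth of the Haagerup bound, so some
    power M brings it below 1/2. Only q, \<eta> and R enter the choice of M.\<close>
  have "(\<lambda>n. q ^ n + (4 * (1/\<eta>) * (R + 1) / q) * (real n * q ^ n)) \<longlonglongrightarrow> 0 + (4 * (1/\<eta>) * (R + 1) / q) * 0"
    using q by (intro tendsto_intros LIMSEQ_power_zero powser_times_n_limit_0) auto
  then have "\<forall>\<^sub>F n in sequentially. q ^ n + (4 * (1/\<eta>) * (R + 1) / q) * (real n * q ^ n) < 1/2"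
    by (rule order_tendstoD) simp
  then obtain M where "q ^ M + (4 * (1/\<eta>) * (R + 1) / q) * (real M * q ^ M) < 1/2"
    by (auto simp: eventually_sequentially)
  then have M: "q ^ M + M * (4 * (1/\<eta>) * (R + 1)) * q ^ M / q \<le> 1/2" by (simp add: field_simps)
  define \<delta> where "\<delta> = \<eta> / (2 * (1 + (\<Sum>k<M. ((R + 1) / \<eta>) ^ k)))"
  have "0 \<le> (\<Sum>k<M. ((R + 1) / \<eta>) ^ k)" using \<eta> R by (intro sum_nonneg) auto
  then have \<delta>: "0 < \<delta>" unfolding \<delta>_def using \<eta> by (intro divide_pos_pos) auto
  have "{-\<delta><..<\<delta>} \<inter> msupp (\<mu> \<boxplus> \<nu>) = {}"
    if \<mu>: "bounded_prob R \<mu>" "odd_integrals_vanish R \<mu>" "AE t in \<mu>. \<eta> \<le> \<bar>t\<bar>"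
      and \<nu>: "bounded_prob R \<nu>" "odd_integrals_vanish R \<nu>"
      and qq: "sqrt (\<integral>t. inverse t * inverse t \<partial>\<mu>) * sqrt (\<integral>t. t * t \<partial>\<nu>) \<le> q" for \<mu> \<nu>
  proof -
    have "\<exists>l s. rounded_free_law R \<delta> \<mu> \<nu> n l s" for n
      unfolding \<delta>_def by (rule rounded_free_law_exists[OF \<mu> \<nu> qq q(1) \<eta> M])
    then obtain l s where ls: "\<And>n. rounded_free_law R \<delta> \<mu> \<nu> n (l n) (s n)" by metis
    note F = ls[unfolded rounded_free_law_def]
    note l = F[THEN conjunct1, THEN spec] F[THEN conjunct2, THEN conjunct1, THEN spec]
    note free = F[THEN conjunct2, THEN conjunct2, THEN conjunct1, THEN spec]
    note s = F[THEN conjunct2, THEN conjunct2, THEN conjunct2, THEN conjunct1, THEN spec]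
    note pos = F[THEN conjunct2, THEN conjunct2, THEN conjunct2, THEN conjunct2, THEN conjunct1, THEN spec] F[THEN conjunct2, THEN conjunct2, THEN conjunct2, THEN conjunct2, THEN conjunct2, THEN conjunct1, THEN spec]
      F[THEN conjunct2, THEN conjunct2, THEN conjunct2, THEN conjunct2, THEN conjunct2, THEN conjunct2, THEN conjunct1, THEN spec] F[THEN conjunct2, THEN conjunct2, THEN conjunct2, THEN conjunct2, THEN conjunct2, THEN conjunct2, THEN conjunct2, THEN spec]
    have p\<mu>: "prob_space \<mu>" using \<mu>(1) by (simp add: bounded_prob_def)
    have meas: "round_up n \<in> borel_measurable \<mu>" "round_down n \<in> borel_measurable \<nu>" for n
      by (rule bounded_prob_measurable[OF \<mu>(1) round_measurable(1)],
          rule bounded_prob_measurable[OF \<nu>(1) round_measurable(2)])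
    define \<mu>s where "\<mu>s n = distr \<mu> borel (round_up n)" for n
    define \<nu>s where "\<nu>s n = distr \<nu> borel (round_down n)" for n
    have mom: "(\<integral>t. t ^ k \<partial>\<mu>s n) = (\<integral>t. round_up n t ^ k \<partial>\<mu>)" "(\<integral>t. t ^ k \<partial>\<nu>s n) = (\<integral>t. round_down n t ^ k \<partial>\<nu>)" for n k
      unfolding \<mu>s_def \<nu>s_def using meas by (simp_all add: integral_distr)
    have law: "free_joint_law (\<mu>s n) (\<nu>s n) (\<lambda>w. complex_of_real (l n w))" for n
      unfolding free_joint_law_def using free by (simp add: l mom)
    have prob: "prob_space (\<mu>s n)" for n
      unfolding \<mu>s_def using meas p\<mu> by (intro prob_space.prob_space_distr) auto
    have lim1: "(\<lambda>n. \<integral>t. t ^ k \<partial>\<mu>s n) \<longlonglongrightarrow> (\<integral>t. t ^ k \<partial>\<mu>)" for k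
      unfolding mom by (rule rounded_moment_tendsto[OF \<mu>(1) round_measurable(1) round_bounds(2)])
    have lim2: "(\<lambda>n. \<integral>t. t ^ k \<partial>\<nu>s n) \<longlonglongrightarrow> (\<integral>t. t ^ k \<partial>\<nu>)" for k
      unfolding mom by (rule rounded_moment_tendsto[OF \<nu>(1) round_measurable(2) round_bounds(4)])
    \<comment> \<open>Convergence of the marginal moments forces convergence of all mixed moments;
      no subsequence has to be extracted.\<close>
    have "convergent (\<lambda>n. complex_of_real (l n w))" for w
      by (rule free_joint_law_convergent[OF law prob]) (use lim1 lim2 in \<open>auto simp: convergent_def\<close>)
    then obtain \<phi> where \<phi>: "\<And>w. (\<lambda>n. complex_of_real (l n w)) \<longlonglongrightarrow> \<phi> w"
      unfolding convergent_def by metis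
    define \<phi>r where "\<phi>r w = Re (\<phi> w)" for w
    have lr: "(\<lambda>n. l n w) \<longlonglongrightarrow> \<phi>r w" for w
      using tendsto_Re[OF \<phi>[of w]] by (simp add: \<phi>r_def)
    then have \<phi>_eq: "\<phi> w = complex_of_real (\<phi>r w)" for w
      using LIMSEQ_unique[OF \<phi> tendsto_of_real] by blast
    have law\<phi>: "free_joint_law \<mu> \<nu> \<phi>"
      by (rule free_joint_law_limit[OF law prob \<phi> lim1 lim2])
    define s' where "s' k = (\<Sum>w | length w = k. \<phi>r w)" for k
    have s_lim: "(\<lambda>n. s n k) \<longlonglongrightarrow> s' k" for k
      unfolding s s'_def by (intro tendsto_intros lr)
    then have mf_lim: "(\<lambda>n. moment_functional (s n) p) \<longlonglongrightarrow> moment_functional s' p" for p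
      by (rule moment_functional_tendsto)
    \<comment> \<open>For a fixed polynomial each condition involves finitely many moments and a
      weak inequality, so it passes to the limit.\<close>
    have pos': "0 \<le> moment_functional s' (p * p)"
      "0 \<le> moment_functional s' ([:2 * (R + 1), -1:] * (p * p))"
      "0 \<le> moment_functional s' ([:2 * (R + 1), 1:] * (p * p))"
      "\<delta>\<^sup>2 * moment_functional s' (p * p) \<le> moment_functional s' ([:0, 1:] ^ 2 * (p * p))" for p
      using LIMSEQ_le_const[OF mf_lim] LIMSEQ_le[OF tendsto_mult[OF tendsto_const mf_lim] mf_lim] pos by blast+
    have s'0: "s' 0 = 1"
    proof -
      have "\<phi> [] = 1" by (rule free_joint_law_unit[OF law\<phi> p\<mu>])
      then show ?thesis by (simp add: s'_def \<phi>r_def)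
    qed
    obtain \<rho> where \<rho>: "bounded_prob (2 * (R + 1)) \<rho>"
      "\<And>j. (\<integral>t. t ^ j \<partial>\<rho>) = moment_functional s' ([:0, 1:] ^ j)"
    proof (rule poly_functional_measure[of "moment_functional s'" "2 * (R + 1)"])
      show "moment_functional s' 1 = 1" using moment_functional_monom[of s' 0] s'0 by simp
      show "0 < 2 * (R + 1)" using R by simp
    qed (rule moment_functional_add moment_functional_smult pos' | use that in blast)+
    have \<rho>_mom: "(\<integral>t. t ^ j \<partial>\<rho>) = s' j" for j by (simp only: \<rho>(2) moment_functional_monom)
    have \<rho>_poly: "(\<integral>t. poly p t \<partial>\<rho>) = moment_functional s' p" for p
      unfolding poly_integral[OF \<rho>(1)] moment_functional_def \<rho>_mom ..
    have "\<mu> \<boxplus> \<nu> = \<rho>"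
    proof (rule free_add_conv_eqI[OF _ law\<phi> p\<mu>])
      show "compact_prob \<rho>" using \<rho>(1) compact_prob_iff_bounded_prob by blast
      show "complex_of_real (\<integral>t. t ^ n \<partial>\<rho>) = (\<Sum>w | length w = n. \<phi> w)" for n
        by (simp add: \<rho>_mom s'_def \<phi>_eq)
    qed
    moreover have "{-\<delta><..<\<delta>} \<inter> msupp \<rho> = {}"
    proof (rule quadratic_gap[OF \<rho>(1) \<delta>])
      fix p
      have "(\<integral>t. (poly p t)\<^sup>2 \<partial>\<rho>) = moment_functional s' (p * p)"
        using \<rho>_poly[of "p * p"] by (simp add: power2_eq_square)
      moreover have "(\<integral>t. t\<^sup>2 * (poly p t)\<^sup>2 \<partial>\<rho>) = moment_functional s' ([:0, 1:] ^ 2 * (p * p))"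
        using \<rho>_poly[of "[:0, 1:] ^ 2 * (p * p)"] by (simp add: power2_eq_square mult_ac)
      ultimately show "\<delta>\<^sup>2 * (\<integral>t. (poly p t)\<^sup>2 \<partial>\<rho>) \<le> (\<integral>t. t\<^sup>2 * (poly p t)\<^sup>2 \<partial>\<rho>)"
        using pos'(4) by simp
    qed
    ultimately show ?thesis by simp
  qed
  then show ?thesis using \<delta> by blast
qed

lemma symmetrization_odd_integrals_vanish:
  "bounded_prob R \<nu> \<Longrightarrow> odd_integrals_vanish R (symmetrization \<nu>)"
  unfolding odd_integrals_vanish_def using integral_odd_symmetrization by blast

section \<open>From extended moments to real integrals\<close>

lemma powi_2_ennreal: "ennreal \<bar>t\<bar> powi 2 = ennreal (t * t)"
  by (simp add: power_int_def power2_eq_square ennreal_mult'[symmetric])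

text \<open>Cutting off at \<eta> turns t^(-2) into a bounded continuous minorant, equal to it for
  |t| >= \<eta>; at t = 0 the right-hand side is infinite.\<close>

lemma powi_minus_2_ennreal_ge:
  assumes "0 < \<eta>"
  shows "ennreal (1 / max (t\<^sup>2) (\<eta>\<^sup>2)) \<le> ennreal \<bar>t\<bar> powi (-2)"
proof (cases "t = 0")
  case True
  then show ?thesis by (simp add: power_int_def)
next
  case False
  then have "inverse (ennreal \<bar>t\<bar>) = ennreal (inverse \<bar>t\<bar>)" by (simp add: inverse_ennreal)
  then have "ennreal \<bar>t\<bar> powi (-2) = ennreal ((inverse \<bar>t\<bar>)\<^sup>2)"
    by (simp add: power_int_def ennreal_power)
  also have "(inverse \<bar>t\<bar>)\<^sup>2 = 1 / t\<^sup>2" by (simp add: power_one_over inverse_eq_divide)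
  finally show ?thesis
    using False assms by (auto intro!: ennreal_leI divide_left_mono mult_pos_pos simp: less_max_iff_disj)
qed

lemma abs_moment_2:
  assumes "bounded_prob R \<nu>" shows "abs_moment 2 \<nu> = ennreal (\<integral>t. t * t \<partial>\<nu>)"
proof -
  have "integrable \<nu> (\<lambda>t. t * t)"
    by (rule bounded_prob_integrable_cont[OF assms]) (auto intro!: continuous_intros)
  then show ?thesis
    unfolding abs_moment_def powi_2_ennreal by (rule nn_integral_eq_integral) simp
qed

text \<open>The cut-off integral F is at most m_-2, so the assumption gives m < 1/F. An infinite
  m_-2 is excluded, as its reciprocal 0 cannot exceed a moment.\<close>

lemma abs_moment_product_less_1:
  assumes \<mu>: "bounded_prob R \<mu>" and \<nu>: "bounded_prob R \<nu>" and \<eta>: "0 < \<eta>"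
    and less: "abs_moment 2 \<nu> < 1 / abs_moment (-2) \<mu>"
  shows "(\<integral>t. t * t \<partial>\<nu>) * (\<integral>t. 1 / max (t\<^sup>2) (\<eta>\<^sup>2) \<partial>\<mu>) < 1"
proof -
  interpret prob_space \<mu> using \<mu> by (simp add: bounded_prob_def)
  have R: "0 \<le> R" using \<mu> by (rule bounded_prob_nonneg)
  define f where "f t = 1 / max (t\<^sup>2) (\<eta>\<^sup>2)" for t
  have pos: "0 < max (t\<^sup>2) (\<eta>\<^sup>2)" for t using \<eta> by (simp add: less_max_iff_disj)
  have f: "continuous_on A f" for A
    unfolding f_def using pos by (intro continuous_intros) (metis less_irrefl)
  have int: "integrable \<mu> f"
    by (rule bounded_prob_integrable_cont[OF \<mu> borel_measurable_continuous_onI[OF f] f])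
  define m F where "m = (\<integral>t. t * t \<partial>\<nu>)" and "F = (\<integral>t. f t \<partial>\<mu>)"
  \<comment> \<open>Positivity of F allows passing from m < 1/F to the product form.\<close>
  have "1 / (R\<^sup>2 + \<eta>\<^sup>2) \<le> F"
  proof -
    have "(\<integral>t. 1 / (R\<^sup>2 + \<eta>\<^sup>2) \<partial>\<mu>) \<le> F"
      unfolding F_def
    proof (rule integral_mono_AE[OF _ int])
      have "AE t in \<mu>. \<bar>t\<bar> \<le> R" using \<mu> by (simp add: bounded_prob_def)
      then show "AE t in \<mu>. 1 / (R\<^sup>2 + \<eta>\<^sup>2) \<le> f t"
      proof (rule eventually_mono)
        fix t assume "\<bar>t\<bar> \<le> R"
        then have "t\<^sup>2 \<le> R\<^sup>2" using R by (metis abs_le_square_iff abs_of_nonneg)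
        then have "max (t\<^sup>2) (\<eta>\<^sup>2) \<le> R\<^sup>2 + \<eta>\<^sup>2"
          using zero_le_power2[of R] zero_le_power2[of \<eta>] by (intro max.boundedI) linarith+
        then show "1 / (R\<^sup>2 + \<eta>\<^sup>2) \<le> f t"
          unfolding f_def using pos[of t] by (intro divide_left_mono mult_pos_pos) linarith+
      qed
    qed simp
    then show ?thesis by (simp add: prob_space)
  qed
  moreover have "0 < 1 / (R\<^sup>2 + \<eta>\<^sup>2)" using \<eta> by (simp add: add_nonneg_pos)
  ultimately have F: "0 < F" by linarith
  have "ennreal F = (\<integral>\<^sup>+t. ennreal (f t) \<partial>\<mu>)"
    unfolding F_def using nn_integral_eq_integral[OF int] pos by (simp add: f_def less_imp_le)
  also have "\<dots> \<le> abs_moment (-2) \<mu>"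
    unfolding abs_moment_def f_def by (intro nn_integral_mono powi_minus_2_ennreal_ge \<eta>)
  finally have FI: "ennreal F \<le> abs_moment (-2) \<mu>" .
  have mI: "ennreal m < 1 / abs_moment (-2) \<mu>"
    using less by (simp add: m_def abs_moment_2[OF \<nu>])
  have "m < 1 / F"
  proof (cases "abs_moment (-2) \<mu>" rule: ennreal_cases)
    case (real r)
    then have "F \<le> r" using FI F by (simp add: ennreal_le_iff)
    then have "ennreal m < ennreal (1 / r)"
      using mI real F divide_ennreal[of 1 r] by simp
    then have "m < 1 / r" by (simp add: ennreal_less_iff m_def)
    also have "1 / r \<le> 1 / F" using F \<open>F \<le> r\<close> by (intro divide_left_mono) auto
    finally show ?thesis .
  next
    case top
    then show ?thesis using mI by simp
  qed
  then show ?thesis using F by (simp add: m_def F_def f_def field_simps)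
qed

theorem theorem2p15:
  fixes M :: "'h::complex_hilbert oper set" and \<tau> :: "'h oper \<Rightarrow> complex"
    and a T :: "'h oper" and a_seq :: "nat \<Rightarrow> 'h oper" and z :: complex
    and \<mu>1 \<mu>2 :: "real measure" and \<mu>1_seq :: "nat \<Rightarrow> real measure"
  assumes "tracial_vN_algebra M \<tau>"
    and "a \<in> M" and "T \<in> M" and "freely_independent \<tau> a T"
    and "R_diagonal TYPE('k::complex_hilbert) \<tau> T"
    and "\<And>n. a_seq n \<in> M"
    and "bdd_above (range (\<lambda>n. norm (a_seq n)))"
    and "converges_in_star_moments \<tau> a_seq a"
    and \<mu>1_def: "\<mu>1 = symmetrization (spectral_distribution \<tau> (op_abs (a - scalar_op z)))"
    and \<mu>2_def: "\<mu>2 = symmetrization (spectral_distribution \<tau> (op_abs T))"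
    and \<mu>1_seq_def: "\<And>n. \<mu>1_seq n =
          symmetrization (spectral_distribution \<tau> (op_abs (a_seq n - scalar_op z)))"
    and supp_eq_spec: "msupp (brown_measure \<tau> (a + T)) = op_spectrum M (a + T)"
    and z_outside: "abs_moment 2 \<mu>2 < 1 / abs_moment (-2) \<mu>1"
    and gap: "\<exists>\<eta>>0. \<forall>\<^sub>F n in sequentially. {-\<eta>..\<eta>} \<inter> msupp (\<mu>1_seq n) = {}"
  shows "\<exists>\<epsilon>>0. \<forall>\<^sub>F n in sequentially. {-\<epsilon>..\<epsilon>} \<inter> msupp (\<mu>1_seq n \<boxplus> \<mu>2) = {}"
proof -
  interpret tracial_vN_algebra M \<tau> by (rule assms(1))
  obtain B where B: "\<And>n. norm (a_seq n) \<le> B"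
    using assms(7) unfolding bdd_above_def by auto
  define Z where "Z = norm (scalar_op z :: 'h oper)"
  \<comment> \<open>One radius for all operators a_n - z, for a - z and for T; the summand 1 makes
    it positive.\<close>
  define R where "R = \<bar>B\<bar> + norm a + Z + norm T + 1"
  have Z: "0 \<le> Z" by (simp add: Z_def)
  have R: "0 < R" unfolding R_def using Z by (simp add: add_nonneg_pos)
  define x where "x n = a_seq n - scalar_op z" for n
  have xM: "x n \<in> M" for n unfolding x_def using assms(6) M_scalar by (rule M_diff)
  have yM: "a - scalar_op z \<in> M" using assms(2) M_scalar by (rule M_diff)
  have xR: "norm (x n) \<le> R" for n
    using norm_triangle_ineq4[of "a_seq n" "scalar_op z"] B[of n] norm_ge_zero[of a] norm_ge_zero[of T]
    unfolding x_def R_def Z_def by linarith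
  have yR: "norm (a - scalar_op z) \<le> R"
    using norm_triangle_ineq4[of a "scalar_op z"] norm_ge_zero[of T] unfolding R_def Z_def by linarith
  have TR: "norm T \<le> R" using Z unfolding R_def by simp
  define \<sigma> where "\<sigma> y = spectral_distribution \<tau> (op_abs y)" for y
  have \<sigma>x: "bounded_prob R (\<sigma> (x n))" for n unfolding \<sigma>_def by (rule op_abs_distribution(1)[OF xM xR R])
  have \<sigma>y: "bounded_prob R (\<sigma> (a - scalar_op z))" unfolding \<sigma>_def by (rule op_abs_distribution(1)[OF yM yR R])
  have \<sigma>T: "bounded_prob R (\<sigma> T)" unfolding \<sigma>_def by (rule op_abs_distribution(1)[OF assms(3) TR R])
  have eqs: "\<mu>1_seq n = symmetrization (\<sigma> (x n))" "\<mu>1 = symmetrization (\<sigma> (a - scalar_op z))"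
    "\<mu>2 = symmetrization (\<sigma> T)" for n
    by (simp_all add: \<mu>1_seq_def \<mu>1_def \<mu>2_def \<sigma>_def x_def)
  have bp: "bounded_prob R (\<mu>1_seq n)" "bounded_prob R \<mu>1" "bounded_prob R \<mu>2" for n
    unfolding eqs by (rule bounded_prob_symmetrization \<sigma>x \<sigma>y \<sigma>T)+
  have odd: "odd_integrals_vanish R (\<mu>1_seq n)" "odd_integrals_vanish R \<mu>2" for n
    unfolding eqs by (rule symmetrization_odd_integrals_vanish \<sigma>x \<sigma>T)+
  \<comment> \<open>Odd moments vanish by symmetry on both sides; even ones are star-moments of the
    shifted operators.\<close>
  have mom: "(\<lambda>n. \<integral>t. t ^ k \<partial>\<mu>1_seq n) \<longlonglongrightarrow> (\<integral>t. t ^ k \<partial>\<mu>1)" for k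
  proof (cases "even k")
    case True
    then obtain j where k: "k = 2 * j" by blast
    show ?thesis
      unfolding eqs moment_symmetrization[OF \<sigma>x] moment_symmetrization[OF \<sigma>y] k
      using op_abs_moments_tendsto[OF assms(6,2,8), where k = j and z = z] by (simp add: \<sigma>_def x_def)
  next
    case False
    then show ?thesis
      unfolding eqs moment_symmetrization[OF \<sigma>x] moment_symmetrization[OF \<sigma>y] by simp
  qed
  obtain \<eta> where \<eta>: "0 < \<eta>" and gap': "\<forall>\<^sub>F n in sequentially. {-\<eta>..\<eta>} \<inter> msupp (\<mu>1_seq n) = {}"
    using gap by blast
  \<comment> \<open>The gap is known for the approximating measures only. The cut-off makes
    \<open>f\<close> continuous on the whole line, so no gap of \<open>\<mu>1\<close> has to be
    established for passing to the limit.\<close>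
  define f where "f t = 1 / max (t\<^sup>2) (\<eta>\<^sup>2)" for t
  have f: "continuous_on A f" for A
    unfolding f_def using \<eta> by (intro continuous_intros) (auto simp: max_def)
  define m F where "m = (\<integral>t. t * t \<partial>\<mu>2)" and "F = (\<integral>t. f t \<partial>\<mu>1)"
  have "m * F < 1"
    unfolding m_def F_def f_def by (rule abs_moment_product_less_1[OF bp(2,3) \<eta> z_outside])
  then have "sqrt (m * F) < 1" by simp
  have "0 \<le> m * F"
    unfolding m_def F_def f_def by (intro mult_nonneg_nonneg integral_nonneg_AE) (auto simp: le_max_iff_disj)
  then have "0 \<le> sqrt (m * F)" by simp
  \<comment> \<open>The midpoint between the limit value and 1 leaves room for the approximating
    measures, and it is positive even if m = 0.\<close>
  define q where "q = (1 + sqrt (m * F)) / 2"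
  have q: "0 < q" "q < 1" "sqrt (m * F) < q"
  proof -
    have "0 < (1 + r) / 2 \<and> (1 + r) / 2 < 1 \<and> r < (1 + r) / 2" if "r < 1" "0 \<le> r" for r :: real
      using that by auto
    from this[OF \<open>sqrt (m * F) < 1\<close> \<open>0 \<le> sqrt (m * F)\<close>]
    show "0 < q" "q < 1" "sqrt (m * F) < q" unfolding q_def by blast+
  qed
  have "(\<lambda>n. \<integral>t. f t \<partial>\<mu>1_seq n) \<longlonglongrightarrow> F"
    unfolding F_def by (rule moments_tendsto_integral_tendsto[OF bp(1,2) mom f borel_measurable_continuous_onI[OF f]])
  then have "(\<lambda>n. sqrt (m * (\<integral>t. f t \<partial>\<mu>1_seq n))) \<longlonglongrightarrow> sqrt (m * F)"
    by (intro tendsto_intros)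
  then have ev: "\<forall>\<^sub>F n in sequentially. sqrt (m * (\<integral>t. f t \<partial>\<mu>1_seq n)) < q"
    using q(3) by (rule order_tendstoD)
  from free_convolution_gap[OF q(1,2) \<eta> less_imp_le[OF R]]
  obtain \<delta> where \<delta>: "0 < \<delta>" and conv: "\<forall>\<mu> \<nu>. bounded_prob R \<mu> \<longrightarrow> odd_integrals_vanish R \<mu> \<longrightarrow>
      (AE t in \<mu>. \<eta> \<le> \<bar>t\<bar>) \<longrightarrow> bounded_prob R \<nu> \<longrightarrow> odd_integrals_vanish R \<nu> \<longrightarrow>
      sqrt (\<integral>t. inverse t * inverse t \<partial>\<mu>) * sqrt (\<integral>t. t * t \<partial>\<nu>) \<le> q \<longrightarrow>
      {-\<delta><..<\<delta>} \<inter> msupp (\<mu> \<boxplus> \<nu>) = {}"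
    by (elim exE conjE)
  \<comment> \<open>Halving passes from the open gap to a closed interval.\<close>
  have "\<forall>\<^sub>F n in sequentially. {-(\<delta>/2)..\<delta>/2} \<inter> msupp (\<mu>1_seq n \<boxplus> \<mu>2) = {}"
    using gap' ev
  proof eventually_elim
    case (elim n)
    have sets: "sets (\<mu>1_seq n) = sets borel" using bp(1) by (simp add: bounded_prob_def)
    have "emeasure (\<mu>1_seq n) {-\<eta>..\<eta>} = 0"
      by (rule disjoint_msupp_imp_null[OF _ elim(1) sets]) simp
    then have "AE t in \<mu>1_seq n. t \<notin> {-\<eta>..\<eta>}"
      by (intro AE_not_in) (simp add: null_sets_def sets)
    then have far: "AE t in \<mu>1_seq n. \<eta> \<le> \<bar>t\<bar>"
      by (rule eventually_mono) (auto simp: abs_le_iff)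
    have "(\<integral>t. inverse t * inverse t \<partial>\<mu>1_seq n) = (\<integral>t. f t \<partial>\<mu>1_seq n)"
    proof (rule integral_cong_AE)
      show "AE t in \<mu>1_seq n. inverse t * inverse t = f t"
        using far
      proof (rule eventually_mono)
        fix t assume "\<eta> \<le> \<bar>t\<bar>"
        then have "\<eta>\<^sup>2 \<le> t\<^sup>2" using \<eta> by (metis abs_le_square_iff abs_of_pos)
        then show "inverse t * inverse t = f t"
          by (simp add: f_def max_def power2_eq_square inverse_eq_divide)
      qed
    qed (rule bounded_prob_measurable[OF bp(1)], measurable, rule bounded_prob_measurable[OF bp(1)],
        rule borel_measurable_continuous_onI[OF f])
    then have "sqrt (\<integral>t. inverse t * inverse t \<partial>\<mu>1_seq n) * sqrt (\<integral>t. t * t \<partial>\<mu>2) \<le> q"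
      using elim(2) by (simp add: m_def real_sqrt_mult mult.commute)
    then have "{-\<delta><..<\<delta>} \<inter> msupp (\<mu>1_seq n \<boxplus> \<mu>2) = {}"
      by (rule conv[rule_format, OF bp(1) odd(1) far bp(3) odd(2)])
    moreover have "{-(\<delta>/2)..\<delta>/2} \<subseteq> {-\<delta><..<\<delta>}" using \<delta> by auto
    ultimately show ?case by blast
  qed
  then show ?thesis using \<delta> by (intro exI[of _ "\<delta>/2"]) simp
qed

end
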